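(* Let $T$ be a tree and let $G\le\mathrm{Aut}(T)$ be $(\mathrm{P})$-closed and strongly closed. Then the following are equivalent: (i) $G$ is a simple group, $G$ acts with translation, and there is no finite set of vertices of $T$ whose pointwise stabiliser in $G$ is trivial. (ii) There is a $G$-invariant subtree $T'$ of $T$ (possibly equal to $T$) which is infinite and on which $G$ acts faithfully. Moreover, letting $\Delta=(\Gamma,(X_a),(G(v)))$ be the local action diagram of $(T',G)$, then $\Delta$ is irreducible; $\Gamma$ is a tree; and each of the groups $G(v)$ is closed and generated by point stabilisers, with $G(v)\neq\{1\}$ for some $v\in V\Gamma$. Furthermore, in (ii) the action $(T',G)$ is $(T',\mathbf U(\Delta))$; that is, the subgroup of $\mathrm{Aut}(T')$ induced by $G$ is the universal group of $\Delta$ with respect to a $\Delta$-tree structure on $T'$.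
   Context: Graphs. A graph $\Gamma$ has a vertex set $V\Gamma$, an arc set $A\Gamma$, an origin map $o:A\Gamma\to V\Gamma$ and a reversal map $a\mapsto\overline a$ on $A\Gamma$ with $\overline{\overline a}=a$; $t(a):=o(\overline a)$. An arc with $o(a)=t(a)$ is a loop; for a loop both $\overline a=a$ and $\overline a\neq a$ are allowed. $o^{-1}(v)$ is the set of arcs with origin $v$. A tree is a nonempty connected graph without loops, multiple edges or cycles; subtrees are nonempty connected subgraphs. Permutation groups carry the permutation topology (pointwise stabilisers of finite sets form a base of neighbourhoods of the identity), and $\mathrm{Aut}(T)\le\mathrm{Sym}(VT)$ the subspace topology. $G\backslash T$ is the graph of $G$-orbits on vertices and arcs. Property $(\mathrm{P})$. For a nonempty (finite or infinite) simple path $L$ in $T$, let $\pi_L:VT\to VL$ be the closest point projection and $G_{(L)}$ the pointwise stabiliser of $L$; for $x\in VL$ let $\phi_x:G_{(L)}\to\mathrm{Sym}(\pi_L^{-1}(x))$ be given by the action. $G$ has property $(\mathrm{P})$ if for every such $L$ the homomorphism $G_{(L)}\to\prod_{x\in VL}\phi_x(G_{(L)})$ is surjective. $G$ is $(\mathrm{P})$-closed if it is closed in $\mathrm{Aut}(T)$ and has $(\mathrm{P})$. $G$ is strongly closed if for every $G$-invariant subtree $T'$ of $T$ the image of $G$ in $\mathrm{Aut}(T')$ is closed. $G$ acts with translation if some $g\in G$ preserves a two-way infinite simple path $L$, acting on $L$ as an orientation-preserving automorphism fixing no point of $L$. Local action diagrams. A local action diagram $\Delta=(\Gamma,(X_a),(G(v)))$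 consists of a connected graph $\Gamma$; nonempty pairwise disjoint sets $X_a$ $(a\in A\Gamma)$; and for each $v\in V\Gamma$ a closed subgroup $G(v)\le\mathrm{Sym}(X_v)$, $X_v=\bigsqcup_{a\in o^{-1}(v)}X_a$, whose orbits are the sets $X_a$, $a\in o^{-1}(v)$. The local action diagram of $(T,G)$ has $\Gamma=G\backslash T$ with quotient map $\pi$; one chooses $v^*\in\pi^{-1}(v)$ for each $v\in V\Gamma$, sets $X_a=\{b\in o^{-1}(v^* ):\pi(b)=a\}$ for $a\in o^{-1}(v)$, and lets $G(v)$ be the closure of the permutation group induced by $G_{v^*}$ on $X_v=o^{-1}(v^* )$. A scopo of $\Delta$ is a subset $O\subseteq A\Gamma$ such that: if $a\in O$ then $\overline a\notin O$ and $|X_a|=1$; and for all $v\in V\Gamma$, if $O$ contains an arc $a$ originating at $v$, then $O$ contains all arcs other than $\overline a$ terminating at $v$. $\Delta$ is irreducible if its only scopo is $\emptyset$. Universal group. A $\Delta$-tree is a tree $T$ with a surjective graph homomorphism $\pi:T\to\Gamma$ and a map $\mathcal L:AT\to\bigsqcup_{a\in A\Gamma}X_a$ such that for all $v\in VT$ and $a\in o^{-1}(\pi(v))$, $\mathcal L$ restricts to a bijection $\{b\in o^{-1}(v):\pi(b)=a\}\to X_a$. Let $\mathcal L_v:o^{-1}(v)\to X_{\pi(v)}$ be the resulting bijection. For $g\in\mathrm{Aut}(T)$ with $\pi\circ g=\pi$ let $\sigma_{\mathcal L,v}(g)=\mathcal L_{gv}\circ g\circ\mathcal L_v^{-1}\in\mathrm{Sym}(X_{\pi(v)})$.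 $\mathbf U(\Delta)$ is the group of all $g\in\mathrm{Aut}(T)$ with $\pi\circ g=\pi$ and $\sigma_{\mathcal L,v}(g)\in G(\pi(v))$ for all $v\in VT$; as a group acting on a tree it is independent of the $\Delta$-tree up to isomorphism of trees. *)

theory Defs
  imports "HOL-Analysis.Abstract_Topology" "HOL-Algebra.Group_Action" "HOL-Algebra.Generated_Groups"
begin

section \<open>Graphs and trees\<close>

record ('v, 'a) graph =
  verts :: "'v set"
  arcs :: "'a set"
  orig :: "'a \<Rightarrow> 'v"
  arev :: "'a \<Rightarrow> 'a"

definition terminus :: "('v, 'a) graph \<Rightarrow> 'a \<Rightarrow> 'v"
  where "terminus \<Gamma> a = orig \<Gamma> (arev \<Gamma> a)"

definition is_graph :: "('v, 'a) graph \<Rightarrow> bool"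
  where "is_graph \<Gamma> \<longleftrightarrow>
    orig \<Gamma> \<in> arcs \<Gamma> \<rightarrow> verts \<Gamma> \<and> arev \<Gamma> \<in> arcs \<Gamma> \<rightarrow> arcs \<Gamma> \<and>
    (\<forall>a\<in>arcs \<Gamma>. arev \<Gamma> (arev \<Gamma> a) = a)"

definition out_arcs :: "('v, 'a) graph \<Rightarrow> 'v \<Rightarrow> 'a set"
  where "out_arcs \<Gamma> v = {a \<in> arcs \<Gamma>. orig \<Gamma> a = v}"

definition adj :: "('v, 'a) graph \<Rightarrow> ('v \<times> 'v) set"
  where "adj \<Gamma> = {(orig \<Gamma> a, terminus \<Gamma> a) | a. a \<in> arcs \<Gamma>}"

definition connected_graph :: "('v, 'a) graph \<Rightarrow> bool"
  where "connected_graph \<Gamma> \<longleftrightarrow> (\<forall>u\<in>verts \<Gamma>. \<forall>v\<in>verts \<Gamma>. (u, v) \<in> (adj \<Gamma>)\<^sup>*)"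

definition has_loop :: "('v, 'a) graph \<Rightarrow> bool"
  where "has_loop \<Gamma> \<longleftrightarrow> (\<exists>a\<in>arcs \<Gamma>. orig \<Gamma> a = terminus \<Gamma> a)"

definition has_multiple_edge :: "('v, 'a) graph \<Rightarrow> bool"
  where "has_multiple_edge \<Gamma> \<longleftrightarrow>
    (\<exists>a\<in>arcs \<Gamma>. \<exists>b\<in>arcs \<Gamma>. a \<noteq> b \<and> orig \<Gamma> a = orig \<Gamma> b \<and> terminus \<Gamma> a = terminus \<Gamma> b)"

text \<open>Cycles of length 1 and 2 are loops and multiple edges.\<close>

definition has_cycle :: "('v, 'a) graph \<Rightarrow> bool"
  where "has_cycle \<Gamma> \<longleftrightarrow>
    (\<exists>vs. 3 \<le> length vs \<and> distinct vs \<and>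
      (\<forall>i<length vs. (vs ! i, vs ! (Suc i mod length vs)) \<in> adj \<Gamma>))"

definition is_tree :: "('v, 'a) graph \<Rightarrow> bool"
  where "is_tree T \<longleftrightarrow>
    is_graph T \<and> verts T \<noteq> {} \<and> connected_graph T \<and>
    \<not> has_loop T \<and> \<not> has_multiple_edge T \<and> \<not> has_cycle T"

text \<open>The maps of a subgraph are those of the ambient graph as total functions; their values
  outside the arc set are irrelevant, so every subgraph has exactly one representation.\<close>

definition subgraph :: "('v, 'a) graph \<Rightarrow> ('v, 'a) graph \<Rightarrow> bool"
  where "subgraph H \<Gamma> \<longleftrightarrow>
    is_graph H \<and> verts H \<subseteq> verts \<Gamma> \<and> arcs H \<subseteq> arcs \<Gamma> \<and> orig H = orig \<Gamma> \<and> arev H = arev \<Gamma>"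

definition subtree :: "('v, 'a) graph \<Rightarrow> ('v, 'a) graph \<Rightarrow> bool"
  where "subtree T' T \<longleftrightarrow> subgraph T' T \<and> verts T' \<noteq> {} \<and> connected_graph T'"

definition graph_dist :: "('v, 'a) graph \<Rightarrow> 'v \<Rightarrow> 'v \<Rightarrow> nat"
  where "graph_dist \<Gamma> u v = (LEAST n. (u, v) \<in> adj \<Gamma> ^^ n)"

text \<open>A simple path is parametrised by a nonempty interval of integers, so that finite, one-way
  infinite and two-way infinite paths are treated uniformly.\<close>

definition simple_path :: "('v, 'a) graph \<Rightarrow> int set \<Rightarrow> (int \<Rightarrow> 'v) \<Rightarrow> bool"
  where "simple_path \<Gamma> I p \<longleftrightarrow>
    I \<noteq> {} \<and> (\<forall>i\<in>I. \<forall>k\<in>I. {i..k} \<subseteq> I) \<and> p ` I \<subseteq> verts \<Gamma> \<and> inj_on p I \<and>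
    (\<forall>i. i \<in> I \<and> i + 1 \<in> I \<longrightarrow> (p i, p (i + 1)) \<in> adj \<Gamma>)"


section \<open>Permutation groups\<close>

definition fixator :: "('x \<Rightarrow> 'x) set \<Rightarrow> 'x set \<Rightarrow> ('x \<Rightarrow> 'x) set"
  where "fixator G F = {g \<in> G. \<forall>x\<in>F. g x = x}"

text \<open>The permutation topology on the symmetric group: the group topology in which the pointwise
  stabilisers of finite sets form a base of neighbourhoods of the identity.\<close>

definition perm_topology :: "'x set \<Rightarrow> ('x \<Rightarrow> 'x) topology"
  where "perm_topology X = topology (\<lambda>U. U \<subseteq> Bij X \<and>
    (\<forall>g\<in>U. \<exists>F. finite F \<and> F \<subseteq> X \<and> g <#\<^bsub>BijGroup X\<^esub> fixator (Bij X) F \<subseteq> U))"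

lemma openin_perm_topology:
  "openin (perm_topology X) U \<longleftrightarrow> U \<subseteq> Bij X \<and>
    (\<forall>g\<in>U. \<exists>F. finite F \<and> F \<subseteq> X \<and> g <#\<^bsub>BijGroup X\<^esub> fixator (Bij X) F \<subseteq> U)"
proof -
  have "istopology (\<lambda>U. U \<subseteq> Bij X \<and>
    (\<forall>g\<in>U. \<exists>F. finite F \<and> F \<subseteq> X \<and> g <#\<^bsub>BijGroup X\<^esub> fixator (Bij X) F \<subseteq> U))" (is "istopology ?P")
    unfolding istopology_def
  proof (intro conjI allI impI)
    fix S T assume S: "?P S" and T: "?P T"
    show "S \<inter> T \<subseteq> Bij X" using S by blast
    show "\<forall>g\<in>S \<inter> T. \<exists>F. finite F \<and> F \<subseteq> X \<and> g <#\<^bsub>BijGroup X\<^esub> fixator (Bij X) F \<subseteq> S \<inter> T"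
    proof
      fix g assume "g \<in> S \<inter> T"
      then obtain F F' where
        "finite F" "F \<subseteq> X" "g <#\<^bsub>BijGroup X\<^esub> fixator (Bij X) F \<subseteq> S"
        "finite F'" "F' \<subseteq> X" "g <#\<^bsub>BijGroup X\<^esub> fixator (Bij X) F' \<subseteq> T"
        using S T by (meson IntD1 IntD2)
      moreover have "g <#\<^bsub>BijGroup X\<^esub> fixator (Bij X) (F \<union> F') \<subseteq> g <#\<^bsub>BijGroup X\<^esub> fixator (Bij X) F"
        "g <#\<^bsub>BijGroup X\<^esub> fixator (Bij X) (F \<union> F') \<subseteq> g <#\<^bsub>BijGroup X\<^esub> fixator (Bij X) F'"
        unfolding l_coset_def fixator_def by auto
      ultimately show "\<exists>F. finite F \<and> F \<subseteq> X \<and> g <#\<^bsub>BijGroup X\<^esub> fixator (Bij X) F \<subseteq> S \<inter> T"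
        by (intro exI[of _ "F \<union> F'"]) blast
    qed
  next
    fix \<K> assume K: "\<forall>S\<in>\<K>. ?P S"
    show "\<Union>\<K> \<subseteq> Bij X" using K by blast
    show "\<forall>g\<in>\<Union>\<K>. \<exists>F. finite F \<and> F \<subseteq> X \<and> g <#\<^bsub>BijGroup X\<^esub> fixator (Bij X) F \<subseteq> \<Union>\<K>"
      using K by (meson UnionE Union_upper order_trans)
  qed
  then show ?thesis
    by (simp add: perm_topology_def topology_inverse')
qed

lemma topspace_perm_topology [simp]: "topspace (perm_topology X) = Bij X"
proof -
  have "openin (perm_topology X) (Bij X)"
    unfolding openin_perm_topology l_coset_def fixator_def
    by (auto simp: BijGroup_def compose_Bij intro!: exI[of _ "{}"])
  then show ?thesis
    by (metis openin_perm_topology openin_subset openin_topspace subset_antisym)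
qed

definition generated_by_point_stabilisers :: "'x set \<Rightarrow> ('x \<Rightarrow> 'x) set \<Rightarrow> bool"
  where "generated_by_point_stabilisers X H \<longleftrightarrow>
    generate (BijGroup X) (\<Union>x\<in>X. fixator H {x}) = H"

text \<open>The locale \<open>simple_group\<close> of HOL-Algebra demands \<open>order G > 1\<close>, which fails for every infinite
  group because the cardinality of an infinite set is 0.\<close>

definition is_simple :: "('g, 'm) monoid_scheme \<Rightarrow> bool"
  where "is_simple G \<longleftrightarrow>
    group G \<and> carrier G \<noteq> {\<one>\<^bsub>G\<^esub>} \<and> (\<forall>N. N \<lhd> G \<longrightarrow> N = carrier G \<or> N = {\<one>\<^bsub>G\<^esub>})"


section \<open>Groups of tree automorphisms\<close>

text \<open>An automorphism is given by its action on vertices. Since a tree has no multiple edges, this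
  determines the action on arcs, which is \<open>arc_map\<close>.\<close>

definition aut :: "('v, 'a) graph \<Rightarrow> ('v \<Rightarrow> 'v) set"
  where "aut T = {g \<in> Bij (verts T). \<exists>\<alpha>\<in>Bij (arcs T). \<forall>a\<in>arcs T.
    orig T (\<alpha> a) = g (orig T a) \<and> \<alpha> (arev T a) = arev T (\<alpha> a)}"

definition arc_map :: "('v, 'a) graph \<Rightarrow> ('v \<Rightarrow> 'v) \<Rightarrow> 'a \<Rightarrow> 'a"
  where "arc_map T g = (\<lambda>a\<in>arcs T.
    THE b. b \<in> arcs T \<and> orig T b = g (orig T a) \<and> terminus T b = g (terminus T a))"

definition perm_group :: "'v set \<Rightarrow> ('v \<Rightarrow> 'v) set \<Rightarrow> ('v \<Rightarrow> 'v) monoid"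
  where "perm_group X G = BijGroup X\<lparr>carrier := G\<rparr>"

definition aut_group :: "('v, 'a) graph \<Rightarrow> ('v \<Rightarrow> 'v) monoid"
  where "aut_group T = perm_group (verts T) (aut T)"

definition aut_topology :: "('v, 'a) graph \<Rightarrow> ('v \<Rightarrow> 'v) topology"
  where "aut_topology T = subtopology (perm_topology (verts T)) (aut T)"

definition invariant_subtree :: "('v, 'a) graph \<Rightarrow> ('v \<Rightarrow> 'v) set \<Rightarrow> ('v, 'a) graph \<Rightarrow> bool"
  where "invariant_subtree T G T' \<longleftrightarrow> subtree T' T \<and>
    (\<forall>g\<in>G. g ` verts T' = verts T' \<and> arc_map T g ` arcs T' = arcs T')"

definition induced_on :: "('v, 'a) graph \<Rightarrow> ('v \<Rightarrow> 'v) set \<Rightarrow> ('v \<Rightarrow> 'v) set"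
  where "induced_on T' G = (\<lambda>g. restrict g (verts T')) ` G"

definition closest_vertex :: "('v, 'a) graph \<Rightarrow> 'v set \<Rightarrow> 'v \<Rightarrow> 'v"
  where "closest_vertex T L v = arg_min_on (graph_dist T v) L"

definition proj_fibre :: "('v, 'a) graph \<Rightarrow> 'v set \<Rightarrow> 'v \<Rightarrow> 'v set"
  where "proj_fibre T L x = {v \<in> verts T. closest_vertex T L v = x}"

definition property_P :: "('v, 'a) graph \<Rightarrow> ('v \<Rightarrow> 'v) set \<Rightarrow> bool"
  where "property_P T G \<longleftrightarrow> (\<forall>I p. simple_path T I p \<longrightarrow>
    (let L = p ` I; \<phi> = (\<lambda>x g. restrict g (proj_fibre T L x))
     in (\<lambda>g. \<lambda>x\<in>L. \<phi> x g) ` fixator G L = (\<Pi>\<^sub>E x\<in>L. \<phi> x ` fixator G L)))"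

definition P_closed :: "('v, 'a) graph \<Rightarrow> ('v \<Rightarrow> 'v) set \<Rightarrow> bool"
  where "P_closed T G \<longleftrightarrow> closedin (aut_topology T) G \<and> property_P T G"

definition strongly_closed :: "('v, 'a) graph \<Rightarrow> ('v \<Rightarrow> 'v) set \<Rightarrow> bool"
  where "strongly_closed T G \<longleftrightarrow>
    (\<forall>T'. invariant_subtree T G T' \<longrightarrow> closedin (aut_topology T') (induced_on T' G))"

text \<open>The clause with \<open>i\<close> and \<open>j\<close> says that \<open>g\<close> preserves the orientation of the path.\<close>

definition acts_with_translation :: "('v, 'a) graph \<Rightarrow> ('v \<Rightarrow> 'v) set \<Rightarrow> bool"
  where "acts_with_translation T G \<longleftrightarrow> (\<exists>g\<in>G. \<exists>p. simple_path T UNIV p \<and>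
    g ` range p = range p \<and>
    (\<forall>i. \<exists>j. g (p i) = p j \<and> g (p (i + 1)) = p (j + 1)) \<and>
    (\<forall>i. g (p i) \<noteq> p i))"


section \<open>Local action diagrams\<close>

record ('v, 'a, 'x) diagram =
  base :: "('v, 'a) graph"
  colours :: "'a \<Rightarrow> 'x set"
  local_group :: "'v \<Rightarrow> ('x \<Rightarrow> 'x) set"

definition colours_at :: "('v, 'a, 'x) diagram \<Rightarrow> 'v \<Rightarrow> 'x set"
  where "colours_at \<Delta> v = (\<Union>a\<in>out_arcs (base \<Delta>) v. colours \<Delta> a)"

text \<open>An arc of the quotient graph is an orbit of arcs; its origin and its reverse are the images
  of this orbit under the origin and reversal maps.\<close>

definition quotient_graph :: "('v, 'a) graph \<Rightarrow> ('v \<Rightarrow> 'v) set \<Rightarrow> ('v set, 'a set) graph"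
  where "quotient_graph T G =
    \<lparr>verts = orbits (perm_group (verts T) G) (verts T) (\<lambda>g. g),
     arcs = orbits (perm_group (verts T) G) (arcs T) (arc_map T),
     orig = (\<lambda>A. orig T ` A),
     arev = (\<lambda>A. arev T ` A)\<rparr>"

text \<open>The function \<open>rep\<close> chooses the representative \<open>v\<^sup>*\<close> of each vertex orbit \<open>v\<close>. The set \<open>X\<^sub>a\<close>
  consists of the arcs of \<open>T\<close> with origin \<open>v\<^sup>*\<close> in the orbit \<open>a\<close>, where \<open>v\<close> is the origin of \<open>a\<close>.\<close>

definition local_action_diagram ::
    "('v, 'a) graph \<Rightarrow> ('v \<Rightarrow> 'v) set \<Rightarrow> ('v set \<Rightarrow> 'v) \<Rightarrow> ('v set, 'a set, 'a) diagram"
  where "local_action_diagram T G rep =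
    \<lparr>base = quotient_graph T G,
     colours = (\<lambda>a. {b \<in> out_arcs T (rep (orig (quotient_graph T G) a)).
                       orbit (perm_group (verts T) G) (arc_map T) b = a}),
     local_group = (\<lambda>v. perm_topology (out_arcs T (rep v)) closure_of
       ((\<lambda>g. restrict (arc_map T g) (out_arcs T (rep v))) ` fixator G {rep v}))\<rparr>"

definition scopo :: "('v, 'a, 'x) diagram \<Rightarrow> 'a set \<Rightarrow> bool"
  where "scopo \<Delta> S \<longleftrightarrow> S \<subseteq> arcs (base \<Delta>) \<and>
    (\<forall>a\<in>S. arev (base \<Delta>) a \<notin> S \<and> card (colours \<Delta> a) = 1) \<and>
    (\<forall>v\<in>verts (base \<Delta>). \<forall>a\<in>S. orig (base \<Delta>) a = v \<longrightarrow>
      {b \<in> arcs (base \<Delta>). terminus (base \<Delta>) b = v \<and> b \<noteq> arev (base \<Delta>) a} \<subseteq> S)"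

definition irreducible_diagram :: "('v, 'a, 'x) diagram \<Rightarrow> bool"
  where "irreducible_diagram \<Delta> \<longleftrightarrow> (\<forall>S. scopo \<Delta> S \<longrightarrow> S = {})"


section \<open>Universal groups\<close>

definition surj_graph_hom ::
    "('u, 'b) graph \<Rightarrow> ('v, 'a) graph \<Rightarrow> ('u \<Rightarrow> 'v) \<Rightarrow> ('b \<Rightarrow> 'a) \<Rightarrow> bool"
  where "surj_graph_hom T \<Gamma> \<pi>V \<pi>A \<longleftrightarrow>
    \<pi>V ` verts T = verts \<Gamma> \<and> \<pi>A ` arcs T = arcs \<Gamma> \<and>
    (\<forall>b\<in>arcs T. orig \<Gamma> (\<pi>A b) = \<pi>V (orig T b) \<and> \<pi>A (arev T b) = arev \<Gamma> (\<pi>A b))"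

definition diagram_tree ::
    "('v, 'a, 'x) diagram \<Rightarrow> ('u, 'b) graph \<Rightarrow> ('u \<Rightarrow> 'v) \<Rightarrow> ('b \<Rightarrow> 'a) \<Rightarrow> ('b \<Rightarrow> 'x) \<Rightarrow> bool"
  where "diagram_tree \<Delta> T \<pi>V \<pi>A \<L> \<longleftrightarrow>
    is_tree T \<and> surj_graph_hom T (base \<Delta>) \<pi>V \<pi>A \<and>
    \<L> \<in> arcs T \<rightarrow> (\<Union>a\<in>arcs (base \<Delta>). colours \<Delta> a) \<and>
    (\<forall>v\<in>verts T. \<forall>a\<in>out_arcs (base \<Delta>) (\<pi>V v).
      bij_betw \<L> {b \<in> out_arcs T v. \<pi>A b = a} (colours \<Delta> a))"

definition local_action ::
    "('v, 'a, 'x) diagram \<Rightarrow> ('u, 'b) graph \<Rightarrow> ('u \<Rightarrow> 'v) \<Rightarrow> ('b \<Rightarrow> 'x) \<Rightarrow> 'u \<Rightarrow> ('u \<Rightarrow> 'u) \<Rightarrow> 'x \<Rightarrow> 'x"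
  where "local_action \<Delta> T \<pi>V \<L> v g =
    (\<lambda>x\<in>colours_at \<Delta> (\<pi>V v). \<L> (arc_map T g (inv_into (out_arcs T v) \<L> x)))"

definition universal_group ::
    "('v, 'a, 'x) diagram \<Rightarrow> ('u, 'b) graph \<Rightarrow> ('u \<Rightarrow> 'v) \<Rightarrow> ('b \<Rightarrow> 'a) \<Rightarrow> ('b \<Rightarrow> 'x) \<Rightarrow> ('u \<Rightarrow> 'u) set"
  where "universal_group \<Delta> T \<pi>V \<pi>A \<L> = {g \<in> aut T.
    (\<forall>v\<in>verts T. \<pi>V (g v) = \<pi>V v) \<and> (\<forall>b\<in>arcs T. \<pi>A (arc_map T g b) = \<pi>A b) \<and>
    (\<forall>v\<in>verts T. local_action \<Delta> T \<pi>V \<L> v g \<in> local_group \<Delta> (\<pi>V v))}"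


definition simplicity_subtree ::
    "('v, 'a) graph \<Rightarrow> ('v \<Rightarrow> 'v) set \<Rightarrow> ('v set \<Rightarrow> 'v) \<Rightarrow> ('v, 'a) graph \<Rightarrow> bool"
  where "simplicity_subtree T G rep T' \<longleftrightarrow>
    invariant_subtree T G T' \<and> infinite (verts T') \<and>
    faithful_action (perm_group (verts T) G) (verts T') (\<lambda>g. restrict g (verts T')) \<and>
    (let \<Delta> = local_action_diagram T' (induced_on T' G) rep; \<Gamma> = base \<Delta> in
      irreducible_diagram \<Delta> \<and> is_tree \<Gamma> \<and>
      (\<forall>v\<in>verts \<Gamma>. closedin (perm_topology (colours_at \<Delta> v)) (local_group \<Delta> v) \<and>
        generated_by_point_stabilisers (colours_at \<Delta> v) (local_group \<Delta> v)) \<and>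
      (\<exists>v\<in>verts \<Gamma>. local_group \<Delta> v \<noteq> {\<one>\<^bsub>BijGroup (colours_at \<Delta> v)\<^esub>}))"

end

(*
For (ii) ==> (i), irreducibility of the diagram forbids invariant orientations of the kind that a
proper invariant subtree or a fixed end would produce; two applications of this show that any
half-tree can be moved into any other one. A non-trivial normal subgroup N then contains a
hyperbolic n together with a half-tree S whose translates under powers of n are pairwise disjoint.
Every f supported on S is a commutator of n with an infinite product of conjugates of f, which lies
in the closed group G; so N contains all half-tree fixators, hence by (P) all arc stabilisers,
hence (local groups generated by point stabilisers) all vertex stabilisers, hence (the quotient
graph is a tree) all of G.

For (i) ==> (ii), take the smallest invariant subtree containing the axis of a translation. Each
condition on the diagram is obtained in the same way: if it fails, functions on the vertices (a
2-colouring that changes across a chosen orbit of edges, a height function towards a fixed end, a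
flat section of cosets) are determined by their value at one vertex, so some vertex stabiliser acts
trivially on them; by simplicity G acts trivially, a contradiction.
*)

theory Submission
  imports Defs
begin

section \<open>Trees\<close>

text \<open>The arguments run on the adjacency relation of a tree and on permutations extended by
  the identity off the vertex set; arcs return only for the quotient graph and the local actions.
  The unit of geometry is the half-tree \<open>half x y\<close>, the side of \<open>y\<close> of the
  edge from \<open>x\<close> to \<open>y\<close>. For a path with one edge, (P) says that an element
  fixing the edge may be replaced by the identity on one side. With closedness this allows gluing
  branch by branch, and it makes membership in \<open>G\<close> a local property, which is the
  reason why \<open>G\<close> is a universal group. Strong closedness carries closedness over to the
  group induced on a subtree. A scopo lifts to an invariant set of arcs of the tree with at most one
  arc leaving each vertex. If every vertex has such an arc, they point to a fixed end; otherwise the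
  vertices without one span an invariant subtree, a proper one unless the set is empty. In (i) ==>
  (ii) simplicity turns one non-trivial element with trivial action into triviality of the whole
  action; the condition on finite sets supplies this element, as it makes every vertex stabiliser
  non-trivial.\<close>

lemma distinct_path_exists:
  assumes "(a, b) \<in> R\<^sup>*"
  shows "\<exists>xs. xs \<noteq> [] \<and> hd xs = a \<and> last xs = b \<and> distinct xs \<and> successively (\<lambda>x y. (x, y) \<in> R) xs"
  using assms
proof (induction rule: converse_rtrancl_induct)
  case base
  show ?case by (rule exI[of _ "[b]"]) simp
next
  case (step y z)
  then obtain xs where xs: "xs \<noteq> []" "hd xs = z" "last xs = b" "distinct xs"
    "successively (\<lambda>x y. (x, y) \<in> R) xs" by blast
  show ?case
  proof (cases "y \<in> set xs")
    case True
    then obtain ys zs where "xs = ys @ y # zs" by (meson split_list)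
    then show ?thesis using xs
      by (intro exI[of _ "y # zs"]) (auto simp: successively_append_iff)
  next
    case False
    obtain x ys where "xs = x # ys" using xs(1) by (cases xs) auto
    then show ?thesis using xs step.hyps(1) False
      by (intro exI[of _ "y # xs"]) simp
  qed
qed

text \<open>Pairs of adjacent vertices stand for arcs, which loses nothing because a tree has no
  multiple edges. The axiom \<open>no_cycle\<close> mirrors the negation of
  \<open>has_cycle\<close>; it speaks of lists of distinct vertices, so walks have to be made simple
  before it applies.\<close>

locale tree_rel =
  fixes V :: "'v set" and E :: "('v \<times> 'v) set"
  assumes E_sub: "E \<subseteq> V \<times> V"
    and E_sym: "(x, y) \<in> E \<Longrightarrow> (y, x) \<in> E"
    and E_irrefl: "(x, x) \<notin> E"
    and conn: "x \<in> V \<Longrightarrow> y \<in> V \<Longrightarrow> (x, y) \<in> E\<^sup>*"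
    and no_cycle: "3 \<le> length vs \<Longrightarrow> distinct vs \<Longrightarrow>
      \<exists>i<length vs. (vs ! i, vs ! (Suc i mod length vs)) \<notin> E"
begin

lemma E_V: "(x, y) \<in> E \<Longrightarrow> x \<in> V" "(x, y) \<in> E \<Longrightarrow> y \<in> V"
  using E_sub by auto

lemma tree_induct [consumes 2, case_names root step]:
  assumes "r \<in> V" "z \<in> V" "P r" "\<And>x y. (x, y) \<in> E \<Longrightarrow> P x \<Longrightarrow> P y"
  shows "P z"
proof -
  have "(r, z) \<in> E\<^sup>*" using conn assms by blast
  then show ?thesis by (induction) (use assms in auto)
qed

section \<open>Distances and parents\<close>

definition dist :: "'v \<Rightarrow> 'v \<Rightarrow> nat"
  where "dist x y = (LEAST n. (x, y) \<in> E ^^ n)"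

lemma relpow_dist: "x \<in> V \<Longrightarrow> y \<in> V \<Longrightarrow> (x, y) \<in> E ^^ dist x y"
  unfolding dist_def by (rule LeastI_ex) (use conn rtrancl_imp_relpow in blast)

lemma dist_le: "(x, y) \<in> E ^^ n \<Longrightarrow> dist x y \<le> n"
  unfolding dist_def by (rule Least_le)

lemma dist_refl [simp]: "dist x x = 0"
  using dist_le[of x x 0] by simp

lemma dist_0_iff: "x \<in> V \<Longrightarrow> y \<in> V \<Longrightarrow> dist x y = 0 \<longleftrightarrow> x = y"
  using relpow_dist[of x y] by force

lemma relpow_sym: "(x, y) \<in> E ^^ n \<Longrightarrow> (y, x) \<in> E ^^ n"
proof (induction n arbitrary: y)
  case (Suc n)
  then obtain w where "(x, w) \<in> E ^^ n" "(w, y) \<in> E" by auto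
  then show ?case using Suc.IH E_sym relpow_Suc_I2 by metis
qed simp

lemma dist_sym: "x \<in> V \<Longrightarrow> y \<in> V \<Longrightarrow> dist x y = dist y x"
  by (meson dist_le le_antisym relpow_dist relpow_sym)

lemma dist_tri: "x \<in> V \<Longrightarrow> y \<in> V \<Longrightarrow> z \<in> V \<Longrightarrow> dist x z \<le> dist x y + dist y z"
  by (rule dist_le) (use relpow_dist in \<open>auto simp: relpow_add intro: relcomp.relcompI\<close>)

lemma dist_edge: "(x, y) \<in> E \<Longrightarrow> dist x y = 1"
proof -
  assume e: "(x, y) \<in> E"
  then have "dist x y \<le> 1" using dist_le[of x y 1] by simp
  moreover have "dist x y \<noteq> 0" using e dist_0_iff E_V E_irrefl by metis
  ultimately show ?thesis by simp
qed

lemma dist_step: "r \<in> V \<Longrightarrow> (x, y) \<in> E \<Longrightarrow> dist r y \<le> Suc (dist r x)"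
  using dist_tri[of r x y] dist_edge[of x y] E_V by fastforce

lemma parent_ex:
  assumes "r \<in> V" "x \<in> V" "x \<noteq> r"
  shows "\<exists>y. (x, y) \<in> E \<and> Suc (dist r y) = dist r x"
proof -
  have "dist r x \<noteq> 0" using assms dist_0_iff by blast
  then obtain n where n: "dist r x = Suc n" using not0_implies_Suc by blast
  then obtain y where y: "(r, y) \<in> E ^^ n" "(y, x) \<in> E"
    using relpow_dist[OF assms(1,2)] by auto
  have "dist r y \<le> n" using dist_le y by blast
  moreover have "dist r x \<le> Suc (dist r y)" using dist_step assms y by blast
  ultimately show ?thesis using n y E_sym by (intro exI[of _ y]) auto
qed

text \<open>A simple path from \<open>y\<close> to \<open>y'\<close> off \<open>x\<close> closes up
  through \<open>x\<close> to a cycle. It has at least two vertices because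
  \<open>y \<noteq> y'\<close>, which gives the length 3 that \<open>no_cycle\<close> asks
  for.\<close>

lemma deleted_vertex_disconnects:
  assumes "(x, y) \<in> E" "(x, y') \<in> E" "(y, y') \<in> (E \<inter> (V - {x}) \<times> (V - {x}))\<^sup>*"
  shows "y = y'"
proof (rule ccontr)
  assume ne: "y \<noteq> y'"
  let ?R = "E \<inter> (V - {x}) \<times> (V - {x})"
  obtain xs where xs: "xs \<noteq> []" "hd xs = y" "last xs = y'" "distinct xs"
    "successively (\<lambda>a b. (a, b) \<in> ?R) xs"
    using distinct_path_exists[OF assms(3)] by blast
  have len: "2 \<le> length xs" using xs ne by (cases xs; cases "tl xs") auto
  have succ: "(xs ! i, xs ! Suc i) \<in> ?R" if "Suc i < length xs" for i
    using xs(5) that by (auto simp: successively_conv_nth)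
  have x: "x \<notin> set xs"
  proof
    assume "x \<in> set xs"
    then obtain i where i: "i < length xs" "xs ! i = x" by (auto simp: in_set_conv_nth)
    show False
      using succ[of i] succ[of "i - 1"] i len by (cases "Suc i < length xs") auto
  qed
  let ?vs = "x # xs"
  have "\<exists>i<length ?vs. (?vs ! i, ?vs ! (Suc i mod length ?vs)) \<notin> E"
    by (rule no_cycle) (use len xs x in auto)
  then obtain i where i: "i < length ?vs" "(?vs ! i, ?vs ! (Suc i mod length ?vs)) \<notin> E" by blast
  show False
  proof (cases i)
    case 0
    then show False using i len assms(1) xs by (auto simp: hd_conv_nth)
  next
    case (Suc j)
    show False
    proof (cases "Suc i < length ?vs")
      case True
      then show False using i Suc succ[of j] by auto
    next
      case False
      then have "Suc i = length ?vs" using i by auto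
      then show False using i Suc xs E_sym[OF assms(2)] by (auto simp: last_conv_nth)
    qed
  qed
qed

text \<open>Following parents from \<open>y\<close> to \<open>r\<close> strictly lowers the distance
  to \<open>r\<close>, which starts at most at that of \<open>x\<close>. So \<open>x\<close> is met
  neither at the start, where it is excluded, nor later.\<close>

lemma geodesic_avoids:
  assumes "r \<in> V" "x \<in> V" "y \<in> V" "y \<noteq> x" "dist r y \<le> dist r x" "x \<noteq> r"
  shows "(y, r) \<in> (E \<inter> (V - {x}) \<times> (V - {x}))\<^sup>*"
  using assms(3-5)
proof (induction "dist r y" arbitrary: y rule: less_induct)
  case less
  show ?case
  proof (cases "y = r")
    case False
    then obtain z where z: "(y, z) \<in> E" "Suc (dist r z) = dist r y"
      using parent_ex assms less by blast
    have "z \<noteq> x" using z less by auto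
    then have "(z, r) \<in> (E \<inter> (V - {x}) \<times> (V - {x}))\<^sup>*" using less z E_V by auto
    moreover have "(y, z) \<in> E \<inter> (V - {x}) \<times> (V - {x})" using z less \<open>z \<noteq> x\<close> E_V by auto
    ultimately show ?thesis by (rule converse_rtrancl_into_rtrancl[rotated])
  qed auto
qed

text \<open>Both neighbours are joined to \<open>r\<close> without passing through \<open>x\<close>,
  so \<open>deleted_vertex_disconnects\<close> identifies them. This is the form in which acyclicity
  is used below: a path backtracks wherever its distance to a point has a maximum.\<close>

lemma unique_parent:
  assumes "r \<in> V" "(x, y) \<in> E" "(x, y') \<in> E" "dist r y \<le> dist r x" "dist r y' \<le> dist r x"
  shows "y = y'"
proof (cases "x = r")
  case True
  then show ?thesis using assms dist_0_iff[OF assms(1)] E_V by auto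
next
  case False
  let ?R = "E \<inter> (V - {x}) \<times> (V - {x})"
  have *: "(y, r) \<in> ?R\<^sup>*" "(y', r) \<in> ?R\<^sup>*"
    by (rule geodesic_avoids; use assms E_V E_irrefl False in blast)+
  have "sym ?R" by (auto simp: sym_def E_sym)
  then have "(r, y') \<in> ?R\<^sup>*" using symD[OF sym_rtrancl *(2)] by blast
  then have "(y, y') \<in> ?R\<^sup>*" by (rule rtrancl_trans[OF *(1)])
  then show ?thesis by (rule deleted_vertex_disconnects[OF assms(2,3)])
qed

text \<open>If the two distances were equal, \<open>y\<close> would be a second candidate for the
  parent of \<open>x\<close>.\<close>

lemma dist_step_cases:
  assumes "r \<in> V" "(x, y) \<in> E"
  shows "dist r y = Suc (dist r x) \<or> dist r x = Suc (dist r y)"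
proof (rule ccontr)
  assume c: "\<not> ?thesis"
  have "dist r y \<le> Suc (dist r x)" "dist r x \<le> Suc (dist r y)"
    using dist_step assms E_sym by blast+
  then have eq: "dist r x = dist r y" using c by linarith
  show False
  proof (cases "x = r")
    case True
    then show False using eq assms dist_0_iff E_V E_irrefl by (metis dist_refl)
  next
    case False
    then obtain z where z: "(x, z) \<in> E" "Suc (dist r z) = dist r x"
      using parent_ex assms E_V by blast
    then have "z = y" using unique_parent[of r x z y] assms eq by auto
    then show False using z eq by auto
  qed
qed

lemma nonparent_dist:
  assumes "r \<in> V" "(x, y) \<in> E" "(x, z) \<in> E" "dist r y \<le> dist r x" "z \<noteq> y"
  shows "dist r z = Suc (dist r x)"
proof -
  have "\<not> dist r z \<le> dist r x" using assms unique_parent[of r x y z] by auto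
  then show ?thesis using dist_step_cases[OF assms(1,3)] by linarith
qed

section \<open>Half-trees\<close>

definition half :: "'v \<Rightarrow> 'v \<Rightarrow> 'v set"
  where "half x y = {z \<in> V. dist z y < dist z x}"

lemma half_sub: "half x y \<subseteq> V" by (auto simp: half_def)

lemma half_ends: assumes "(x, y) \<in> E" shows "y \<in> half x y" "x \<notin> half x y"
  using assms dist_edge[OF E_sym[OF assms]] E_V by (auto simp: half_def)

lemma half_compl: "(x, y) \<in> E \<Longrightarrow> half y x = V - half x y"
  using dist_step_cases unfolding half_def by fastforce

lemma half_iff: "(x, y) \<in> E \<Longrightarrow> z \<in> V \<Longrightarrow> z \<in> half x y \<longleftrightarrow> z \<notin> half y x"
  using half_compl[of x y] by auto

lemma half_dist: "(x, y) \<in> E \<Longrightarrow> z \<in> half x y \<Longrightarrow> dist z x = Suc (dist z y)"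
  using dist_step_cases unfolding half_def by fastforce

lemma half_crossing:
  assumes "(x, y) \<in> E" "(z, w) \<in> E" "z \<in> half x y" "w \<notin> half x y"
  shows "z = y \<and> w = x"
proof -
  have V: "x \<in> V" "y \<in> V" "z \<in> V" "w \<in> V" using assms E_V by auto
  have w: "w \<in> half y x" using assms half_compl V by auto
  have 1: "dist z x = Suc (dist z y)" "dist w y = Suc (dist w x)"
    using half_dist E_sym assms w by blast+
  have 2: "dist y z = dist z y" "dist y w = dist w y" "dist x z = dist z x" "dist x w = dist w x"
    using V dist_sym by auto
  have 3: "dist y w \<le> Suc (dist y z)" "dist x z \<le> Suc (dist x w)"
    using dist_step V assms E_sym by blast+
  have eq: "dist w x = dist z y" using 1 2 3 by linarith
  show ?thesis
  proof (cases "z = y")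
    case True
    then show ?thesis using eq dist_0_iff V by (metis dist_refl)
  next
    case False
    \<comment> \<open>With \<open>z'\<close> the next vertex from \<open>z\<close> towards
      \<open>y\<close>, both \<open>z'\<close> and \<open>w\<close> are neighbours of
      \<open>z\<close> that are no farther from \<open>x\<close> than \<open>z\<close> is.
      Uniqueness gives \<open>z' = w\<close>, against the distances of these vertices to
      \<open>y\<close>.\<close>
    then obtain z' where z': "(z, z') \<in> E" "Suc (dist y z') = dist y z"
      using parent_ex V by blast
    have "dist x z' \<le> Suc (dist y z')"
      using dist_tri[of x y z'] dist_edge[OF assms(1)] V E_V z' by auto
    then have "dist x z' \<le> dist x z" using z' 1 2 by linarith
    moreover have "dist x w \<le> dist x z" using eq 1 2 by linarith
    ultimately have "z' = w" using unique_parent[of x z z' w] V z' assms by blast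
    then show ?thesis using z' 1 2 eq by simp
  qed
qed

text \<open>A half-tree is connected: by \<open>half_crossing\<close> the step from
  \<open>z \<noteq> y\<close> towards \<open>y\<close> cannot leave it. So the distance to
  \<open>y\<close> serves as induction measure inside the half-tree.\<close>

lemma half_induct [consumes 2, case_names root step]:
  assumes e: "(x, y) \<in> E" and z: "z \<in> half x y"
    and r: "P y"
    and s: "\<And>u w. (u, w) \<in> E \<Longrightarrow> u \<in> half x y \<Longrightarrow> w \<in> half x y \<Longrightarrow> dist w y = Suc (dist u y) \<Longrightarrow> P u \<Longrightarrow> P w"
  shows "P z"
  using z
proof (induction "dist z y" arbitrary: z rule: less_induct)
  case less
  show ?case
  proof (cases "z = y")
    case False
    have V: "z \<in> V" "y \<in> V" "x \<in> V" using less half_sub e E_V by auto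
    obtain u where u: "(z, u) \<in> E" "Suc (dist y u) = dist y z"
      using parent_ex V False by blast
    have "u \<in> half x y" using half_crossing[OF e u(1) less(2)] False by blast
    moreover have "dist z y = Suc (dist u y)" using u V E_V dist_sym by metis
    ultimately show ?thesis using s[of u z] less E_sym u by simp
  qed (simp add: r)
qed

text \<open>Growing \<open>half z w\<close> from \<open>w\<close> stays inside
  \<open>half x y\<close>, because the only way out is the step from \<open>y\<close> to
  \<open>x\<close>, and \<open>x\<close> does not lie in \<open>half z w\<close>.\<close>

lemma half_nested:
  assumes "(x, y) \<in> E" "(z, w) \<in> E" "x \<notin> half z w" "z \<in> half x y"
  shows "half z w \<subseteq> half x y"
proof
  fix u assume "u \<in> half z w"
  with assms(2) show "u \<in> half x y"
  proof (induction rule: half_induct)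
    case root
    show ?case using half_crossing[OF assms(1,2,4)] half_ends[OF assms(2)] assms(3) by blast
  next
    case (step u w')
    then show ?case using half_crossing[OF assms(1) step(1)] assms(3) by blast
  qed
qed

lemma sibling_half:
  assumes "(x, y) \<in> E" "(x, z) \<in> E" "y \<noteq> z"
  shows "half x z \<subseteq> half y x" "half x y \<inter> half x z = {}" "y \<notin> half x z"
proof -
  have V: "x \<in> V" "y \<in> V" "z \<in> V" using assms E_V by auto
  have "dist y z \<noteq> 0" using dist_0_iff V assms by auto
  then show y: "y \<notin> half x z" using dist_edge[OF E_sym[OF assms(1)]] by (auto simp: half_def)
  show s: "half x z \<subseteq> half y x"
    by (rule half_nested[OF E_sym[OF assms(1)] assms(2) y])
      (use half_ends[OF E_sym[OF assms(1)]] in auto)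
  show "half x y \<inter> half x z = {}" using s half_compl[OF assms(1)] by auto
qed

lemma half_disjoint:
  assumes "(x, y) \<in> E" "(z, w) \<in> E" "x \<notin> half z w" "z \<notin> half x y" "x \<noteq> z"
  shows "half x y \<inter> half z w = {}"
proof -
  have "half z w \<subseteq> half y x"
  proof (rule half_nested[OF E_sym[OF assms(1)] assms(2)])
    show "z \<in> half y x" using half_iff[OF assms(1)] assms E_V by blast
    show "y \<notin> half z w"
      using half_crossing[OF assms(2) E_sym[OF assms(1)]] assms by auto
  qed
  then show ?thesis using half_compl[OF assms(1)] by auto
qed

lemma half_toward:
  assumes "x \<in> V" "z \<in> V" "x \<noteq> z"
  shows "\<exists>y. (x, y) \<in> E \<and> z \<in> half x y"
proof -
  obtain y where y: "(x, y) \<in> E" "Suc (dist z y) = dist z x" using parent_ex assms by metis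
  then show ?thesis using assms unfolding half_def by (intro exI[of _ y]) auto
qed

text \<open>If the edge between \<open>d\<close> and \<open>d'\<close> does not lie inside
  \<open>half p q\<close>, then growth from \<open>q\<close> never crosses it, and all of
  \<open>half p q\<close> stays on the side of \<open>q\<close>.\<close>

lemma half_cover:
  assumes "(p, q) \<in> E" "(d, d') \<in> E" "\<not> half p q \<subseteq> half d d'" "\<not> half p q \<subseteq> half d' d"
  shows "d \<in> half p q" "d' \<in> half p q"
proof -
  have *: "half p q \<subseteq> half a b" if e: "(a, b) \<in> E" "q \<in> half a b" "\<not> (a \<in> half p q \<and> b \<in> half p q)" for a b
  proof
    fix u assume "u \<in> half p q"
    with assms(1) show "u \<in> half a b"
    proof (induction rule: half_induct)
      case root then show ?case using e by blast
    next
      case (step u w) then show ?case using half_crossing[OF e(1) step(1)] e(3) by blast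
    qed
  qed
  have "q \<in> half d d' \<or> q \<in> half d' d" using half_iff[OF assms(2)] E_V assms by blast
  then have "d \<in> half p q \<and> d' \<in> half p q"
    using *[OF assms(2)] *[OF E_sym[OF assms(2)]] assms by blast
  then show "d \<in> half p q" "d' \<in> half p q" by auto
qed

section \<open>Two-way infinite paths without backtracking\<close>

lemma nonbacktracking_dist:
  fixes p :: "int \<Rightarrow> 'v"
  assumes e: "\<And>i. (p i, p (i + 1)) \<in> E" and nb: "\<And>i. p (i - 1) \<noteq> p (i + 1)"
  shows "dist (p i) (p (i + int n)) = n"
proof -
  have V: "p k \<in> V" for k using e E_V by blast
  \<comment> \<open>Two consecutive distances are carried along, since the next step has to know
    that the path arrives from the parent and leaves through another neighbour.\<close>
  have "dist (p i) (p (i + int n)) = n \<and> dist (p i) (p (i + int n + 1)) = Suc n"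
  proof (induction n)
    case 0
    then show ?case using e dist_edge by simp
  next
    case (Suc n)
    let ?k = "i + int n"
    have "dist (p i) (p (?k + 2)) = Suc (dist (p i) (p (?k + 1)))"
    proof (rule nonparent_dist[OF V])
      show "(p (?k + 1), p ?k) \<in> E" using e E_sym by blast
      show "(p (?k + 1), p (?k + 2)) \<in> E" using e[of "?k + 1"] by (simp add: add.assoc)
      show "p (?k + 2) \<noteq> p ?k" using nb[of "?k + 1"] by (auto simp: algebra_simps)
    qed (use Suc in auto)
    then show ?case using Suc by (simp add: algebra_simps)
  qed
  then show ?thesis by blast
qed

lemma nonbacktracking_inj:
  fixes p :: "int \<Rightarrow> 'v"
  assumes e: "\<And>i. (p i, p (i + 1)) \<in> E" and nb: "\<And>i. p (i - 1) \<noteq> p (i + 1)"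
  shows "inj p"
proof (rule linorder_injI)
  fix i j :: int assume "i < j"
  then have "dist (p i) (p j) = nat (j - i)" using nonbacktracking_dist[of p i "nat (j - i)"] assms by simp
  then show "p i \<noteq> p j" using \<open>i < j\<close> by auto
qed

text \<open>These are the vertex sets of subtrees, and the empty set. The condition speaks of the
  first step towards another point of the set, the form needed for gluing along the branches at a
  vertex.\<close>

definition convex :: "'v set \<Rightarrow> bool"
  where "convex W \<longleftrightarrow> W \<subseteq> V \<and> (\<forall>x\<in>W. \<forall>y. (x, y) \<in> E \<and> W \<inter> half x y \<noteq> {} \<longrightarrow> y \<in> W)"

lemma convex_insert:
  assumes W: "convex W" "v \<in> W" "(v, w) \<in> E"
  shows "convex (insert w W)"
proof (cases "w \<in> W")
  case True then show ?thesis using W by (simp add: insert_absorb)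
next
  case False
  show ?thesis unfolding convex_def
  proof (intro conjI ballI allI impI)
    show "insert w W \<subseteq> V" using W E_V unfolding convex_def by blast
    fix x y assume x: "x \<in> insert w W" and y: "(x, y) \<in> E \<and> insert w W \<inter> half x y \<noteq> {}"
    show "y \<in> insert w W"
    proof (cases "x = w")
      case False
      then have xW: "x \<in> W" using x by blast
      show ?thesis
      proof (cases "W \<inter> half x y = {}")
        case False then show ?thesis using W xW y unfolding convex_def by blast
      next
        case True
        then have "w \<in> half x y" "v \<notin> half x y" using y W by auto
        then show ?thesis using half_crossing[of x y w v] y E_sym W by blast
      qed
    next
      case True
      then have "W \<inter> half w y \<noteq> {}" using y half_ends by auto
      then obtain a where a: "a \<in> W" "a \<in> half w y" by blast
      show ?thesis
      proof (rule ccontr)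
        assume "y \<notin> insert w W"
        then have "y \<noteq> v" using W by auto
        then have "a \<in> half v w" using sibling_half(1)[of w v y] a y True E_sym W by blast
        then show False using W a False unfolding convex_def by blast
      qed
    qed
  qed
qed

text \<open>A finite convex set around \<open>F\<close> grows by one neighbour at a time along paths
  from \<open>r\<close>. The vertex \<open>r\<close> stays in the set, so that every further point
  can be reached by a path starting inside.\<close>

lemma finite_convex_induct:
  assumes F: "finite F" "F \<subseteq> V" and r: "r \<in> V" "P {r}"
    and step: "\<And>B v w. finite B \<Longrightarrow> convex B \<Longrightarrow> P B \<Longrightarrow> v \<in> B \<Longrightarrow> (v, w) \<in> E \<Longrightarrow> w \<notin> B \<Longrightarrow> P (insert w B)"
  shows "\<exists>A. F \<subseteq> A \<and> P A"
proof -
  define Q where "Q A \<longleftrightarrow> finite A \<and> r \<in> A \<and> convex A \<and> P A" for A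
  have Qr: "Q {r}" unfolding Q_def using r by (auto simp: convex_def dest: half_ends)
  have Qi: "Q (insert w A)" if A: "Q A" "v \<in> A" "(v, w) \<in> E" for A v w
  proof (cases "w \<in> A")
    case True then show ?thesis using A by (simp add: insert_absorb)
  next
    case False
    then show ?thesis using A convex_insert[of A v w] step[of A v w] unfolding Q_def by simp
  qed
  have Qz: "\<exists>B. Q B \<and> A \<subseteq> B \<and> z \<in> B" if z: "z \<in> V" "Q A" for z A
    using r(1) z(1)
  proof (induction rule: tree_induct)
    case root then show ?case using z(2) unfolding Q_def by blast
  next
    case (step x y)
    then obtain B where "Q B" "A \<subseteq> B" "x \<in> B" by blast
    then show ?case using Qi[of B x y] step(1) by blast
  qed
  have "\<exists>A. Q A \<and> F \<subseteq> A" using F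
  proof (induction rule: finite_induct)
    case empty then show ?case using Qr by blast
  next
    case (insert x F)
    then obtain A where A: "Q A" "F \<subseteq> A" by auto
    then obtain B where "Q B" "A \<subseteq> B" "x \<in> B" using Qz[of x A] insert.prems by blast
    then show ?case using A by blast
  qed
  then show ?thesis unfolding Q_def by blast
qed

lemma convex_connected:
  assumes W: "convex W" and x: "x \<in> W" and z: "z \<in> W"
  shows "(x, z) \<in> (E \<inter> W \<times> W)\<^sup>*"
  using x
proof (induction "dist z x" arbitrary: x rule: less_induct)
  case less
  show ?case
  proof (cases "x = z")
    case False
    have V: "x \<in> V" "z \<in> V" using W less z unfolding convex_def by auto
    obtain y where y: "(x, y) \<in> E" "z \<in> half x y" using half_toward V False by blast
    have yW: "y \<in> W" using W less.prems y z unfolding convex_def by blast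
    have "dist z y < dist z x" using y unfolding half_def by auto
    then have "(y, z) \<in> (E \<inter> W \<times> W)\<^sup>*" using less yW by blast
    then show ?thesis using y yW less.prems by (meson IntI SigmaI converse_rtrancl_into_rtrancl)
  qed auto
qed

text \<open>Invertible transport along edges has no monodromy on a tree, so the value at
  \<open>r\<close> spreads by recursion on the distance to \<open>r\<close>. The 2-colourings,
  height functions and sections of cosets on which a simple group is made to act are obtained from
  it.\<close>

lemma section_exists:
  assumes r: "r \<in> V" "s0 \<in> D r"
    and \<tau>: "\<And>x y s. (x, y) \<in> E \<Longrightarrow> s \<in> D x \<Longrightarrow> \<tau> x y s \<in> D y \<and> \<tau> y x (\<tau> x y s) = s"
  shows "\<exists>s. s r = s0 \<and> (\<forall>x\<in>V. s x \<in> D x) \<and> (\<forall>(x, y)\<in>E. s y = \<tau> x y (s x))"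
proof -
  define par where "par x = (SOME y. (x, y) \<in> E \<and> Suc (dist r y) = dist r x)" for x
  have par: "(x, par x) \<in> E \<and> Suc (dist r (par x)) = dist r x" if "x \<in> V" "x \<noteq> r" for x
    unfolding par_def by (rule someI_ex) (rule parent_ex[OF r(1) that])
  \<comment> \<open>Only the values of \<open>S n\<close> at vertices at distance \<open>n\<close>
    from \<open>r\<close> have a meaning, and \<open>s\<close> reads off exactly these.\<close>
  define S where "S n = rec_nat (\<lambda>x. s0) (\<lambda>n f x. \<tau> (par x) x (f (par x))) n" for n
  define s where "s x = S (dist r x) x" for x
  have s_r: "s r = s0" by (simp add: s_def S_def)
  have s_par: "s x = \<tau> (par x) x (s (par x))" if "x \<in> V" "x \<noteq> r" for x
  proof -
    have "dist r x = Suc (dist r (par x))" using par that by simp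
    then have "s x = S (Suc (dist r (par x))) x" by (simp add: s_def)
    also have "\<dots> = \<tau> (par x) x (S (dist r (par x)) (par x))" by (simp add: S_def)
    finally show ?thesis by (simp add: s_def)
  qed
  have sD: "s x \<in> D x" if "x \<in> V" for x
    using that
  proof (induction "dist r x" arbitrary: x rule: less_induct)
    case less
    show ?case
    proof (cases "x = r")
      case False
      have "s (par x) \<in> D (par x)" using less par[OF less.prems False] E_V by (metis lessI)
      then show ?thesis using \<tau> par[OF less.prems False] E_sym s_par[OF less.prems False] by metis
    qed (use r s_r in auto)
  qed
  have up: "s y = \<tau> x y (s x)" if "(x, y) \<in> E" "dist r y = Suc (dist r x)" for x y
  proof -
    have y: "y \<in> V" "y \<noteq> r" using that E_V by auto
    have "par y = x" using unique_parent[of r y "par y" x] par[OF y] that E_sym r by auto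
    then show ?thesis using s_par[OF y] by simp
  qed
  have "s y = \<tau> x y (s x)" if e: "(x, y) \<in> E" for x y
  proof -
    consider "dist r y = Suc (dist r x)" | "dist r x = Suc (dist r y)"
      using dist_step_cases[OF r(1) e] by blast
    then show ?thesis
    proof cases
      case 1 then show ?thesis using up e by blast
    next
      case 2
      then have "s x = \<tau> y x (s y)" using up E_sym e by blast
      then show ?thesis using \<tau>[OF E_sym[OF e] sD] E_V e by metis
    qed
  qed
  then show ?thesis using s_r sD by blast
qed

end

section \<open>Group actions on trees with Property (P)\<close>

abbreviation pinv :: "('v \<Rightarrow> 'v) \<Rightarrow> 'v \<Rightarrow> 'v"
  where "pinv \<equiv> inv_into UNIV"

definition perm_subgroup :: "('v \<Rightarrow> 'v) set \<Rightarrow> bool"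
  where "perm_subgroup M \<longleftrightarrow> id \<in> M \<and> (\<forall>g\<in>M. \<forall>h\<in>M. g \<circ> h \<in> M) \<and> (\<forall>g\<in>M. pinv g \<in> M)"

text \<open>Elements of \<open>G\<close> are total bijections that fix everything outside
  \<open>V\<close>, so that product, inverse and unit are \<open>\<circ>\<close>,
  \<open>pinv\<close> and \<open>id\<close>. Extensional bijections are brought into this form by
  \<open>tot\<close> further below.\<close>

locale tree_action = tree_rel V E for V :: "'v set" and E :: "('v \<times> 'v) set" +
  fixes G :: "('v \<Rightarrow> 'v) set"
  assumes G_sub: "perm_subgroup G"
    and G_bij: "g \<in> G \<Longrightarrow> bij g"
    and G_out: "g \<in> G \<Longrightarrow> x \<notin> V \<Longrightarrow> g x = x"
    and G_E: "g \<in> G \<Longrightarrow> (x, y) \<in> E \<Longrightarrow> (g x, g y) \<in> E"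
begin

lemma G_id [simp]: "id \<in> G" and G_comp: "g \<in> G \<Longrightarrow> h \<in> G \<Longrightarrow> g \<circ> h \<in> G"
  and G_inv: "g \<in> G \<Longrightarrow> pinv g \<in> G"
  using G_sub by (auto simp: perm_subgroup_def)

lemma G_inv_l [simp]: "g \<in> G \<Longrightarrow> pinv g (g x) = x"
  by (simp add: G_bij bij_is_inj)

lemma G_inv_r [simp]: "g \<in> G \<Longrightarrow> g (pinv g x) = x"
  by (simp add: G_bij bij_is_surj surj_f_inv_f)

lemma G_inj: "g \<in> G \<Longrightarrow> g x = g y \<longleftrightarrow> x = y"
  by (metis G_inv_l)

lemma G_inv_eq: "g \<in> G \<Longrightarrow> pinv g x = y \<longleftrightarrow> x = g y"
  by (metis G_inv_l G_inv_r)

lemma G_V [simp]: "g \<in> G \<Longrightarrow> g x \<in> V \<longleftrightarrow> x \<in> V"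
  by (metis G_inj G_out)

lemma G_E_iff: "g \<in> G \<Longrightarrow> (g x, g y) \<in> E \<longleftrightarrow> (x, y) \<in> E"
  using G_E[of g x y] G_E[of "pinv g" "g x" "g y"] G_inv by auto

lemma G_dist: assumes "g \<in> G" shows "dist (g x) (g y) = dist x y"
proof -
  have *: "(h x, h y) \<in> E ^^ n" if "h \<in> G" "(x, y) \<in> E ^^ n" for h x y n
    using that(2)
  proof (induction n arbitrary: y)
    case (Suc n)
    then obtain w where "(x, w) \<in> E ^^ n" "(w, y) \<in> E" by auto
    then show ?case using Suc.IH G_E that(1) by (meson relpow_Suc_I)
  qed simp
  have "(g x, g y) \<in> E ^^ n \<longleftrightarrow> (x, y) \<in> E ^^ n" for n
    using *[of g x y n] *[of "pinv g" "g x" "g y" n] assms G_inv by auto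
  then show ?thesis unfolding dist_def by simp
qed

lemma G_half_mem: "g \<in> G \<Longrightarrow> g z \<in> half (g x) (g y) \<longleftrightarrow> z \<in> half x y"
  by (simp add: half_def G_dist)

lemma G_half: assumes "g \<in> G" shows "g ` half x y = half (g x) (g y)"
proof (intro equalityI subsetI)
  fix z assume "z \<in> half (g x) (g y)"
  then have "pinv g z \<in> half x y" using G_half_mem[OF assms, of "pinv g z"] assms by simp
  then show "z \<in> g ` half x y" using assms by (intro image_eqI[of _ _ "pinv g z"]) simp_all
qed (use G_half_mem assms in auto)

lemma G_eqI: "g \<in> G \<Longrightarrow> h \<in> G \<Longrightarrow> (\<And>x. x \<in> V \<Longrightarrow> g x = h x) \<Longrightarrow> g = h"
  by (metis G_out ext)

lemma G_inv_comp: "g \<in> G \<Longrightarrow> pinv g \<circ> g = id" "g \<in> G \<Longrightarrow> g \<circ> pinv g = id"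
  by (auto simp: fun_eq_iff)

lemma G_inv_inv: "g \<in> G \<Longrightarrow> pinv (pinv g) = g"
  using G_bij inv_inv_eq by blast

lemma G_inv_dist: "g \<in> G \<Longrightarrow> h \<in> G \<Longrightarrow> pinv (g \<circ> h) = pinv h \<circ> pinv g"
  using G_bij o_inv_distrib by blast

definition normal_sub :: "('v \<Rightarrow> 'v) set \<Rightarrow> bool"
  where "normal_sub N \<longleftrightarrow> N \<subseteq> G \<and> perm_subgroup N \<and> (\<forall>n\<in>N. \<forall>g\<in>G. g \<circ> n \<circ> pinv g \<in> N)"

definition simple_action :: bool
  where "simple_action \<longleftrightarrow> G \<noteq> {id} \<and> (\<forall>N. normal_sub N \<longrightarrow> N = G \<or> N = {id})"

text \<open>A scopo lifted from the quotient to the tree. The condition that \<open>X_a\<close> has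
  one element needs no clause of its own: of two arcs of \<open>S\<close> leaving \<open>x\<close>,
  the last clause would put the reverse of the second into \<open>S\<close>.\<close>

definition arc_scopo :: "('v \<times> 'v) set \<Rightarrow> bool"
  where "arc_scopo S \<longleftrightarrow> S \<subseteq> E \<and> (\<forall>g\<in>G. \<forall>(x, y)\<in>S. (g x, g y) \<in> S) \<and>
    (\<forall>(x, y)\<in>S. (y, x) \<notin> S \<and> (\<forall>z. (z, x) \<in> E \<and> z \<noteq> y \<longrightarrow> (z, x) \<in> S))"

text \<open>A union of groups, not a group. As soon as \<open>x\<close> has a neighbour, it contains
  every element of \<open>G\<close> that fixes \<open>x\<close> and all its neighbours; this links
  it to the point stabilisers of the local action at \<open>x\<close>.\<close>

definition arc_stabs :: "'v \<Rightarrow> ('v \<Rightarrow> 'v) set"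
  where "arc_stabs x = {g \<in> G. g x = x \<and> (\<exists>y. (x, y) \<in> E \<and> g y = y)}"

end

text \<open>\<open>edge_indep\<close> is (P) for a path with one edge, and
  \<open>limit_closed\<close> is closedness. The latter asks for \<open>h\<close> to map
  \<open>V\<close> onto \<open>V\<close> because a pointwise limit of bijections is injective but
  can fail to be onto.\<close>

locale P_tree_action = tree_action V E G for V :: "'v set" and E :: "('v \<times> 'v) set" and G :: "('v \<Rightarrow> 'v) set" +
  assumes edge_indep: "(x, y) \<in> E \<Longrightarrow> g \<in> G \<Longrightarrow> g x = x \<Longrightarrow> g y = y \<Longrightarrow>
      \<exists>g'\<in>G. (\<forall>z\<in>half x y. g' z = g z) \<and> (\<forall>z\<in>half y x. g' z = z)"
    and limit_closed: "h ` V = V \<Longrightarrow> (\<And>x. x \<notin> V \<Longrightarrow> h x = x) \<Longrightarrow>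
      (\<And>F. finite F \<Longrightarrow> F \<subseteq> V \<Longrightarrow> \<exists>g\<in>G. \<forall>x\<in>F. g x = h x) \<Longrightarrow> h \<in> G"
begin

text \<open>The branches are treated one by one. The element found so far and the prescribed
  \<open>k y\<close> agree on the edge from \<open>v\<close> to \<open>y\<close>, so their quotient
  fixes this edge, and (P) cuts the quotient down to the branch beyond \<open>y\<close>.\<close>

lemma local_modify:
  assumes "finite Y" "v \<in> V" "\<And>y. y \<in> Y \<Longrightarrow> (v, y) \<in> E" "k0 \<in> G" "k0 v = v"
    "\<And>y. y \<in> Y \<Longrightarrow> k y \<in> G \<and> k y v = v \<and> k y y = k0 y"
  shows "\<exists>g\<in>G. g v = v \<and> (\<forall>y\<in>Y. \<forall>z\<in>half v y. g z = k y z) \<and>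
    (\<forall>z\<in>V. (\<forall>y\<in>Y. z \<notin> half v y) \<longrightarrow> g z = k0 z)"
  using assms(1,3,6)
proof (induction rule: finite_induct)
  case empty
  then show ?case using assms by auto
next
  case (insert y Y)
  then obtain g where g: "g \<in> G" "g v = v" "\<forall>y\<in>Y. \<forall>z\<in>half v y. g z = k y z"
    "\<forall>z\<in>V. (\<forall>y\<in>Y. z \<notin> half v y) \<longrightarrow> g z = k0 z" by auto
  have vy: "(v, y) \<in> E" and ky: "k y \<in> G" "k y v = v" "k y y = k0 y" using insert by auto
  have sib: "half v y \<inter> half v y' = {}" "y \<notin> half v y'" if "y' \<in> Y" for y'
    using sibling_half[OF vy, of y'] that insert by auto
  have gy: "g y = k0 y" using g(4) sib E_V vy by blast
  define r where "r = pinv g \<circ> k y"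
  have r: "r \<in> G" "r v = v" "r y = y"
    using g ky gy by (auto simp: r_def G_comp G_inv G_inv_eq)
  obtain r' where r': "r' \<in> G" "\<forall>z\<in>half v y. r' z = r z" "\<forall>z\<in>half y v. r' z = z"
    using edge_indep[OF vy r] by blast
  have out: "r' z = z" if "z \<in> V" "z \<notin> half v y" for z
    using r'(3) half_compl[OF vy] that by blast
  have "(g \<circ> r') v = v" using out half_ends[OF vy] assms g by simp
  moreover have "(g \<circ> r') z = k y z" if "z \<in> half v y" for z
    using r'(2) that g by (simp add: r_def)
  moreover have "(g \<circ> r') z = k y' z" if "y' \<in> Y" "z \<in> half v y'" for y' z
  proof -
    have "z \<in> V" "z \<notin> half v y" using that half_sub sib(1)[OF that(1)] by auto
    then show ?thesis using out that g(3) by simp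
  qed
  moreover have "(g \<circ> r') z = k0 z" if "z \<in> V" "\<forall>y\<in>insert y Y. z \<notin> half v y" for z
    using out[of z] that g(4) by auto
  ultimately show ?case using G_comp[OF g(1) r'(1)] by blast
qed

text \<open>One element of the stabiliser of \<open>v\<close> is chosen for each branch, and these
  are glued. A finite set meets finitely many branches, on which \<open>local_modify\<close> finds
  an element of \<open>G\<close> doing the same, so the glued map is a limit. This makes the local
  groups closed.\<close>

lemma local_lift:
  assumes v: "v \<in> V" and s: "s ` {y. (v, y) \<in> E} = {y. (v, y) \<in> E}"
    and fin: "\<And>Y. finite Y \<Longrightarrow> (\<And>y. y \<in> Y \<Longrightarrow> (v, y) \<in> E) \<Longrightarrow> \<exists>k\<in>G. k v = v \<and> (\<forall>y\<in>Y. k y = s y)"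
  shows "\<exists>g\<in>G. g v = v \<and> (\<forall>y. (v, y) \<in> E \<longrightarrow> g y = s y)"
proof -
  define k where "k y = (SOME k. k \<in> G \<and> k v = v \<and> k y = s y)" for y
  have k: "k y \<in> G" "k y v = v" "k y y = s y" if "(v, y) \<in> E" for y
  proof -
    have "\<exists>k. k \<in> G \<and> k v = v \<and> k y = s y" using fin[of "{y}"] that by auto
    from someI_ex[OF this] show "k y \<in> G" "k y v = v" "k y y = s y" unfolding k_def by auto
  qed
  define b where "b z = (SOME y. (v, y) \<in> E \<and> z \<in> half v y)" for z
  have b: "(v, b z) \<in> E" "z \<in> half v (b z)" if "z \<in> V" "z \<noteq> v" for z
    using someI_ex[OF half_toward[OF v that(1) that(2)[symmetric]]] unfolding b_def by auto
  have b_eq: "b z = y" if "(v, y) \<in> E" "z \<in> half v y" for y z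
  proof (rule ccontr)
    assume ne: "b z \<noteq> y"
    have "z \<in> V" "z \<noteq> v" using that half_sub half_ends by auto
    then show False using sibling_half(2)[OF b(1) that(1) ne] b(2) that by blast
  qed
  define h where "h z = (if z \<in> V - {v} then k (b z) z else z)" for z
  have h_half: "h z = k y z" if "(v, y) \<in> E" "z \<in> half v y" for y z
    using b_eq[OF that] that half_sub half_ends[OF that(1)] by (auto simp: h_def)
  have hG: "h \<in> G"
  proof (rule limit_closed)
    show "h ` V = V"
    proof (intro equalityI subsetI)
      fix z assume "z \<in> h ` V" then show "z \<in> V" using k b by (auto simp: h_def)
    next
      fix z assume z: "z \<in> V"
      show "z \<in> h ` V"
      proof (cases "z = v")
        case True then show ?thesis using v by (intro image_eqI[of _ _ v]) (auto simp: h_def)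
      next
        case False
        have "b z \<in> s ` {y. (v, y) \<in> E}" unfolding s using b[OF z False] by simp
        then obtain y where y: "(v, y) \<in> E" "s y = b z" by auto
        have "k y (pinv (k y) z) \<in> half (k y v) (k y y)" using y k[OF y(1)] b[OF z False] by simp
        then have "pinv (k y) z \<in> half v y" using G_half_mem[OF k(1)[OF y(1)]] by simp
        then have "h (pinv (k y) z) = z" "pinv (k y) z \<in> V"
          using h_half[OF y(1)] k[OF y(1)] half_sub by auto
        then show ?thesis by (metis imageI)
      qed
    qed
    show "h x = x" if "x \<notin> V" for x using that by (simp add: h_def)
    fix F assume F: "finite F" "F \<subseteq> V"
    define Y where "Y = b ` (F - {v})"
    have Y: "finite Y" "\<And>y. y \<in> Y \<Longrightarrow> (v, y) \<in> E" using F b by (auto simp: Y_def)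
    obtain k0 where k0: "k0 \<in> G" "k0 v = v" "\<forall>y\<in>Y. k0 y = s y" using fin[OF Y] by blast
    have "\<exists>g\<in>G. g v = v \<and> (\<forall>y\<in>Y. \<forall>z\<in>half v y. g z = k y z) \<and>
      (\<forall>z\<in>V. (\<forall>y\<in>Y. z \<notin> half v y) \<longrightarrow> g z = k0 z)"
      by (rule local_modify[OF Y(1) v Y(2) k0(1,2)]) (use k k0 Y in auto)
    then obtain g where g: "g \<in> G" "g v = v" "\<forall>y\<in>Y. \<forall>z\<in>half v y. g z = k y z" by blast
    have "g x = h x" if "x \<in> F" for x
    proof (cases "x = v")
      case True then show ?thesis using g by (simp add: h_def)
    next
      case False
      then have "b x \<in> Y" "x \<in> V" using that F by (auto simp: Y_def)
      then show ?thesis using g(3) b[of x] h_half[of "b x" x] False by auto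
    qed
    then show "\<exists>g\<in>G. \<forall>x\<in>F. g x = h x" using g by blast
  qed
  have "h y = s y" if "(v, y) \<in> E" for y using h_half[of y y] that half_ends k by auto
  then show ?thesis using hG by (intro bexI[of _ h]) (auto simp: h_def)
qed

text \<open>An element of \<open>G\<close> that agrees with \<open>h\<close> on a finite convex set
  can be improved to agree at one more adjacent vertex; closedness does the rest. It yields the
  inclusion of the universal group in \<open>G\<close>.\<close>

lemma locally_in_G:
  assumes h: "h ` V = V" "\<And>x. x \<notin> V \<Longrightarrow> h x = x"
    and loc: "\<And>v Y. v \<in> V \<Longrightarrow> finite Y \<Longrightarrow> (\<And>y. y \<in> Y \<Longrightarrow> (v, y) \<in> E) \<Longrightarrow>
      \<exists>g\<in>G. g v = h v \<and> (\<forall>y\<in>Y. g y = h y)"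
  shows "h \<in> G"
proof (rule limit_closed[OF h])
  fix F assume F: "finite F" "F \<subseteq> V"
  show "\<exists>g\<in>G. \<forall>x\<in>F. g x = h x"
  proof (cases "F = {}")
    case True then show ?thesis using G_id by blast
  next
    case False
    then obtain r where r: "r \<in> V" using F by blast
    define P where "P B \<longleftrightarrow> (\<exists>g\<in>G. \<forall>x\<in>B. g x = h x)" for B
    have "\<exists>A. F \<subseteq> A \<and> P A"
    proof (rule finite_convex_induct[OF F r])
      show "P {r}" using loc[OF r, of "{}"] by (auto simp: P_def)
      show "P (insert w B)" if B: "finite B" "convex B" "P B" and v: "v \<in> B" "(v, w) \<in> E" "w \<notin> B" for B v w
      proof -
        obtain k where k: "k \<in> G" "\<And>x. x \<in> B \<Longrightarrow> k x = h x" using B(3) by (auto simp: P_def)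
        \<comment> \<open>Besides \<open>w\<close>, the local element has to be right at the
          neighbours of \<open>v\<close> in \<open>B\<close>. Its difference \<open>k0\<close> from
          \<open>k\<close> then fixes the root of every branch at \<open>v\<close> that meets
          \<open>B\<close>, so it can be replaced by the identity on these branches and kept at
          \<open>w\<close>.\<close>
        define Y where "Y = {y \<in> B. (v, y) \<in> E}"
        have Y: "finite Y" "\<And>y. y \<in> Y \<Longrightarrow> (v, y) \<in> E" using B by (auto simp: Y_def)
        have vV: "v \<in> V" using v E_V by blast
        obtain g where g: "g \<in> G" "g v = h v" "\<And>y. y \<in> insert w Y \<Longrightarrow> g y = h y"
          using loc[OF vV, of "insert w Y"] Y v(2) by auto
        define k0 where "k0 = pinv k \<circ> g"
        have k0: "k0 \<in> G" "k0 v = v" using g k v by (auto simp: k0_def G_comp G_inv G_inv_eq)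
        have k0Y: "k0 y = y" if "y \<in> Y" for y
          using g(3)[of y] k that by (auto simp: k0_def Y_def G_inv_eq)
        have "\<exists>m\<in>G. m v = v \<and> (\<forall>y\<in>Y. \<forall>z\<in>half v y. m z = id z) \<and>
          (\<forall>z\<in>V. (\<forall>y\<in>Y. z \<notin> half v y) \<longrightarrow> m z = k0 z)"
          by (rule local_modify[where k = "\<lambda>_. id", OF Y(1) vV Y(2) k0]) (simp_all add: k0Y)
        then obtain m where m: "m \<in> G" "m v = v" "\<And>y z. y \<in> Y \<Longrightarrow> z \<in> half v y \<Longrightarrow> m z = z"
          "\<And>z. z \<in> V \<Longrightarrow> (\<forall>y\<in>Y. z \<notin> half v y) \<Longrightarrow> m z = k0 z" by auto
        have "m b = b" if b: "b \<in> B" for b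
        proof (cases "b = v")
          case False
          have "b \<in> V" using b B(2) unfolding convex_def by blast
          then obtain y where y: "(v, y) \<in> E" "b \<in> half v y" using half_toward[OF vV _ False[symmetric]] by blast
          then have "y \<in> Y" using B(2) v b unfolding convex_def Y_def by blast
          then show ?thesis using m y by blast
        qed (use m in simp)
        moreover have "m w = k0 w"
        proof (rule m(4))
          show "w \<in> V" using v E_V by blast
          show "\<forall>y\<in>Y. w \<notin> half v y"
          proof
            fix y assume y: "y \<in> Y"
            then have "w \<noteq> y" using v(3) by (auto simp: Y_def)
            then show "w \<notin> half v y" by (rule sibling_half(3)[OF v(2) Y(2)[OF y]])
          qed
        qed
        moreover have "k (k0 w) = h w" using g(3)[of w] k(1) by (simp add: k0_def)
        ultimately have "\<forall>x\<in>insert w B. (k \<circ> m) x = h x" using k(2) by simp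
        then show ?thesis using G_comp[OF k(1) m(1)] unfolding P_def by blast
      qed
    qed
    then show ?thesis unfolding P_def by blast
  qed
qed

end

section \<open>Simplicity of irreducible actions\<close>

lemma perm_subgroup_funpow: "perm_subgroup M \<Longrightarrow> g \<in> M \<Longrightarrow> g ^^ k \<in> M"
  by (induction k) (auto simp: perm_subgroup_def)

section \<open>Generation of vertex stabilisers by arc stabilisers\<close>

context tree_action
begin

text \<open>Phrased through all subgroups above \<open>arc_stabs x\<close> instead of a generated
  subgroup, because it is applied to subgroups given otherwise: a normal subgroup, or the kernel of
  a local action.\<close>

definition local_gen :: "'v \<Rightarrow> bool"
  where "local_gen x \<longleftrightarrow> (\<forall>M. perm_subgroup M \<and> M \<subseteq> G \<and> arc_stabs x \<subseteq> M \<longrightarrow>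
    (\<forall>g\<in>G. g x = x \<longrightarrow> g \<in> M))"

lemma local_gen_translate:
  assumes "local_gen x" "h \<in> G"
  shows "local_gen (h x)"
  unfolding local_gen_def
proof (intro allI impI ballI)
  fix M g assume M: "perm_subgroup M \<and> M \<subseteq> G \<and> arc_stabs (h x) \<subseteq> M" and g: "g \<in> G" "g (h x) = h x"
  define M' where "M' = {k \<in> G. h \<circ> k \<circ> pinv h \<in> M}"
  have "perm_subgroup M'" unfolding perm_subgroup_def
  proof (intro conjI ballI)
    show "id \<in> M'" using M assms G_inv_comp by (simp add: M'_def perm_subgroup_def)
  next
    fix k l assume kl: "k \<in> M'" "l \<in> M'"
    have "h \<circ> (k \<circ> l) \<circ> pinv h = (h \<circ> k \<circ> pinv h) \<circ> (h \<circ> l \<circ> pinv h)"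
      using assms by (simp add: fun_eq_iff)
    then show "k \<circ> l \<in> M'" using kl M G_comp unfolding M'_def perm_subgroup_def by auto
  next
    fix k assume k: "k \<in> M'"
    have "h \<circ> pinv k \<circ> pinv h = pinv (h \<circ> k \<circ> pinv h)"
      using assms k by (simp add: M'_def G_inv_dist G_inv_inv G_inv G_comp comp_assoc)
    then show "pinv k \<in> M'" using k M G_inv unfolding M'_def perm_subgroup_def by auto
  qed
  moreover have "arc_stabs x \<subseteq> M'"
  proof
    fix k assume k: "k \<in> arc_stabs x"
    then obtain y where y: "k \<in> G" "k x = x" "(x, y) \<in> E" "k y = y" unfolding arc_stabs_def by auto
    have "h \<circ> k \<circ> pinv h \<in> G" "(h x, h y) \<in> E" using y assms by (simp_all add: G_comp G_inv G_E)
    then have "h \<circ> k \<circ> pinv h \<in> arc_stabs (h x)"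
      using assms y by (auto simp: arc_stabs_def intro: exI[of _ "h y"])
    then show "k \<in> M'" using M y by (auto simp: M'_def)
  qed
  ultimately have "pinv h \<circ> g \<circ> h \<in> M'"
    using assms g unfolding local_gen_def by (auto simp: M'_def G_comp G_inv)
  moreover have "h \<circ> (pinv h \<circ> g \<circ> h) \<circ> pinv h = g" using assms by (simp add: fun_eq_iff)
  ultimately show "g \<in> M" by (simp add: M'_def)
qed

end

text \<open>The conditions of (ii) read on the tree: \<open>irr\<close> is irreducibility,
  \<open>local_gen\<close> generation by point stabilisers, \<open>nontriv\<close> the existence of
  a non-trivial local group, and \<open>vertex_gen\<close> is what a quotient graph that is a tree
  yields.\<close>

locale irreducible_action = P_tree_action V E G for V :: "'v set" and E :: "('v \<times> 'v) set" and G :: "('v \<Rightarrow> 'v) set" +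
  assumes irr: "arc_scopo S \<Longrightarrow> S = {}"
    and local_gen: "x \<in> V \<Longrightarrow> local_gen x"
    and nontriv: "\<exists>v y g. (v, y) \<in> E \<and> g \<in> G \<and> g v = v \<and> g y \<noteq> y"
    and vertex_gen: "perm_subgroup M \<Longrightarrow> M \<subseteq> G \<Longrightarrow>
      (\<And>g x. g \<in> G \<Longrightarrow> x \<in> V \<Longrightarrow> g x = x \<Longrightarrow> g \<in> M) \<Longrightarrow> G \<subseteq> M"
begin

text \<open>Call a half-tree bad if it contains no translate of \<open>half a a'\<close>. Half-trees
  inside a bad one are bad, so the arcs with a bad half-tree behind them satisfy the backward
  closure of a scopo. Asymmetry is the obstacle; a first scopo removes it by showing that the two
  sides of an edge are never both bad.\<close>

lemma half_transport:
  assumes a: "(a, a') \<in> E" and b: "(b, b') \<in> E"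
  shows "\<exists>g\<in>G. half (g a) (g a') \<subseteq> half b b'"
proof -
  define bad where "bad d d' \<longleftrightarrow> \<not> (\<exists>g\<in>G. half (g a) (g a') \<subseteq> half d d')" for d d'
  have bad_G: "bad (g d) (g d')" if "bad d d'" "g \<in> G" for g d d'
    unfolding bad_def
  proof
    assume "\<exists>h\<in>G. half (h a) (h a') \<subseteq> half (g d) (g d')"
    then obtain h where h: "h \<in> G" "half (h a) (h a') \<subseteq> half (g d) (g d')" by blast
    then have "pinv g ` half (h a) (h a') \<subseteq> pinv g ` half (g d) (g d')" by blast
    then have "half ((pinv g \<circ> h) a) ((pinv g \<circ> h) a') \<subseteq> half d d'"
      using G_half[OF G_inv[OF that(2)]] that by simp
    then show False using that h G_comp G_inv unfolding bad_def by blast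
  qed
  have one_good: "\<not> bad d d' \<or> \<not> bad d' d" if d: "(d, d') \<in> E" for d d'
  proof (rule ccontr)
    assume c: "\<not> ?thesis"
    \<comment> \<open>These arcs have the whole orbit of the edge in the half-tree ahead of them. If
      both sides of the edge were bad, \<open>half a a'\<close> would lie on neither side of any
      translate, hence contain all of them by \<open>half_cover\<close>, and \<open>(a, a')\<close>
      would be such an arc.\<close>
    let ?S = "{(x, y). (x, y) \<in> E \<and> (\<forall>h\<in>G. h d \<in> half x y \<and> h d' \<in> half x y)}"
    have "arc_scopo ?S" unfolding arc_scopo_def
    proof (intro conjI ballI; clarify)
      fix g x y h assume *: "g \<in> G" "(x, y) \<in> E" "\<forall>h\<in>G. h d \<in> half x y \<and> h d' \<in> half x y"
      show "(g x, g y) \<in> E \<and> (\<forall>h\<in>G. h d \<in> half (g x) (g y) \<and> h d' \<in> half (g x) (g y))"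
      proof (intro conjI ballI)
        fix h assume "h \<in> G"
        then have "pinv g \<circ> h \<in> G" using * G_comp G_inv by blast
        then have "(pinv g \<circ> h) d \<in> half x y" "(pinv g \<circ> h) d' \<in> half x y" using * by blast+
        then show "h d \<in> half (g x) (g y)" "h d' \<in> half (g x) (g y)"
          using G_half_mem[OF *(1), of "pinv g (h d)"] G_half_mem[OF *(1), of "pinv g (h d')"] *(1)
          by simp_all
      qed (use * G_E in auto)
    next
      fix x y assume *: "(x, y) \<in> E" "\<forall>h\<in>G. h d \<in> half x y \<and> h d' \<in> half x y"
      have "d \<in> half x y" using *(2)[rule_format, of id] by simp
      then have "id d \<notin> half y x" using half_compl[OF *(1)] by simp
      then have "\<not> (\<forall>h\<in>G. h d \<in> half y x \<and> h d' \<in> half y x)" using G_id by blast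
      moreover have "half x y \<subseteq> half z x" if "(z, x) \<in> E" "z \<noteq> y" for z
        using sibling_half(1)[of x z y] that * E_sym by blast
      ultimately show "(y, x) \<notin> ?S \<and> (\<forall>z. (z, x) \<in> E \<and> z \<noteq> y \<longrightarrow> (z, x) \<in> ?S)"
        using *(2) by blast
    qed
    then have "?S = {}" by (rule irr)
    moreover have "h d \<in> half a a' \<and> h d' \<in> half a a'" if h: "h \<in> G" for h
    proof -
      have hd: "(h d, h d') \<in> E" "bad (h d) (h d')" "bad (h d') (h d)"
        using c bad_G h G_E d by auto
      then have "\<not> half a a' \<subseteq> half (h d) (h d')" "\<not> half a a' \<subseteq> half (h d') (h d)"
        unfolding bad_def by (auto dest!: bspec[OF _ G_id])
      then show ?thesis using half_cover[OF a hd(1)] by blast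
    qed
    ultimately show False using a by blast
  qed
  let ?S = "{(x, y). (x, y) \<in> E \<and> bad y x}"
  have "arc_scopo ?S" unfolding arc_scopo_def
  proof (intro conjI ballI; clarify)
    fix g x y assume "g \<in> G" "(x, y) \<in> E" "bad y x"
    then show "(g x, g y) \<in> E \<and> bad (g y) (g x)" using bad_G G_E by blast
  next
    fix x y assume *: "(x, y) \<in> E" "bad y x"
    have "bad x z" if "(z, x) \<in> E" "z \<noteq> y" for z
    proof -
      have "half x z \<subseteq> half y x" using sibling_half(1)[of x y z] that * E_sym by blast
      then show ?thesis using *(2) unfolding bad_def by blast
    qed
    then show "(y, x) \<notin> ?S \<and> (\<forall>z. (z, x) \<in> E \<and> z \<noteq> y \<longrightarrow> (z, x) \<in> ?S)"
      using one_good[OF *(1)] * by auto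
  qed
  then have "?S = {}" by (rule irr)
  then have "\<not> bad b b'" using E_sym[OF b] by blast
  then show ?thesis unfolding bad_def by blast
qed

text \<open>If the arc stabilisers at \<open>v\<close> fixed all neighbours of \<open>v\<close>, so
  would the stabiliser that they generate, against \<open>nontriv\<close>. Hence some
  \<open>f\<close> fixes a neighbour \<open>a\<close> and moves another one \<open>b\<close>. The
  three neighbours are \<open>a\<close>, \<open>b\<close> and \<open>f b\<close>, and (P) makes
  \<open>f\<close> trivial beyond \<open>a\<close>.\<close>

lemma branching:
  obtains u y1 y2 y3 f where "(u, y1) \<in> E" "(u, y2) \<in> E" "(u, y3) \<in> E"
    "y1 \<noteq> y2" "y1 \<noteq> y3" "y2 \<noteq> y3" "f \<in> G" "f \<noteq> id" "\<And>z. z \<notin> half y1 u \<Longrightarrow> f z = z"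
proof -
  obtain v y g where v: "(v, y) \<in> E" "g \<in> G" "g v = v" "g y \<noteq> y" using nontriv by blast
  define M where "M = {g \<in> G. g v = v \<and> (\<forall>y. (v, y) \<in> E \<longrightarrow> g y = y)}"
  have "perm_subgroup M" unfolding perm_subgroup_def M_def
    by (auto simp: G_comp G_inv G_inv_eq)
  moreover have "g \<notin> M" using v by (auto simp: M_def)
  moreover have "M \<subseteq> G" by (auto simp: M_def)
  ultimately have "\<not> arc_stabs v \<subseteq> M"
    using local_gen[of v] v E_V unfolding local_gen_def by blast
  then obtain f where f0: "f \<in> arc_stabs v" "f \<notin> M" by blast
  then obtain a where "f \<in> G" "f v = v" "(v, a) \<in> E" "f a = a" by (auto simp: arc_stabs_def)
  moreover from this f0 obtain b where "(v, b) \<in> E" "f b \<noteq> b" by (auto simp: M_def)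
  ultimately obtain a b where f: "f \<in> G" "f v = v" "(v, a) \<in> E" "f a = a" "(v, b) \<in> E" "f b \<noteq> b"
    by blast
  have "(v, f b) \<in> E" using G_E[OF f(1,5)] f(2) by simp
  moreover have "f b \<noteq> a" "a \<noteq> b" using f(4,6) G_inj[OF f(1), of b a] by metis+
  ultimately have fb: "(v, f b) \<in> E" "f b \<noteq> a" "a \<noteq> b" by blast+
  obtain f' where f': "f' \<in> G" "\<forall>z\<in>half a v. f' z = f z" "\<forall>z\<in>half v a. f' z = z"
    using edge_indep[OF E_sym[OF f(3)] f(1,4,2)] by blast
  have "b \<in> half a v" using sibling_half(3)[OF f(5,3)] half_iff[OF f(3)] f(5) E_V fb by blast
  then have "f' b \<noteq> b" using f'(2) f(6) by simp
  then have "f' \<noteq> id" by (metis id_apply)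
  moreover have "f' z = z" if "z \<notin> half a v" for z
    using that f'(3) half_compl[OF f(3)] G_out[OF f'(1)] by (cases "z \<in> V") blast+
  ultimately show thesis using that[OF f(3,5) fb(1)] f'(1) f(6) fb(2,3) by metis
qed

text \<open>\<open>branching\<close> supplies such an element for one half-tree, and
  \<open>half_transport\<close> conjugates it into any other.\<close>

lemma rigid_nontrivial:
  assumes "(b, b') \<in> E"
  obtains f where "f \<in> G" "f \<noteq> id" "\<And>z. z \<notin> half b b' \<Longrightarrow> f z = z"
proof -
  obtain u y f where f: "(u, y) \<in> E" "f \<in> G" "f \<noteq> id" "\<And>z. z \<notin> half y u \<Longrightarrow> f z = z"
    by (rule branching) blast
  obtain g where g: "g \<in> G" "half (g y) (g u) \<subseteq> half b b'"
    using half_transport[OF E_sym[OF f(1)] assms] by blast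
  show thesis
  proof (rule that)
    show "g \<circ> f \<circ> pinv g \<in> G" using f g by (simp add: G_comp G_inv)
    show "g \<circ> f \<circ> pinv g \<noteq> id"
    proof
      assume c: "g \<circ> f \<circ> pinv g = id"
      have "f x = x" for x using fun_cong[OF c, of "g x"] g by (simp add: G_inj)
      then show False using f by auto
    qed
    fix z assume "z \<notin> half b b'"
    then have "pinv g z \<notin> half y u" using g G_half_mem[OF g(1), of "pinv g z"] by auto
    then show "(g \<circ> f \<circ> pinv g) z = z" using f g by simp
  qed
qed

text \<open>Every half-tree contains two disjoint ones, translates of two branches at a vertex with
  three neighbours, and a further point \<open>x\<close> lies in at most one of them.\<close>

lemma half_avoiding:
  assumes "finite F"
  shows "\<exists>b b'. (b, b') \<in> E \<and> half b b' \<inter> F = {}"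
  using assms
proof (induction rule: finite_induct)
  case empty
  then show ?case using nontriv by blast
next
  case (insert x F)
  then obtain b b' where b: "(b, b') \<in> E" "half b b' \<inter> F = {}" by blast
  obtain u y1 y2 y3 where u: "(u, y1) \<in> E" "(u, y2) \<in> E" "(u, y3) \<in> E" "y1 \<noteq> y2" "y1 \<noteq> y3" "y2 \<noteq> y3"
    by (rule branching) blast
  obtain g where g: "g \<in> G" "half (g y3) (g u) \<subseteq> half b b'"
    using half_transport[OF E_sym[OF u(3)] b(1)] by blast
  have e: "(g u, g y1) \<in> E" "(g u, g y2) \<in> E" "(g u, g y3) \<in> E" using u g G_E by auto
  have ne: "g y1 \<noteq> g y2" "g y3 \<noteq> g y1" "g y3 \<noteq> g y2" using u g G_inj by auto
  have "x \<notin> half (g u) (g y1) \<or> x \<notin> half (g u) (g y2)" using sibling_half(2)[OF e(1,2) ne(1)] by blast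
  moreover have "half (g u) (g y1) \<subseteq> half b b'" "half (g u) (g y2) \<subseteq> half b b'"
    using sibling_half(1)[OF e(3,1) ne(2)] sibling_half(1)[OF e(3,2) ne(3)] g by blast+
  ultimately show ?case using b e by blast
qed

text \<open>If \<open>n\<close> fixes a vertex, some edge has one end fixed and the other moved.
  Otherwise one of three branches at \<open>u\<close> contains neither \<open>n u\<close> nor the
  preimage of \<open>u\<close>; this choice covers inversions of edges as well as
  translations.\<close>

lemma displaced_half:
  assumes "n \<in> G" "n \<noteq> id"
  shows "\<exists>a a'. (a, a') \<in> E \<and> half a a' \<inter> half (n a) (n a') = {}"
proof (cases "\<exists>x\<in>V. n x = x")
  case True
  then obtain x where x: "x \<in> V" "n x = x" by blast
  obtain w where w: "w \<in> V" "n w \<noteq> w" using assms G_eqI[OF assms(1) G_id] by auto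
  have "\<exists>y z. (y, z) \<in> E \<and> n y = y \<and> n z \<noteq> z"
  proof (rule ccontr)
    assume c: "\<not> ?thesis"
    have "n w = w" using x(1) w(1)
    proof (induction rule: tree_induct)
      case root show ?case by (rule x)
    next
      case (step x y) then show ?case using c by blast
    qed
    then show False using w by simp
  qed
  then obtain y z where yz: "(y, z) \<in> E" "n y = y" "n z \<noteq> z" by blast
  have e: "(y, n z) \<in> E" using G_E[OF assms(1) yz(1)] yz(2) by simp
  have "half y z \<inter> half y (n z) = {}" by (rule sibling_half(2)[OF yz(1) e yz(3)[symmetric]])
  then show ?thesis using yz(1,2) by metis
next
  case False
  obtain u y1 y2 y3 where u: "(u, y1) \<in> E" "(u, y2) \<in> E" "(u, y3) \<in> E" "y1 \<noteq> y2" "y1 \<noteq> y3" "y2 \<noteq> y3"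
    by (rule branching) blast
  have d: "half u y1 \<inter> half u y2 = {}" "half u y1 \<inter> half u y3 = {}" "half u y2 \<inter> half u y3 = {}"
    using sibling_half(2) u by auto
  obtain y where y: "(u, y) \<in> E" "n u \<notin> half u y" "pinv n u \<notin> half u y"
    using d u(1-3) by blast
  have "half u y \<inter> half (n u) (n y) = {}"
  proof (rule half_disjoint[OF y(1) G_E[OF assms(1) y(1)]])
    show "u \<notin> half (n u) (n y)" using G_half_mem[OF assms(1), of "pinv n u" u y] y assms by simp
    show "u \<noteq> n u" using False u E_V by force
  qed (rule y)
  then show ?thesis using y by blast
qed

text \<open>A displaced half-tree is mapped into its own complement, and conjugation moves this
  complement into \<open>half b b'\<close>. The conjugate then sends everything outside
  \<open>half b b'\<close> into it.\<close>

lemma normal_hyperbolic: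
  assumes N: "normal_sub N" and ne: "N \<noteq> {id}"
  shows "(b, b') \<in> E \<Longrightarrow> \<exists>n\<in>N. n ` half b' b \<subseteq> half b b'"
proof -
  assume b: "(b, b') \<in> E"
  have NG: "N \<subseteq> G" using N by (simp add: normal_sub_def)
  have "id \<in> N" using N by (simp add: normal_sub_def perm_subgroup_def)
  then obtain n where n: "n \<in> N" "n \<noteq> id" using ne by blast
  then obtain a a' where a: "(a, a') \<in> E" "half a a' \<inter> half (n a) (n a') = {}"
    using displaced_half NG by blast
  obtain g where g: "g \<in> G" "half (g a') (g a) \<subseteq> half b b'"
    using half_transport[OF E_sym[OF a(1)] b] by blast
  have ga: "(g a, g a') \<in> E" using g a G_E by blast
  have "(g \<circ> n \<circ> pinv g) z \<in> half b b'" if z: "z \<in> half b' b" for z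
  proof -
    have "z \<notin> half (g a') (g a)" "z \<in> V" using z g half_compl[OF b] by auto
    then have "z \<in> half (g a) (g a')" using half_iff[OF ga] by blast
    then have 1: "pinv g z \<in> half a a'" using G_half_mem[OF g(1), of "pinv g z"] g by simp
    then have "n (pinv g z) \<in> half (n a) (n a')" using G_half_mem n NG by blast
    then have "n (pinv g z) \<notin> half a a'" "n (pinv g z) \<in> V" using a half_sub by blast+
    then have "n (pinv g z) \<in> half a' a" using half_iff[OF a(1)] by blast
    then show ?thesis using g G_half_mem[OF g(1)] by auto
  qed
  moreover have "g \<circ> n \<circ> pinv g \<in> N" using N n g unfolding normal_sub_def by blast
  ultimately show ?thesis by blast
qed

text \<open>The first factor pushes \<open>half y1 u\<close> into the branch at \<open>y1\<close>,
  which lies off the branch at \<open>y2\<close>; the second factor pushes the result into the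
  latter. As \<open>half u y2\<close> is a proper part of \<open>half y1 u\<close>, the product
  shifts this half-tree into itself.\<close>

lemma normal_translation:
  assumes N: "normal_sub N" "N \<noteq> {id}"
    and u: "(u, y1) \<in> E" "(u, y2) \<in> E" "y1 \<noteq> y2"
  shows "\<exists>n\<in>N. n ` half y1 u \<subseteq> half u y2"
proof -
  obtain n1 where n1: "n1 \<in> N" "n1 ` half y1 u \<subseteq> half u y1" using normal_hyperbolic[OF N u(1)] by blast
  obtain n2 where n2: "n2 \<in> N" "n2 ` half y2 u \<subseteq> half u y2" using normal_hyperbolic[OF N u(2)] by blast
  have "half u y1 \<subseteq> half y2 u" using sibling_half(1)[OF u(2,1)] u by blast
  then have "(n2 \<circ> n1) ` half y1 u \<subseteq> half u y2" using n1 n2 by fastforce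
  moreover have "n2 \<circ> n1 \<in> N" using N n1 n2 unfolding normal_sub_def perm_subgroup_def by blast
  ultimately show ?thesis by blast
qed

text \<open>With the translates of \<open>S\<close> under powers of \<open>n\<close> pairwise disjoint, the infinite product
  \<open>h\<close> of the conjugates of \<open>f\<close> by \<open>n\<^sup>k\<close>, \<open>k \<ge> 0\<close>, satisfies \<open>f n h = h n\<close>, so that \<open>f\<close> is the
  commutator of \<open>h\<close> and \<open>n\<close>.\<close>

lemma commutator_of_disjoint_translates:
  assumes n: "n \<in> G" and f: "f \<in> G" and S: "S \<subseteq> V" and supp: "\<And>z. z \<notin> S \<Longrightarrow> f z = z"
    and disj: "\<And>j k. j < k \<Longrightarrow> (n ^^ j) ` S \<inter> (n ^^ k) ` S = {}"
  shows "\<exists>h\<in>G. f = h \<circ> n \<circ> pinv h \<circ> pinv n"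
proof -
  have nk: "n ^^ k \<in> G" for k using perm_subgroup_funpow G_sub n by blast
  define R where "R k = (n ^^ k) ` S" for k
  define c where "c k = (n ^^ k) \<circ> f \<circ> pinv (n ^^ k)" for k
  have cG: "c k \<in> G" for k using nk f by (simp add: c_def G_comp G_inv)
  have R_mem: "z \<in> R k \<longleftrightarrow> pinv (n ^^ k) z \<in> S" for z k
    using nk[of k] unfolding R_def by (auto intro!: image_eqI[of _ _ "pinv (n ^^ k) z"])
  have fS: "f z \<in> S \<longleftrightarrow> z \<in> S" for z
    using supp[of z] supp[of "f z"] G_inj[OF f] by metis
  have cR: "c k z \<in> R k \<longleftrightarrow> z \<in> R k" for k z using nk[of k] fS by (simp add: R_mem c_def)
  have c_out: "z \<notin> R k \<Longrightarrow> c k z = z" for k z using nk[of k] supp by (simp add: R_mem c_def)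
  have R_disj: "z \<in> R j \<Longrightarrow> z \<in> R k \<Longrightarrow> j = k" for j k z
    using disj[of j k] disj[of k j] unfolding R_def by (cases j k rule: linorder_cases) blast+
  have R_V: "R k \<subseteq> V" for k using S nk[of k] by (auto simp: R_def)
  define h where "h z = (if \<exists>k. z \<in> R k then c (THE k. z \<in> R k) z else z)" for z
  have h_in: "h z = c k z" if "z \<in> R k" for z k
  proof -
    have "(THE k. z \<in> R k) = k" using that R_disj by blast
    then show ?thesis using that by (auto simp: h_def)
  qed
  have h_out: "h z = z" if "\<And>k. z \<notin> R k" for z using that by (simp add: h_def)
  \<comment> \<open>The product of \<open>c 0\<close> to \<open>c (K - 1)\<close>. It lies in
    \<open>G\<close>, agrees with \<open>h\<close> on \<open>R k\<close> for \<open>k < K\<close>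
    and fixes all points outside these sets, so that \<open>h\<close> is the limit.\<close>
  define p where "p K = rec_nat id (\<lambda>k g. g \<circ> c k) K" for K
  have p_0: "p 0 = id" and p_Suc: "p (Suc K) = p K \<circ> c K" for K by (simp_all add: p_def)
  have pG: "p K \<in> G" for K
  proof (induction K)
    case 0 show ?case unfolding p_0 by (rule G_id)
  next
    case (Suc K) show ?case unfolding p_Suc by (rule G_comp[OF Suc cG])
  qed
  have p_out: "p K z = z" if "\<And>k. k < K \<Longrightarrow> z \<notin> R k" for K z
    using that by (induction K) (auto simp: p_0 p_Suc c_out)
  have p_in: "p K z = h z" if "k < K" "z \<in> R k" for K k z
    using that(1)
  proof (induction K)
    case (Suc K)
    show ?case
    proof (cases "k = K")
      case True
      then have "p K (c K z) = c K z" using p_out that(2) cR R_disj by (metis less_irrefl)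
      then show ?thesis using h_in that True by (simp add: p_Suc)
    next
      case False
      then have "c K z = z" using c_out R_disj that(2) by blast
      then show ?thesis using Suc False by (simp add: p_Suc)
    qed
  qed simp
  have hG: "h \<in> G"
  proof (rule limit_closed)
    show "h ` V = V"
    proof (intro equalityI subsetI)
      fix z assume "z \<in> h ` V"
      then obtain w where w: "w \<in> V" "z = h w" by blast
      then show "z \<in> V" using h_in h_out cG by (cases "\<exists>k. w \<in> R k") auto
    next
      fix z assume z: "z \<in> V"
      show "z \<in> h ` V"
      proof (cases "\<exists>k. z \<in> R k")
        case True
        then obtain k where k: "z \<in> R k" by blast
        have "pinv (c k) z \<in> R k" using k cR[of k "pinv (c k) z"] cG by simp
        then have "h (pinv (c k) z) = z" using h_in cG by simp
        moreover have "pinv (c k) z \<in> V" using z cG by (simp add: G_inv)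
        ultimately show ?thesis by (intro image_eqI[of _ _ "pinv (c k) z"]) auto
      next
        case False
        then show ?thesis using h_out z by (intro image_eqI[of _ _ z]) auto
      qed
    qed
    show "h x = x" if "x \<notin> V" for x using that R_V h_out by blast
    fix F assume F: "finite F" "F \<subseteq> V"
    \<comment> \<open>For \<open>z\<close> in no \<open>R k\<close> the value is arbitrary. It can
      only enlarge the bound \<open>K\<close>, and both maps fix such a \<open>z\<close>.\<close>
    define \<kappa> where "\<kappa> z = (SOME k. z \<in> R k)" for z
    have \<kappa>: "z \<in> R (\<kappa> z)" if "z \<in> R k" for z k using that unfolding \<kappa>_def by (rule someI)
    obtain K where K: "\<And>z. z \<in> F \<Longrightarrow> \<kappa> z < K"
      using finite_nat_set_iff_bounded[of "\<kappa> ` F"] F by auto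
    have "p K z = h z" if "z \<in> F" for z
    proof (cases "\<exists>k. z \<in> R k")
      case True then show ?thesis using p_in[OF K[OF that]] \<kappa> by blast
    next
      case False then show ?thesis using p_out h_out by metis
    qed
    then show "\<exists>g\<in>G. \<forall>x\<in>F. g x = h x" using pG by blast
  qed
  have shift: "n z \<in> R (Suc k) \<longleftrightarrow> z \<in> R k" for z k
    unfolding R_def using G_inj[OF n] by (auto simp: image_iff)
  have c_shift: "c (Suc k) (n z) = n (c k z)" for k z
  proof -
    have "pinv (n ^^ Suc k) (n z) = pinv (n ^^ k) z"
      by (subst G_inv_eq[OF nk]) (simp add: nk)
    then show ?thesis by (simp add: c_def)
  qed
  have R0: "R 0 = S" by (simp add: R_def)
  \<comment> \<open>From \<open>R k\<close> the point \<open>n (h z)\<close> moves on to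
    \<open>R (Suc k)\<close>, off \<open>S = R 0\<close>, where \<open>f\<close> is trivial. From
    outside all \<open>R k\<close>, the point \<open>n z\<close> can only enter \<open>S\<close>,
    where \<open>h\<close> is \<open>f\<close>.\<close>
  have "f (n (h z)) = h (n z)" for z
  proof (cases "\<exists>k. z \<in> R k")
    case True
    then obtain k where k: "z \<in> R k" by blast
    then have hz: "h z = c k z" "h (n z) = n (c k z)"
      using h_in[OF k] h_in[of "n z" "Suc k"] shift[of z k] c_shift[of k z] by simp_all
    have "n (c k z) \<in> R (Suc k)" using k shift cR by blast
    then have "n (c k z) \<notin> S" using R_disj[of "n (c k z)" 0 "Suc k"] R0 by blast
    then show ?thesis using hz supp by simp
  next
    case False
    then have hz: "h z = z" using h_out by blast
    show ?thesis
    proof (cases "n z \<in> S")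
      case True
      then have "h (n z) = f (n z)" using h_in[of "n z" 0] R0 by (simp add: c_def)
      then show ?thesis using hz by simp
    next
      case n: False
      have "n z \<notin> R k" for k using False shift n R0 by (cases k) auto
      then show ?thesis using hz h_out supp n by simp
    qed
  qed
  from this[of "pinv h (pinv n x)" for x] have "f = h \<circ> n \<circ> pinv h \<circ> pinv n"
    using hG n by (simp add: fun_eq_iff)
  then show ?thesis using hG by blast
qed

theorem simple: "simple_action"
  unfolding simple_action_def
proof (intro conjI allI impI)
  show "G \<noteq> {id}" using nontriv by auto
  fix N assume N: "normal_sub N"
  have NG: "N \<subseteq> G" and Nsub: "perm_subgroup N" using N by (auto simp: normal_sub_def)
  have Nc: "\<And>a b. a \<in> N \<Longrightarrow> b \<in> N \<Longrightarrow> a \<circ> b \<in> N" "\<And>a. a \<in> N \<Longrightarrow> pinv a \<in> N"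
    and Nconj: "\<And>a g. a \<in> N \<Longrightarrow> g \<in> G \<Longrightarrow> g \<circ> a \<circ> pinv g \<in> N"
    using N unfolding normal_sub_def perm_subgroup_def by auto
  show "N = G \<or> N = {id}"
  proof (rule disjCI)
    assume ne: "N \<noteq> {id}"
    obtain u y1 y2 y3 where u: "(u, y1) \<in> E" "(u, y2) \<in> E" "(u, y3) \<in> E" "y1 \<noteq> y2" "y1 \<noteq> y3" "y2 \<noteq> y3"
      by (rule branching) blast
    obtain n where n: "n \<in> N" "n ` half y1 u \<subseteq> half u y2"
      using normal_translation[OF N ne u(1,2,4)] by blast
    have nG: "n \<in> G" using n NG by blast
    have s: "half u y2 \<subseteq> half y1 u" "half u y3 \<subseteq> half y1 u" "half u y2 \<inter> half u y3 = {}"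
      using sibling_half u by auto
    have pw: "(n ^^ k) ` half y1 u \<subseteq> half y1 u" for k
    proof (induction k)
      case (Suc k)
      have "(n ^^ Suc k) ` half y1 u = n ` (n ^^ k) ` half y1 u" by (simp add: image_comp)
      also have "\<dots> \<subseteq> half u y2" using Suc n by blast
      finally show ?case using s by blast
    qed simp
    \<comment> \<open>\<open>half u y3\<close> lies in \<open>half y1 u\<close>, every positive
      power of \<open>n\<close> maps the latter into \<open>half u y2\<close>, and the branches at
      \<open>y2\<close> and \<open>y3\<close> are disjoint.\<close>
    have disj: "(n ^^ j) ` half u y3 \<inter> (n ^^ k) ` half u y3 = {}" if jk: "j < k" for j k
    proof -
      obtain i where i: "k = j + Suc i" using less_imp_Suc_add[OF jk] by auto
      have "(n ^^ Suc i) ` half u y3 = n ` (n ^^ i) ` half u y3" by (simp add: image_comp)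
      also have "\<dots> \<subseteq> n ` half y1 u" using pw[of i] s by blast
      also have "\<dots> \<subseteq> half u y2" by (rule n)
      finally have "half u y3 \<inter> (n ^^ Suc i) ` half u y3 = {}" using s by blast
      moreover have "inj (n ^^ j)" using G_bij perm_subgroup_funpow[OF G_sub nG] bij_is_inj by blast
      ultimately have "(n ^^ j) ` half u y3 \<inter> (n ^^ j) ` (n ^^ Suc i) ` half u y3 = {}"
        by (simp add: image_Int[symmetric] del: funpow.simps)
      then show ?thesis unfolding i add_Suc_right[symmetric] funpow_add by (simp only: image_comp)
    qed
    have rigid1: "f \<in> N" if f: "f \<in> G" "\<And>z. z \<notin> half u y3 \<Longrightarrow> f z = z" for f
    proof -
      obtain h where "h \<in> G" "f = h \<circ> n \<circ> pinv h \<circ> pinv n"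
        using commutator_of_disjoint_translates[OF nG f(1) half_sub f(2) disj] by blast
      then show ?thesis using Nc Nconj n by blast
    qed
    have rigid: "f \<in> N" if b: "(b, b') \<in> E" and f: "f \<in> G" "\<And>z. z \<notin> half b b' \<Longrightarrow> f z = z" for f b b'
    proof -
      obtain g where g: "g \<in> G" "half (g b) (g b') \<subseteq> half u y3" using half_transport[OF b u(3)] by blast
      have "g \<circ> f \<circ> pinv g \<in> N"
      proof (rule rigid1)
        fix z assume "z \<notin> half u y3"
        then have "pinv g z \<notin> half b b'" using g G_half_mem[OF g(1), of "pinv g z"] by auto
        then show "(g \<circ> f \<circ> pinv g) z = z" using f g by simp
      qed (use f g in \<open>simp add: G_comp G_inv\<close>)
      then have "pinv g \<circ> (g \<circ> f \<circ> pinv g) \<circ> pinv (pinv g) \<in> N" using Nconj g G_inv by blast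
      moreover have "pinv g \<circ> (g \<circ> f \<circ> pinv g) \<circ> pinv (pinv g) = f" using g by (simp add: fun_eq_iff G_inv_inv)
      ultimately show ?thesis by simp
    qed
    \<comment> \<open>By (P), \<open>g\<close> is the product of two elements of \<open>G\<close>,
      each supported on one side of the fixed edge, that is on a half-tree.\<close>
    have arc: "g \<in> N" if e: "(x, y) \<in> E" and g: "g \<in> G" "g x = x" "g y = y" for g x y
    proof -
      obtain g' where g': "g' \<in> G" "\<forall>z\<in>half x y. g' z = g z" "\<forall>z\<in>half y x. g' z = z"
        using edge_indep[OF e g] by blast
      have "g' \<in> N"
      proof (rule rigid[OF e g'(1)])
        fix z assume "z \<notin> half x y"
        then show "g' z = z" using g' half_iff[OF e] G_out[OF g'(1)] by (cases "z \<in> V") auto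
      qed
      moreover have "pinv g' \<circ> g \<in> N"
      proof (rule rigid[OF E_sym[OF e]])
        show "pinv g' \<circ> g \<in> G" using g g' by (simp add: G_comp G_inv)
        fix z assume z: "z \<notin> half y x"
        have "g z = g' z"
        proof (cases "z \<in> V")
          case True then show ?thesis using g'(2) z half_iff[OF e] by simp
        next
          case False then show ?thesis using G_out[OF g(1)] G_out[OF g'(1)] by simp
        qed
        then show "(pinv g' \<circ> g) z = z" using g' by simp
      qed
      ultimately have "g' \<circ> (pinv g' \<circ> g) \<in> N" using Nc by blast
      moreover have "g' \<circ> (pinv g' \<circ> g) = g" using g' by (simp add: fun_eq_iff)
      ultimately show ?thesis by simp
    qed
    have "G \<subseteq> N"
    proof (rule vertex_gen[OF Nsub NG])
      fix g x assume "g \<in> G" "x \<in> V" "g x = x"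
      moreover have "arc_stabs x \<subseteq> N" using arc unfolding arc_stabs_def by blast
      ultimately show "g \<in> N" using local_gen[of x] Nsub NG unfolding local_gen_def by blast
    qed
    then show "N = G" using NG by blast
  qed
qed

end

section \<open>Translations and actions of simple groups\<close>

context tree_rel
begin

lemma geodesic_path:
  assumes "x \<in> V" "z \<in> V"
  shows "\<exists>q. q 0 = x \<and> q (dist x z) = z \<and> (\<forall>i<dist x z. (q i, q (Suc i)) \<in> E) \<and> (\<forall>i\<le>dist x z. dist x (q i) = i)"
  using assms(2)
proof (induction "dist x z" arbitrary: z)
  case 0
  then have "x = z" using assms dist_0_iff by metis
  then show ?case by (intro exI[of _ "\<lambda>_. x"]) simp
next
  case (Suc n)
  have "z \<noteq> x" using Suc.hyps(2) by auto
  then obtain y where y: "(z, y) \<in> E" "Suc (dist x y) = dist x z"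
    using parent_ex[OF assms(1) Suc.prems] by blast
  have n: "n = dist x y" using y Suc.hyps(2) by simp
  obtain q where q: "q 0 = x" "q (dist x y) = y" "\<forall>i<dist x y. (q i, q (Suc i)) \<in> E"
    "\<forall>i\<le>dist x y. dist x (q i) = i"
    using Suc.hyps(1)[OF n] E_V(2)[OF y(1)] by blast
  have zn: "dist x z = Suc n" using Suc.hyps(2) by simp
  show ?case
  proof (intro exI[of _ "q(Suc n := z)"] conjI allI impI)
    fix i assume "i < dist x z"
    then have "i < n \<or> i = n" using zn by linarith
    then show "((q(Suc n := z)) i, (q(Suc n := z)) (Suc i)) \<in> E"
      using q n E_sym[OF y(1)] by auto
  next
    fix i assume "i \<le> dist x z"
    then have "i \<le> n \<or> i = Suc n" using zn by linarith
    then show "dist x ((q(Suc n := z)) i) = i" using q n zn by auto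
  qed (use q n zn in auto)
qed

lemma walk_dist: "(\<And>i. a \<le> i \<Longrightarrow> i < a + k \<Longrightarrow> (q i, q (Suc i)) \<in> E) \<Longrightarrow> q a \<in> V \<Longrightarrow> dist (q a) (q (a + k)) \<le> k"
proof (induction k)
  case (Suc k)
  have 1: "dist (q a) (q (a + k)) \<le> k" using Suc by simp
  have "(q (a + k), q (Suc (a + k))) \<in> E" using Suc.prems(1)[of "a + k"] by simp
  then show ?case using dist_step[OF Suc.prems(2)] 1 by fastforce
qed simp

end

context irreducible_action
begin

text \<open>An element that shifts \<open>half y1 u\<close> into itself has its axis through
  \<open>y1\<close> and \<open>u\<close>: the geodesic from \<open>y1\<close> to
  \<open>g y1\<close>, repeated under the powers of \<open>g\<close>. It is continued by one vertex,
  to \<open>g u\<close>, so that backtracking can be excluded where two copies meet.\<close>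

lemma translation_exists:
  "\<exists>g\<in>G. \<exists>(p :: int \<Rightarrow> 'v) (m :: int). m \<noteq> 0 \<and> inj p \<and> (\<forall>i. (p i, p (i + 1)) \<in> E) \<and> (\<forall>i. g (p i) = p (i + m))"
proof -
  obtain u y1 y2 y3 where u: "(u, y1) \<in> E" "(u, y2) \<in> E" "y1 \<noteq> y2"
    by (rule branching) blast
  have "normal_sub G" unfolding normal_sub_def using G_sub G_comp G_inv by auto
  moreover have "G \<noteq> {id}" using nontriv by auto
  ultimately obtain g where g: "g \<in> G" "g ` half y1 u \<subseteq> half u y2"
    using normal_translation[OF _ _ u] by blast
  have V: "u \<in> V" "y1 \<in> V" "g u \<in> V" "g y1 \<in> V" using u g E_V by auto
  have sib: "half u y2 \<subseteq> half y1 u" using sibling_half(1)[OF u] .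
  have "u \<in> half y1 u" using half_ends(1)[OF E_sym[OF u(1)]] .
  then have gu: "g u \<in> half u y2" using g by blast
  have e1: "(g y1, g u) \<in> E" using G_E[OF g(1) E_sym[OF u(1)]] .
  have y1: "y1 \<notin> half (g y1) (g u)"
    using half_ends(2)[OF E_sym[OF u(1)]] g sib G_half[OF g(1), of y1 u] by auto
  define m where "m = dist y1 (g y1)"
  have d_gu: "dist y1 (g u) = Suc m"
  proof -
    have "y1 \<in> half (g u) (g y1)" using half_iff[OF e1 V(2)] y1 by blast
    then have "dist y1 (g u) = Suc (dist y1 (g y1))" by (rule half_dist[OF E_sym[OF e1]])
    then show ?thesis by (simp add: m_def)
  qed
  obtain q where q: "q 0 = y1" "q (Suc m) = g u" "\<forall>i<Suc m. (q i, q (Suc i)) \<in> E"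
    "\<forall>i\<le>Suc m. dist y1 (q i) = i"
    using geodesic_path[OF V(2,3)] unfolding d_gu by blast
  have qV: "q i \<in> V" if "i \<le> Suc m" for i
  proof (cases "i < Suc m")
    case True then show ?thesis using q E_V by blast
  next
    case False then show ?thesis using that q V by (simp add: le_less)
  qed
  have qm: "q m = g y1"
  proof (rule unique_parent[OF V(2)])
    show "(g u, q m) \<in> E" using q(3)[rule_format, of m] q(2) E_sym by simp
    show "(g u, g y1) \<in> E" by (rule E_sym[OF e1])
    show "dist y1 (q m) \<le> dist y1 (g u)" using q(4) d_gu by simp
    show "dist y1 (g y1) \<le> dist y1 (g u)" using d_gu m_def by simp
  qed
  have m0: "0 < m"
  proof (rule ccontr)
    assume "\<not> 0 < m"
    then have "g y1 = y1" using qm q by simp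
    then have "(y1, g u) \<in> E" using e1 by simp
    moreover have "g u \<noteq> y1" using gu sib half_ends(2)[OF E_sym[OF u(1)]] by blast
    moreover have "half u y2 \<inter> half u y1 = {}" using sibling_half(2)[OF u] by blast
    moreover have "g u = u"
      using half_crossing[OF E_sym[OF u(1)] E_sym[OF \<open>(y1, g u) \<in> E\<close>]] gu sib half_ends[OF E_sym[OF u(1)]] by blast
    ultimately show False using gu half_ends(2)[OF u(2)] by simp
  qed
  have q1: "q 1 = u"
  proof (rule unique_parent[OF V(3)])
    show "(y1, q 1) \<in> E" using q(1) q(3)[rule_format, of 0] by simp
    show "(y1, u) \<in> E" by (rule E_sym[OF u(1)])
    have "dist (q 1) (q (1 + m)) \<le> m" by (rule walk_dist) (use q qV in auto)
    then show "dist (g u) (q 1) \<le> dist (g u) y1"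
      using d_gu q(2) dist_sym V qV[of 1] by simp
    have "g u \<in> half y1 u" using gu sib by blast
    then show "dist (g u) u \<le> dist (g u) y1" using half_dist[OF E_sym[OF u(1)]] by simp
  qed
  define gp where "gp k = (if 0 \<le> k then g ^^ nat k else pinv g ^^ nat (- k))" for k :: int
  have gpG: "gp k \<in> G" for k
    unfolding gp_def using perm_subgroup_funpow[OF G_sub] g G_inv by simp
  have gp_Suc: "gp (k + 1) x = g (gp k x)" for k x
  proof (cases "0 \<le> k")
    case True
    then have "nat (k + 1) = Suc (nat k)" by simp
    then show ?thesis using True by (simp add: gp_def)
  next
    case False
    then obtain j where j: "k = - int (Suc j)"
      using not_le zero_less_imp_eq_int[of "- k"] by (metis add.inverse_inverse gr0_conv_Suc neg_0_less_iff_less of_nat_0_less_iff)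
    have "gp (k + 1) x = (pinv g ^^ j) x" by (cases "j = 0") (simp_all add: gp_def j)
    then show ?thesis using g by (simp add: gp_def j nat_add_distrib)
  qed
  have gp_Suc': "gp (k + 1) x = gp k (g x)" for k x
  proof (cases "0 \<le> k")
    case True
    then have "nat (k + 1) = Suc (nat k)" by simp
    then show ?thesis using True by (simp add: gp_def funpow_swap1)
  next
    case False
    then obtain j where j: "k = - int (Suc j)"
      using not_le zero_less_imp_eq_int[of "- k"] by (metis add.inverse_inverse gr0_conv_Suc neg_0_less_iff_less of_nat_0_less_iff)
    have "gp (k + 1) x = (pinv g ^^ j) x" by (cases "j = 0") (simp_all add: gp_def j)
    then show ?thesis using g by (simp add: gp_def j nat_add_distrib funpow_swap1)
  qed
  \<comment> \<open>Only the first \<open>m\<close> vertices of \<open>q\<close> enter. The formula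
    extends to \<open>r = m\<close> and \<open>r = Suc m\<close> in \<open>p_eq\<close>, because
    \<open>q m = g (q 0)\<close> and \<open>q (Suc m) = g (q 1)\<close>.\<close>
  define p where "p i = gp (i div int m) (q (nat (i mod int m)))" for i :: int
  have p_eq: "p (k * int m + int r) = gp k (q r)" if "r \<le> Suc m" for k r
  proof -
    have small: "p (k * int m + int r) = gp k (q r)" if "r < m" for k r
      using that m0 unfolding p_def by (simp add: div_pos_pos_trivial mod_pos_pos_trivial)
    have mid: "p (k * int m + int m) = gp k (q m)" for k
    proof -
      have "k * int m + int m = (k + 1) * int m + int 0" by (simp add: algebra_simps)
      then have "p (k * int m + int m) = gp (k + 1) (q 0)" using small[OF m0, of "k + 1"] by simp
      then show ?thesis using gp_Suc' q qm by simp
    qed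
    consider "r < m" | "r = m" | "r = Suc m" using \<open>r \<le> Suc m\<close> by linarith
    then show ?thesis
    proof cases
      case 3
      have eq: "k * int m + int r = (k + 1) * int m + int 1" using 3 by (simp add: algebra_simps)
      have "p ((k + 1) * int m + int 1) = gp (k + 1) (q 1)"
      proof (cases "1 < m")
        case True then show ?thesis by (rule small)
      next
        case False
        then have "m = 1" using m0 by simp
        then show ?thesis using mid[of "k + 1"] by simp
      qed
      then show ?thesis unfolding eq using 3 gp_Suc' q1 q by simp
    qed (use small mid in auto)
  qed
  have decomp: "\<exists>k r. i = k * int m + int r \<and> r < m" for i
    using m0 by (intro exI[of _ "i div int m"] exI[of _ "nat (i mod int m)"]) (simp add: nat_less_iff)
  have edges: "(p i, p (i + 1)) \<in> E" for i
  proof -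
    obtain k r where kr: "i = k * int m + int r" "r < m" using decomp by blast
    have "p i = gp k (q r)" "p (i + 1) = gp k (q (Suc r))"
      using p_eq[of r k] p_eq[of "Suc r" k] kr by (simp_all add: algebra_simps)
    then show ?thesis using q(3) kr gpG G_E by simp
  qed
  have nb: "p (i - 1) \<noteq> p (i + 1)" for i
  proof -
    obtain k r where kr: "i - 1 = k * int m + int r" "r < m" using decomp by blast
    then have i: "i + 1 = k * int m + int (Suc (Suc r))" by simp
    have "p (i - 1) = gp k (q r)" "p (i + 1) = gp k (q (Suc (Suc r)))"
      unfolding kr i using kr by (intro p_eq; simp)+
    moreover have "q r \<noteq> q (Suc (Suc r))"
    proof
      assume "q r = q (Suc (Suc r))"
      moreover have "dist y1 (q r) = r" "dist y1 (q (Suc (Suc r))) = Suc (Suc r)"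
        using q(4) kr by (auto simp: Suc_leI)
      ultimately show False by simp
    qed
    ultimately show ?thesis using G_inj[OF gpG] by simp
  qed
  have "g (p i) = p (i + int m)" for i
  proof -
    obtain k r where kr: "i = k * int m + int r" "r < m" using decomp by blast
    have "p i = gp k (q r)" "p (i + int m) = gp (k + 1) (q r)"
      using p_eq[of r k] p_eq[of r "k + 1"] kr by (simp_all add: algebra_simps)
    then show ?thesis using gp_Suc by simp
  qed
  then show ?thesis using g nonbacktracking_inj[OF edges nb] edges m0
    by (intro bexI[of _ g] exI[of _ p] exI[of _ "int m"]) auto
qed

end

section \<open>Functions on the vertices under the action of a simple group\<close>

context tree_action
begin

text \<open>A simple group acting on a set of functions acts trivially as soon as some non-trivial
  element does. Below, the functions are determined by their value at one vertex, and the
  non-trivial element is taken from a vertex stabiliser.\<close>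

lemma simple_acts_trivially:
  fixes act :: "('v \<Rightarrow> 'v) \<Rightarrow> ('v \<Rightarrow> 'f) \<Rightarrow> ('v \<Rightarrow> 'f)"
  assumes simple: "simple_action"
    and act_C: "\<And>g c. g \<in> G \<Longrightarrow> c \<in> C \<Longrightarrow> act g c \<in> C"
    and act_comp: "\<And>g h c. g \<in> G \<Longrightarrow> h \<in> G \<Longrightarrow> act (g \<circ> h) c = act g (act h c)"
    and act_id: "\<And>c. act id c = c"
    and act_cong: "\<And>g c d. g \<in> G \<Longrightarrow> (\<And>x. x \<in> V \<Longrightarrow> c x = d x) \<Longrightarrow> (\<And>x. x \<in> V \<Longrightarrow> act g c x = act g d x)"
    and n: "n \<in> G" "n \<noteq> id" "\<And>c x. c \<in> C \<Longrightarrow> x \<in> V \<Longrightarrow> act n c x = c x"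
    and g: "g \<in> G" and c: "c \<in> C" and x: "x \<in> V"
  shows "act g c x = c x"
proof -
  define K where "K = {g \<in> G. \<forall>c\<in>C. \<forall>x\<in>V. act g c x = c x}"
  have "normal_sub K" unfolding normal_sub_def perm_subgroup_def
  proof (intro conjI ballI)
    show "K \<subseteq> G" by (auto simp: K_def)
    show "id \<in> K" by (simp add: K_def act_id)
    fix a assume a: "a \<in> K"
    then have aG: "a \<in> G" by (simp add: K_def)
    show "a \<circ> b \<in> K" if "b \<in> K" for b
      using a that by (simp add: K_def G_comp act_comp act_C)
    have "act (pinv a) d x = d x" if "d \<in> C" "x \<in> V" for d x
    proof -
      have "act (pinv a) d x = act a (act (pinv a) d) x"
        using a that act_C G_inv by (simp add: K_def)
      also have "\<dots> = d x"
        using act_comp[OF aG G_inv[OF aG], of d] by (simp add: G_inv_comp[OF aG] act_id)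
      finally show ?thesis .
    qed
    then show "pinv a \<in> K" using aG by (simp add: K_def G_inv)
    fix b assume b: "b \<in> G"
    have "act (b \<circ> a \<circ> pinv b) d x = d x" if "d \<in> C" "x \<in> V" for d x
    proof -
      have "act (b \<circ> a \<circ> pinv b) d x = act b (act a (act (pinv b) d)) x"
        using act_comp[OF G_comp[OF b aG] G_inv[OF b]] act_comp[OF b aG] by simp
      also have "\<dots> = act b (act (pinv b) d) x"
        by (rule act_cong[OF b _ that(2)]) (use a b that act_C G_inv in \<open>simp add: K_def\<close>)
      also have "\<dots> = d x"
        using act_comp[OF b G_inv[OF b], of d] by (simp add: G_inv_comp[OF b] act_id)
      finally show ?thesis .
    qed
    then show "b \<circ> a \<circ> pinv b \<in> K" using aG b by (simp add: K_def G_comp G_inv)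
  qed
  moreover have "n \<in> K" using n by (simp add: K_def)
  ultimately have "K = G" using simple n(2) unfolding simple_action_def by blast
  then show ?thesis using g c x unfolding K_def by blast
qed

end

text \<open>\<open>stab_nontriv\<close> is what the absence of a finite vertex set with trivial
  fixator says of single vertices; it provides the element \<open>n\<close> of
  \<open>simple_acts_trivially\<close>.\<close>

locale simple_tree_action = tree_action V E G for V :: "'v set" and E :: "('v \<times> 'v) set" and G :: "('v \<Rightarrow> 'v) set" +
  assumes simple: "simple_action"
    and stab_nontriv: "x \<in> V \<Longrightarrow> \<exists>g\<in>G. g \<noteq> id \<and> g x = x"
begin

text \<open>A non-trivial \<open>n\<close> fixing \<open>x\<close> preserves all values at
  \<open>x\<close>, and such a value determines a member of the family. So \<open>n\<close> acts
  trivially on the family, and by simplicity so does \<open>G\<close>.\<close>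

lemma invariant_of_family:
  fixes C :: "('v \<Rightarrow> 'f) set"
  assumes C: "\<And>g c. g \<in> G \<Longrightarrow> c \<in> C \<Longrightarrow> c \<circ> g \<in> C"
    and eq: "\<And>c d x y. c \<in> C \<Longrightarrow> d \<in> C \<Longrightarrow> x \<in> V \<Longrightarrow> c x = d x \<Longrightarrow> y \<in> V \<Longrightarrow> c y = d y"
    and c: "c \<in> C" and g: "g \<in> G" and x: "x \<in> V"
  shows "c (g x) = c x"
proof -
  obtain n where n: "n \<in> G" "n \<noteq> id" "n x = x" using stab_nontriv x by blast
  have "(c \<circ> pinv (pinv g)) x = c x"
  proof (rule simple_acts_trivially[where act = "\<lambda>g c. c \<circ> pinv g" and C = C and n = n])
    show "(d \<circ> pinv n) y = d y" if "d \<in> C" "y \<in> V" for d y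
    proof (rule eq[OF _ that(1) x _ that(2)])
      show "d \<circ> pinv n \<in> C" using C that n G_inv by blast
      have "pinv n x = x" using n G_inv_eq by simp
      then show "(d \<circ> pinv n) x = d x" by simp
    qed
  qed (use C G_inv n simple c g x in \<open>auto simp: G_inv_dist comp_assoc\<close>)
  then show ?thesis using g by (simp add: G_inv_inv)
qed

text \<open>Colourings that change exactly across \<open>Q\<close> exist because a tree has no
  cycles, and they are determined by one value, so \<open>invariant_of_family\<close> applies. For
  suitable \<open>Q\<close> the outcome refutes loops, multiple edges and cycles of the
  quotient.\<close>

lemma parity:
  assumes Q: "\<And>x y. (x, y) \<in> Q \<Longrightarrow> (y, x) \<in> Q" "\<And>g x y. g \<in> G \<Longrightarrow> (g x, g y) \<in> Q \<longleftrightarrow> (x, y) \<in> Q"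
  shows "\<exists>c :: 'v \<Rightarrow> bool. (\<forall>(x, y)\<in>E. c x \<noteq> c y \<longleftrightarrow> (x, y) \<in> Q) \<and> (\<forall>g\<in>G. \<forall>x\<in>V. c (g x) = c x)"
proof (cases "V = {}")
  case False
  then obtain r where r: "r \<in> V" by blast
  define C where "C = {c :: 'v \<Rightarrow> bool. \<forall>(x, y)\<in>E. c x \<noteq> c y \<longleftrightarrow> (x, y) \<in> Q}"
  have "\<exists>c. c r = True \<and> (\<forall>x\<in>V. c x \<in> UNIV) \<and> (\<forall>(x, y)\<in>E. c y = (if (x, y) \<in> Q then \<not> c x else c x))"
    by (rule section_exists[OF r]) (use Q in auto)
  then obtain c where c: "\<forall>(x, y)\<in>E. c y = (if (x, y) \<in> Q then \<not> c x else c x)" by blast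
  have "c x \<noteq> c y \<longleftrightarrow> (x, y) \<in> Q" if "(x, y) \<in> E" for x y
    using bspec[OF c that] by (cases "(x, y) \<in> Q") simp_all
  then have cC: "c \<in> C" unfolding C_def by blast
  have "c (g x) = c x" if "g \<in> G" "x \<in> V" for g x
  proof (rule invariant_of_family[OF _ _ cC that])
    show "c \<circ> g \<in> C" if "g \<in> G" "c \<in> C" for g c
      using that G_E[OF that(1)] Q(2)[OF that(1)] unfolding C_def comp_apply by blast
    show "c y = d y" if "c \<in> C" "d \<in> C" "x \<in> V" "c x = d x" "y \<in> V" for c d x y
      using that(3,5)
    proof (induction rule: tree_induct)
      case (step x y)
      then show ?case using that(1,2) unfolding C_def by blast
    qed (rule that)
  qed
  then show ?thesis using cC unfolding C_def by blast
qed (use E_sub in auto)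

text \<open>The arcs of \<open>S\<close> point to an end fixed by \<open>G\<close>. The height
  towards this end is determined by one value, hence invariant. The rays from \<open>x0\<close> and
  \<open>g x0\<close> towards the end merge, by equal heights after the same number of steps, so
  \<open>g\<close> fixes the vertex where they meet.\<close>

lemma total_scopo_fixes_point:
  assumes S: "arc_scopo S" "\<And>x. x \<in> V \<Longrightarrow> \<exists>y. (x, y) \<in> S" and g: "g \<in> G" and V: "x0 \<in> V"
  shows "\<exists>x\<in>V. g x = x"
proof -
  have SE: "(x, y) \<in> S \<Longrightarrow> (x, y) \<in> E" for x y using S unfolding arc_scopo_def by blast
  have SG: "(x, y) \<in> S \<Longrightarrow> h \<in> G \<Longrightarrow> (h x, h y) \<in> S" for x y h using S unfolding arc_scopo_def by blast
  have Sa: "(x, y) \<in> S \<Longrightarrow> (y, x) \<notin> S" for x y using S unfolding arc_scopo_def by blast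
  have Sb: "(x, y) \<in> S \<Longrightarrow> (z, x) \<in> E \<Longrightarrow> z \<noteq> y \<Longrightarrow> (z, x) \<in> S" for x y z
    using S unfolding arc_scopo_def by blast
  have Su: "(x, y) \<in> S \<Longrightarrow> (x, z) \<in> S \<Longrightarrow> y = z" for x y z
    using Sb[of x y z] SE E_sym Sa by blast
  have St: "(x, y) \<in> S \<or> (y, x) \<in> S" if e: "(x, y) \<in> E" for x y
  proof -
    obtain z where "(x, z) \<in> S" using S(2) E_V e by blast
    then show ?thesis using Sb E_sym e by blast
  qed
  have SG_iff: "(h x, h y) \<in> S \<longleftrightarrow> (x, y) \<in> S" if "h \<in> G" for h x y
    using SG[of x y h] SG[of "h x" "h y" "pinv h"] that G_inv by auto
  define C where "C = {c :: 'v \<Rightarrow> int. \<forall>(x, y)\<in>S. c y = c x + 1}"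
  have "\<exists>c :: 'v \<Rightarrow> int. c x0 = 0 \<and> (\<forall>x\<in>V. c x \<in> UNIV) \<and>
    (\<forall>(x, y)\<in>E. c y = (if (x, y) \<in> S then c x + 1 else c x - 1))"
    by (rule section_exists[OF V]) (use Sa St E_sym in auto)
  then obtain c :: "'v \<Rightarrow> int" where c: "\<forall>(x, y)\<in>E. c y = (if (x, y) \<in> S then c x + 1 else c x - 1)"
    by blast
  have cC: "c \<in> C" using c SE unfolding C_def by fastforce
  have cg: "c (g x) = c x" if "x \<in> V" for x
  proof (rule invariant_of_family[OF _ _ cC g that])
    show "c \<circ> g \<in> C" if "g \<in> G" "c \<in> C" for g c
      using that SG unfolding C_def by fastforce
    show "c y = d y" if "c \<in> C" "d \<in> C" "x \<in> V" "c x = d x" "y \<in> V" for c d x y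
      using that(3,5)
    proof (induction rule: tree_induct)
      case (step x y)
      then show ?case using that(1,2) St[of x y] unfolding C_def by fastforce
    qed (rule that)
  qed
  define f where "f x = (SOME y. (x, y) \<in> S)" for x
  have f: "(x, f x) \<in> S" if "x \<in> V" for x using someI_ex[OF S(2)[OF that]] by (simp add: f_def)
  have fV: "(f ^^ n) x \<in> V" if "x \<in> V" for x n
  proof (induction n)
    case (Suc n)
    then show ?case using E_V(2)[OF SE[OF f[OF Suc]]] by simp
  qed (use that in simp)
  have f_eq: "f x = y" if "(x, y) \<in> S" for x y
    using f[of x] Su that SE E_V by blast
  have cf: "c ((f ^^ n) x) = c x + int n" if "x \<in> V" for x n
  proof (induction n)
    case (Suc n)
    then show ?case using f[OF fV[OF that, of n]] cC unfolding C_def by auto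
  qed simp
  have fg: "(f ^^ n) (g x) = g ((f ^^ n) x)" if "x \<in> V" for x n
  proof (induction n)
    case (Suc n)
    then show ?case using f_eq[OF SG[OF f[OF fV[OF that, of n]] g]] by simp
  qed simp
  have meet: "\<exists>i j. (f ^^ i) x = (f ^^ j) y" if "x \<in> V" "y \<in> V" for x y
    using that
  proof (induction rule: tree_induct)
    case root then show ?case by blast
  next
    case (step y z)
    then obtain i j where ij: "(f ^^ i) x = (f ^^ j) y" by blast
    have "f y = z \<or> f z = y" using St[OF step(1)] f_eq by blast
    then show ?case
    proof
      assume "f y = z"
      then have "(f ^^ Suc i) x = (f ^^ j) z" using ij by (simp add: funpow_swap1)
      then show ?thesis by blast
    next
      assume "f z = y"
      then have "(f ^^ i) x = (f ^^ Suc j) z" using ij by (simp add: funpow_swap1)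
      then show ?thesis by blast
    qed
  qed
  obtain i j where ij: "(f ^^ i) x0 = (f ^^ j) (g x0)" using meet V g by (metis G_V)
  have "c x0 + int i = c (g x0) + int j" using arg_cong[OF ij, of c] cf V g by simp
  then have "i = j" using cg[OF V] by simp
  then have "g ((f ^^ i) x0) = (f ^^ i) x0" using ij fg[OF V] by simp
  then show ?thesis using fV V by blast
qed

end

section \<open>Scopos and local generation\<close>

context tree_action
begin

text \<open>Arcs of \<open>S\<close> propagate backwards: once the arc from \<open>a\<close> towards
  \<open>y\<close> is in \<open>S\<close>, so are the arcs into \<open>a\<close> from all its other
  neighbours. Hence every vertex behind the given arc has its own arc towards
  \<open>y\<close>.\<close>

lemma scopo_behind:
  assumes S: "arc_scopo S" and xy: "(x, y) \<in> S" and u: "u \<in> half y x"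
  shows "\<exists>w. (u, w) \<in> S"
proof -
  have SE: "(a, b) \<in> S \<Longrightarrow> (a, b) \<in> E" for a b using S unfolding arc_scopo_def by blast
  have Sb: "(a, b) \<in> S \<Longrightarrow> (z, a) \<in> E \<Longrightarrow> z \<noteq> b \<Longrightarrow> (z, a) \<in> S" for a b z
    using S unfolding arc_scopo_def by blast
  have yV: "y \<in> V" "x \<in> V" using SE[OF xy] E_V by auto
  have "\<exists>w. (u, w) \<in> S \<and> Suc (dist y w) = dist y u"
    using E_sym[OF SE[OF xy]] u
  proof (induction rule: half_induct)
    case root
    then show ?case using xy dist_edge[OF E_sym[OF SE[OF xy]]] by (intro exI[of _ y]) simp
  next
    case (step a b)
    then obtain w where w: "(a, w) \<in> S" "Suc (dist y w) = dist y a" by blast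
    have V: "a \<in> V" "b \<in> V" using step E_V by auto
    have "dist b y = Suc (dist b x)" "dist a y = Suc (dist a x)"
      using half_dist[OF E_sym[OF SE[OF xy]]] step by auto
    then have d: "dist y b = Suc (dist y a)" using step(4) dist_sym V yV by simp
    then have "b \<noteq> w" using w by auto
    then have "(b, a) \<in> S" using Sb[OF w(1)] E_sym step(1) by blast
    then show ?case using d by (intro exI[of _ a]) simp
  qed
  then show ?thesis by blast
qed

text \<open>The distances from a fixed vertex to the points of the axis would be periodic, hence
  attain a maximum, and there \<open>unique_parent\<close> makes the axis backtrack.\<close>

lemma translation_no_fixed_point:
  fixes p :: "int \<Rightarrow> 'v" and m :: int
  assumes p: "inj p" "\<And>i. (p i, p (i + 1)) \<in> E" and m: "m \<noteq> 0"
    and g: "g \<in> G" "\<And>i. g (p i) = p (i + m)" and x: "x \<in> V"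
  shows "g x \<noteq> x"
proof
  assume gx: "g x = x"
  have per: "dist x (p (i + m)) = dist x (p i)" for i
    using G_dist[OF g(1), of x "p i"] g gx by simp
  have per': "dist x (p (i + int k * m)) = dist x (p i)" for i k
  proof (induction k)
    case (Suc k)
    then show ?case using per[of "i + int k * m"] by (simp add: algebra_simps)
  qed simp
  have per'': "dist x (p (i + k * m)) = dist x (p i)" for i k
  proof (cases "0 \<le> k")
    case True then show ?thesis using per'[of i "nat k"] by simp
  next
    case False then show ?thesis using per'[of "i + k * m" "nat (- k)"] by simp
  qed
  have "range (\<lambda>i. dist x (p i)) \<subseteq> (\<lambda>i. dist x (p i)) ` {- \<bar>m\<bar>..\<bar>m\<bar>}"
  proof clarify
    fix i
    have "i mod m + (i div m) * m = i" by simp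
    then have "dist x (p i) = dist x (p (i mod m))" using per''[of "i mod m" "i div m"] by simp
    moreover have "i mod m \<in> {- \<bar>m\<bar>..\<bar>m\<bar>}"
      using m abs_mod_less[of m i] unfolding atLeastAtMost_iff by linarith
    ultimately show "dist x (p i) \<in> (\<lambda>i. dist x (p i)) ` {- \<bar>m\<bar>..\<bar>m\<bar>}" by blast
  qed
  then have fin: "finite (range (\<lambda>i. dist x (p i)))" by (rule finite_subset) simp
  obtain i where i: "dist x (p i) = Max (range (\<lambda>i. dist x (p i)))"
    using Max_in[OF fin] by auto
  have le: "dist x (p j) \<le> dist x (p i)" for j unfolding i by (rule Max_ge[OF fin]) simp
  have "p (i - 1) = p (i + 1)"
    by (rule unique_parent[OF x _ p(2) le le]) (use E_sym p(2)[of "i - 1"] in simp)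
  then have "i - 1 = i + 1" using p(1) by (simp only: inj_eq)
  then show False by simp
qed

text \<open>The scopo condition carries the given arc one way along the axis and the translation
  carries it the other way, so \<open>S\<close> contains all arcs of the axis in this direction. A
  vertex \<open>z\<close> without an outgoing arc lies behind none of them, and its distance to the
  axis points would decrease forever.\<close>

lemma axis_not_behind:
  fixes p :: "int \<Rightarrow> 'v" and m :: int
  assumes p: "\<And>i. (p i, p (i + 1)) \<in> E" and inj: "inj p" and m: "m \<noteq> 0"
    and g: "g \<in> G" "\<And>i. g (p i) = p (i + m)"
    and S: "arc_scopo S" and i: "(p (i + 1), p i) \<in> S" and z: "z \<in> V"
  shows "\<exists>w. (z, w) \<in> S"
proof (rule ccontr)
  assume c: "\<not> ?thesis"
  have Sb: "(a, b) \<in> S \<Longrightarrow> (z, a) \<in> E \<Longrightarrow> z \<noteq> b \<Longrightarrow> (z, a) \<in> S" for a b z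
    using S unfolding arc_scopo_def by blast
  have SG: "(x, y) \<in> S \<Longrightarrow> h \<in> G \<Longrightarrow> (h x, h y) \<in> S" for x y h using S unfolding arc_scopo_def by blast
  have g': "pinv g (p j) = p (j - m)" for j using G_inv_eq[OF g(1)] g(2)[of "j - m"] by simp
  have fw: "(p (j + int k + 1), p (j + int k)) \<in> S" if "(p (j + 1), p j) \<in> S" for j k
  proof (induction k)
    case (Suc k)
    let ?j = "j + int k"
    have "(p (?j + 1 + 1), p (?j + 1)) \<in> E" by (rule E_sym[OF p])
    moreover have "p (?j + 1 + 1) \<noteq> p ?j" using inj by (simp add: inj_eq)
    ultimately have "(p (?j + 1 + 1), p (?j + 1)) \<in> S" by (rule Sb[OF Suc])
    then show ?case by (simp add: algebra_simps)
  qed (use that in simp)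
  have bw: "(p (j - \<bar>m\<bar> + 1), p (j - \<bar>m\<bar>)) \<in> S" if "(p (j + 1), p j) \<in> S" for j
  proof (cases "0 \<le> m")
    case True
    have "(pinv g (p (j + 1)), pinv g (p j)) \<in> S" by (rule SG[OF that G_inv[OF g(1)]])
    then show ?thesis using True by (simp add: g' algebra_simps)
  next
    case False
    have "(g (p (j + 1)), g (p j)) \<in> S" by (rule SG[OF that g(1)])
    then show ?thesis using False by (simp add: g(2) algebra_simps)
  qed
  have bws: "(p (i - int k * \<bar>m\<bar> + 1), p (i - int k * \<bar>m\<bar>)) \<in> S" for k
  proof (induction k)
    case (Suc k)
    then show ?case using bw[OF Suc] by (simp add: algebra_simps)
  qed (use i in simp)
  have all: "(p (j + 1), p j) \<in> S" for j
  proof -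
    \<comment> \<open>Going back \<open>?k\<close> periods means at least \<open>?k\<close> steps
      since \<open>m \<noteq> 0\<close>, so it leads to or below \<open>j\<close>; from there
      \<open>fw\<close> reaches \<open>j\<close>.\<close>
    let ?k = "nat \<bar>i - j\<bar>"
    have "int ?k * 1 \<le> int ?k * \<bar>m\<bar>" using m by (intro mult_left_mono) auto
    then have "i - int ?k * \<bar>m\<bar> \<le> j" by linarith
    then obtain n where "j = (i - int ?k * \<bar>m\<bar>) + int n" using zle_iff_zadd by blast
    then show ?thesis using fw[OF bws[of ?k], of n] by simp
  qed
  have down: "dist z (p j) < dist z (p (j + 1))" for j
  proof -
    have "z \<notin> half (p j) (p (j + 1))" using scopo_behind[OF S all[of j]] c by blast
    then have "z \<in> half (p (j + 1)) (p j)" using half_iff[OF p] z by blast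
    then show ?thesis by (simp add: half_def)
  qed
  have "dist z (p (- int n)) + n \<le> dist z (p 0)" for n
  proof (induction n)
    case (Suc n)
    then show ?case using down[of "- int (Suc n)"] by (simp add: algebra_simps)
  qed simp
  from this[of "Suc (dist z (p 0))"] show False by simp
qed

end

section \<open>Scopos and vertex stabilisers under simplicity\<close>

context simple_tree_action
begin

text \<open>The vertices without an outgoing arc in \<open>S\<close> form an invariant convex set.
  If it contains the axis, minimality makes it all of \<open>V\<close>. If it misses a point of the
  axis, one of the two axis arcs into this point is in \<open>S\<close>, and then every vertex has
  an outgoing arc, against \<open>total_scopo_fixes_point\<close>.\<close>

lemma scopo_empty:
  fixes p :: "int \<Rightarrow> 'v" and m :: int
  assumes p: "inj p" "\<And>i. (p i, p (i + 1)) \<in> E" and m: "m \<noteq> 0"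
    and g: "g \<in> G" "\<And>i. g (p i) = p (i + m)"
    and minimal: "\<And>W. convex W \<Longrightarrow> (\<And>h. h \<in> G \<Longrightarrow> h ` W = W) \<Longrightarrow> range p \<subseteq> W \<Longrightarrow> W = V"
    and S: "arc_scopo S"
  shows "S = {}"
proof -
  have SE: "(x, y) \<in> S \<Longrightarrow> (x, y) \<in> E" for x y using S unfolding arc_scopo_def by blast
  have SG: "(x, y) \<in> S \<Longrightarrow> h \<in> G \<Longrightarrow> (h x, h y) \<in> S" for x y h using S unfolding arc_scopo_def by blast
  have Sb: "(x, y) \<in> S \<Longrightarrow> (z, x) \<in> E \<Longrightarrow> z \<noteq> y \<Longrightarrow> (z, x) \<in> S" for x y z
    using S unfolding arc_scopo_def by blast
  define W where "W = {x \<in> V. \<nexists>y. (x, y) \<in> S}"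
  have not_total: "\<exists>z\<in>V. \<nexists>w. (z, w) \<in> S"
  proof (rule ccontr)
    assume "\<not> ?thesis"
    then obtain x where "x \<in> V" "g x = x"
      using total_scopo_fixes_point[OF S _ g(1), of "p 0"] E_V p(2) by blast
    then show False using translation_no_fixed_point[OF p m g] by blast
  qed
  have pW: "p i \<in> W" for i
  proof (rule ccontr)
    assume "p i \<notin> W"
    then obtain q where q: "(p i, q) \<in> S" using E_V p(2) unfolding W_def by blast
    have e: "(p (i + 1), p i) \<in> E" "(p (i - 1), p i) \<in> E"
      using E_sym[OF p(2)] p(2)[of "i - 1"] by auto
    have "p (i + 1) \<noteq> p (i - 1)" using p(1) by (simp add: inj_eq)
    then have "(p (i + 1), p i) \<in> S \<or> (p (i - 1), p i) \<in> S" using Sb[OF q] e by metis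
    then show False
    proof
      assume "(p (i + 1), p i) \<in> S"
      then show False using axis_not_behind[OF p(2,1) m g S] not_total by blast
    next
      assume *: "(p (i - 1), p i) \<in> S"
      define p' where "p' j = p (- j)" for j
      have "\<exists>w. (z, w) \<in> S" if "z \<in> V" for z
      proof (rule axis_not_behind[of p' "- m" g S "- i" z])
        show "(p' j, p' (j + 1)) \<in> E" for j using E_sym[OF p(2)[of "- j - 1"]] by (simp add: p'_def)
        show "inj p'" using p(1) unfolding p'_def inj_def by (metis minus_equation_iff)
        show "g (p' j) = p' (j + - m)" for j using g(2)[of "- j"] by (simp add: p'_def)
        show "(p' (- i + 1), p' (- i)) \<in> S" using * by (simp add: p'_def)
      qed (use m g S that in auto)
      then show False using not_total by blast
    qed
  qed
  have "convex W" unfolding convex_def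
  proof (intro conjI ballI allI impI)
    fix x y assume x: "x \<in> W" and y: "(x, y) \<in> E \<and> W \<inter> half x y \<noteq> {}"
    show "y \<in> W"
    proof (rule ccontr)
      assume "y \<notin> W"
      then obtain q where q: "(y, q) \<in> S" using y E_V unfolding W_def by blast
      then have "q = x" using Sb[OF q] y x unfolding W_def by blast
      then show False using scopo_behind[OF S] q y unfolding W_def by blast
    qed
  qed (auto simp: W_def)
  moreover have "h ` W = W" if h: "h \<in> G" for h
  proof -
    have sub: "k ` W \<subseteq> W" if "k \<in> G" for k
    proof clarify
      fix x assume x: "x \<in> W"
      have "\<not> (k x, y) \<in> S" for y
        using SG[of "k x" y "pinv k"] that G_inv x unfolding W_def by auto
      then show "k x \<in> W" using that x by (simp add: W_def)
    qed
    have "W \<subseteq> h ` W"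
    proof
      fix x assume "x \<in> W"
      then have "pinv h x \<in> W" using sub[OF G_inv[OF h]] by blast
      then show "x \<in> h ` W" using h by (intro image_eqI[of _ _ "pinv h x"]) auto
    qed
    then show ?thesis using sub[OF h] by blast
  qed
  moreover have "range p \<subseteq> W" using pW by blast
  ultimately have "W = V" by (rule minimal)
  then have "(x, y) \<notin> S" if "x \<in> V" for x y using that unfolding W_def by blast
  then have "p \<notin> S" for p using SE E_V(1) by (cases p) blast
  then show ?thesis by blast
qed

text \<open>If \<open>M\<close> contains the arc stabilisers at \<open>v\<close>, transport along arcs of \<open>T\<close> of left cosets of
  \<open>M\<close> is well defined and equivariant, so that \<open>G\<close> acts on its global sections. Stabilisers of
  vertices outside the orbit of \<open>v\<close> act trivially, hence so does \<open>G\<close>.\<close>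

lemma simple_local_gen:
  assumes v: "(v, a) \<in> E" and no_loop: "\<And>g. g \<in> G \<Longrightarrow> (v, g v) \<notin> E"
  shows "local_gen v"
  unfolding local_gen_def
proof (intro allI impI ballI)
  fix M0 g0 assume M0: "perm_subgroup M0 \<and> M0 \<subseteq> G \<and> arc_stabs v \<subseteq> M0" and g0: "g0 \<in> G" "g0 v = v"
  have vV: "v \<in> V" using v E_V by blast
  \<comment> \<open>Cutting down to elements that fix \<open>v\<close> keeps all of
    \<open>arc_stabs v\<close> and lets a coset of \<open>M\<close> remember to which vertex it
    sends \<open>v\<close>.\<close>
  define M where "M = {k \<in> M0. k v = v}"
  have MG: "k \<in> M \<Longrightarrow> k \<in> G" for k using M0 by (auto simp: M_def)
  have M_id: "id \<in> M" and M_comp: "\<And>k l. k \<in> M \<Longrightarrow> l \<in> M \<Longrightarrow> k \<circ> l \<in> M"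
    using M0 by (auto simp: M_def perm_subgroup_def)
  have M_inv: "pinv k \<in> M" if "k \<in> M" for k
    using M0 that G_inv_eq[OF MG[OF that]] by (auto simp: M_def perm_subgroup_def)
  have M_arc: "k \<in> M" if "k \<in> G" "k v = v" "(v, y) \<in> E" "k y = y" for k y
    using M0 that by (auto simp: M_def arc_stabs_def)
  define lcos where "lcos h s = (\<lambda>k. h \<circ> k) ` s" for h :: "'v \<Rightarrow> 'v" and s :: "('v \<Rightarrow> 'v) set"
  have lcos_comp: "lcos (g \<circ> h) s = lcos g (lcos h s)" for g h s
    by (simp add: lcos_def image_image comp_assoc)
  have lcos_id: "lcos id s = s" for s by (simp add: lcos_def)
  have lcos_inv: "lcos (pinv g) (lcos g s) = s" "lcos g (lcos (pinv g) s) = s" if "g \<in> G" for g s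
    using lcos_comp[of "pinv g" g s] lcos_comp[of g "pinv g" s] G_inv_comp[OF that] lcos_id by auto
  have lcos_M: "lcos k M = M" if "k \<in> M" for k
  proof
    show "lcos k M \<subseteq> M" using M_comp that by (auto simp: lcos_def)
    have "l = k \<circ> (pinv k \<circ> l)" for l using MG[OF that] by (simp add: fun_eq_iff)
    then show "M \<subseteq> lcos k M" unfolding lcos_def using M_comp[OF M_inv[OF that]] by blast
  qed
  have lcos_eq: "lcos g M = lcos h M" if "g \<in> G" "h \<in> G" "pinv g \<circ> h \<in> M" for g h
  proof -
    have "g \<circ> (pinv g \<circ> h) = h" using that by (simp add: fun_eq_iff)
    then show ?thesis using lcos_comp[of g "pinv g \<circ> h" M] lcos_M[OF that(3)] by simp
  qed
  define Orb where "Orb = {h v | h. h \<in> G}"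
  have OrbI: "h v \<in> Orb" if "h \<in> G" for h using that by (auto simp: Orb_def)
  have OG1: "g x \<in> Orb" if g: "g \<in> G" and x: "x \<in> Orb" for g x
  proof -
    obtain h where "h \<in> G" "x = h v" using x by (auto simp: Orb_def)
    then show ?thesis using OrbI[OF G_comp[OF g, of h]] by simp
  qed
  have OG: "g x \<in> Orb \<longleftrightarrow> x \<in> Orb" if "g \<in> G" for g x
    using OG1[OF that, of x] OG1[OF G_inv[OF that], of "g x"] that by auto
  have noO: False if xy: "x \<in> Orb" "y \<in> Orb" "(x, y) \<in> E" for x y
  proof -
    obtain h k where hk: "h \<in> G" "x = h v" "k \<in> G" "y = k v" using xy(1,2) unfolding Orb_def by blast
    have "(h v, h ((pinv h \<circ> k) v)) \<in> E" using xy hk by simp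
    then have "(v, (pinv h \<circ> k) v) \<in> E" using G_E_iff[OF hk(1)] by blast
    then show False using no_loop[OF G_comp[OF G_inv[OF hk(1)] hk(3)]] by blast
  qed
  \<comment> \<open>\<open>\<beta> x y\<close> is the far end of a representative, starting at
    \<open>v\<close>, of the orbit of the arc from \<open>x\<close> to \<open>y\<close>;
    \<open>\<gamma> x y\<close> carries the representative to this arc. The condition choosing
    \<open>\<beta>\<close> depends on the orbit only, so \<open>\<beta>\<close> is invariant, while
    \<open>\<gamma>\<close> is not canonical.\<close>
  define \<beta> where "\<beta> x y = (SOME y0. (v, y0) \<in> E \<and> (\<exists>g\<in>G. g v = x \<and> g y0 = y))" for x y
  define \<gamma> where "\<gamma> x y = (SOME g. g \<in> G \<and> g v = x \<and> g (\<beta> x y) = y)" for x y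
  have \<beta>: "(v, \<beta> x y) \<in> E \<and> (\<exists>g\<in>G. g v = x \<and> g (\<beta> x y) = y)" if xy: "x \<in> Orb" "(x, y) \<in> E" for x y
  proof -
    obtain h where h: "h \<in> G" "x = h v" using xy(1) unfolding Orb_def by blast
    have "(h v, h (pinv h y)) \<in> E" using h xy by simp
    then have "(v, pinv h y) \<in> E" using G_E_iff[OF h(1)] by blast
    then have "(v, pinv h y) \<in> E \<and> (\<exists>g\<in>G. g v = x \<and> g (pinv h y) = y)" using h by auto
    then show ?thesis unfolding \<beta>_def by (rule someI)
  qed
  have \<gamma>: "\<gamma> x y \<in> G" "\<gamma> x y v = x" "\<gamma> x y (\<beta> x y) = y" if xy: "x \<in> Orb" "(x, y) \<in> E" for x y
  proof -
    have "\<exists>g. g \<in> G \<and> g v = x \<and> g (\<beta> x y) = y" using \<beta>[OF xy] by blast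
    from someI_ex[OF this] show "\<gamma> x y \<in> G" "\<gamma> x y v = x" "\<gamma> x y (\<beta> x y) = y" unfolding \<gamma>_def by auto
  qed
  have \<beta>G: "\<beta> (g x) (g y) = \<beta> x y" if g: "g \<in> G" for g x y
  proof -
    have "(\<exists>k\<in>G. k v = g x \<and> k y0 = g y) \<longleftrightarrow> (\<exists>k\<in>G. k v = x \<and> k y0 = y)" for y0
    proof
      assume "\<exists>k\<in>G. k v = g x \<and> k y0 = g y"
      then obtain k where "k \<in> G" "k v = g x" "k y0 = g y" by blast
      then show "\<exists>k\<in>G. k v = x \<and> k y0 = y"
        using g by (intro bexI[of _ "pinv g \<circ> k"]) (auto simp: G_comp G_inv)
    next
      assume "\<exists>k\<in>G. k v = x \<and> k y0 = y"
      then obtain k where "k \<in> G" "k v = x" "k y0 = y" by blast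
      then show "\<exists>k\<in>G. k v = g x \<and> k y0 = g y"
        using g by (intro bexI[of _ "g \<circ> k"]) (auto simp: G_comp)
    qed
    then show ?thesis unfolding \<beta>_def by simp
  qed
  \<comment> \<open>Over a vertex \<open>x\<close> in the orbit of \<open>v\<close> the fibre
    consists of the cosets that send \<open>v\<close> to \<open>x\<close>. Over any other vertex it
    is the fixed set of cosets of \<open>M\<close> in the stabiliser of \<open>v\<close>, on which
    \<open>G\<close> does not act; \<open>\<gamma>\<close> identifies neighbouring fibres.\<close>
  define D where "D x = {lcos h M | h. h \<in> G \<and> h v = (if x \<in> Orb then x else v)}" for x
  define \<tau> where "\<tau> x y s = (if x \<in> Orb \<and> y \<notin> Orb then lcos (pinv (\<gamma> x y)) s
    else if y \<in> Orb \<and> x \<notin> Orb then lcos (\<gamma> y x) s else s)" for x y s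
  have D_lcos: "lcos g s \<in> D y" if gs: "s \<in> D x" "g \<in> G" "g (if x \<in> Orb then x else v) = (if y \<in> Orb then y else v)" for g s x y
  proof -
    obtain h where h: "s = lcos h M" "h \<in> G" "h v = (if x \<in> Orb then x else v)" using gs(1) unfolding D_def by blast
    then have "lcos g s = lcos (g \<circ> h) M" "g \<circ> h \<in> G" "(g \<circ> h) v = (if y \<in> Orb then y else v)"
      using gs(2,3) by (simp_all only: lcos_comp G_comp comp_apply)
    then show ?thesis unfolding D_def by blast
  qed
  have \<tau>: "\<tau> x y s \<in> D y \<and> \<tau> y x (\<tau> x y s) = s" if e: "(x, y) \<in> E" and s: "s \<in> D x" for x y s
  proof -
    consider "x \<in> Orb" "y \<notin> Orb" | "x \<notin> Orb" "y \<in> Orb" | "x \<notin> Orb" "y \<notin> Orb" using noO e by blast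
    then show ?thesis
    proof cases
      case 1
      have g: "\<gamma> x y \<in> G" "pinv (\<gamma> x y) x = v" using \<gamma>[OF 1(1) e] G_inv_eq by auto
      have "lcos (pinv (\<gamma> x y)) s \<in> D y" by (rule D_lcos[OF s G_inv[OF g(1)]]) (use 1 g in simp)
      then show ?thesis using 1 lcos_inv[OF g(1)] by (simp add: \<tau>_def)
    next
      case 2
      note g = \<gamma>[OF 2(2) E_sym[OF e]]
      have "lcos (\<gamma> y x) s \<in> D y" by (rule D_lcos[OF s g(1)]) (use 2 g in simp)
      then show ?thesis using 2 lcos_inv[OF g(1)] by (simp add: \<tau>_def)
    next
      case 3
      then show ?thesis using s by (simp add: \<tau>_def D_def)
    qed
  qed
  define act where "act g s z = (if z \<in> Orb then lcos g (s (pinv g z)) else s (pinv g z))" for g s and z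
  define C where "C = {s. (\<forall>x\<in>V. s x \<in> D x) \<and> (\<forall>(x, y)\<in>E. s y = \<tau> x y (s x))}"
  have "M \<in> D v" unfolding D_def using lcos_id[of M] G_id by (metis (mono_tags, lifting) id_apply mem_Collect_eq)
  then obtain s where s: "s v = M" "(\<forall>x\<in>V. s x \<in> D x) \<and> (\<forall>(x, y)\<in>E. s y = \<tau> x y (s x))"
    using section_exists[OF vV, of M D \<tau>] \<tau> by blast
  have sC: "s \<in> C" using s(2) by (simp add: C_def)
  have a: "a \<in> V" "a \<notin> Orb" using v E_V noO[of v a] OrbI[OF G_id] by auto
  \<comment> \<open>The vertex \<open>a\<close> is adjacent to \<open>v\<close>, hence off its
    orbit, where \<open>act\<close> only moves the argument. So \<open>n\<close> preserves all
    values at \<open>a\<close>, and therefore all sections.\<close>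
  obtain n where n: "n \<in> G" "n \<noteq> id" "n a = a" using stab_nontriv a by blast
  have uniq: "c y = d y" if "c \<in> C" "d \<in> C" "x \<in> V" "c x = d x" "y \<in> V" for c d x y
    using that(3,5)
  proof (induction rule: tree_induct)
    case (step x y)
    have "c y = \<tau> x y (c x)" "d y = \<tau> x y (d x)" using that(1,2) step(1) unfolding C_def by blast+
    then show ?case using step by simp
  qed (rule that)
  have act_C: "act g c \<in> C" if g: "g \<in> G" and c: "c \<in> C" for g c
  proof -
    have cD: "c x \<in> D x" if "x \<in> V" for x using c that unfolding C_def by blast
    have c\<tau>: "c y = \<tau> x y (c x)" if "(x, y) \<in> E" for x y using c that unfolding C_def by blast
    have OGi: "pinv g x \<in> Orb \<longleftrightarrow> x \<in> Orb" for x using OG[OF G_inv[OF g]] .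
    have "act g c x \<in> D x" if x: "x \<in> V" for x
    proof (cases "x \<in> Orb")
      case True
      have "lcos g (c (pinv g x)) \<in> D x"
        by (rule D_lcos[OF cD g]) (use x g G_inv OGi True in auto)
      then show ?thesis using True by (simp add: act_def)
    next
      case False
      then show ?thesis using cD[of "pinv g x"] x g G_inv OGi by (simp add: act_def D_def)
    qed
    moreover have "act g c y = \<tau> x y (act g c x)" if e: "(x, y) \<in> E" for x y
    proof -
      define x' y' where "x' = pinv g x" and "y' = pinv g y"
      have gx: "g x' = x" "g y' = y" using g by (auto simp: x'_def y'_def)
      have e': "(x', y') \<in> E" using e G_E_iff[OF g, of x' y'] gx by simp
      have x'V: "x' \<in> V" using e' E_V by blast
      have Orb': "x' \<in> Orb \<longleftrightarrow> x \<in> Orb" "y' \<in> Orb \<longleftrightarrow> y \<in> Orb" using OGi by (auto simp: x'_def y'_def)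
      consider "x \<in> Orb" "y \<notin> Orb" | "x \<notin> Orb" "y \<in> Orb" | "x \<notin> Orb" "y \<notin> Orb" using noO e by blast
      then show ?thesis
      proof cases
        case 1
        have x'Orb: "x' \<in> Orb" using 1 Orb' by blast
        note \<gamma>1 = \<gamma>[OF x'Orb e'] and \<gamma>2 = \<gamma>[OF 1(1) e]
        have \<beta>eq: "\<beta> x y = \<beta> x' y'" using \<beta>G[OF g, of x' y'] gx by simp
        obtain h where h: "c x' = lcos h M" "h \<in> G" "h v = x'"
          using cD[OF x'V] x'Orb unfolding D_def by auto
        let ?A = "pinv (\<gamma> x' y') \<circ> h" and ?B = "pinv (\<gamma> x y) \<circ> (g \<circ> h)"
        have AB: "?A \<in> G" "?B \<in> G" using h g \<gamma>1 \<gamma>2 by (auto simp: G_comp G_inv)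
        have v1: "pinv h x' = v" using h G_inv_eq by simp
        have "(h v, h (pinv h y')) \<in> E" using e' h by simp
        then have e2: "(v, pinv h y') \<in> E" using G_E_iff[OF h(2)] by blast
        have iA: "pinv ?A = pinv h \<circ> \<gamma> x' y'" using h \<gamma>1 by (simp add: G_inv_dist G_inv G_inv_inv)
        have p1: "pinv (\<gamma> x y) x = v" "pinv (\<gamma> x y) y = \<beta> x y"
          using \<gamma>2 G_inv_eq[OF \<gamma>2(1)] by simp_all
        \<comment> \<open>Transport before and after the action of \<open>g\<close> differ by an
          element that fixes \<open>v\<close> and a neighbour of \<open>v\<close>. It lies in
          \<open>arc_stabs v\<close>, hence in \<open>M\<close>; this is why transport of cosets is
          equivariant although \<open>\<gamma>\<close> is not.\<close>
        have "pinv ?A \<circ> ?B \<in> M"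
        proof (rule M_arc[OF _ _ e2])
          show "pinv ?A \<circ> ?B \<in> G" using AB G_comp G_inv by blast
          show "(pinv ?A \<circ> ?B) v = v" unfolding iA using h gx p1 \<gamma>1 v1 by simp
          show "(pinv ?A \<circ> ?B) (pinv h y') = pinv h y'" unfolding iA using h gx p1 \<gamma>1 \<beta>eq by simp
        qed
        then have "lcos ?A M = lcos ?B M" using lcos_eq AB by blast
        then have "lcos (pinv (\<gamma> x' y')) (c x') = lcos (pinv (\<gamma> x y)) (lcos g (c x'))"
          using h lcos_comp by simp
        moreover have "c y' = lcos (pinv (\<gamma> x' y')) (c x')" using c\<tau>[OF e'] 1 Orb' by (simp add: \<tau>_def)
        ultimately show ?thesis using 1 by (simp add: act_def \<tau>_def x'_def y'_def)
      next
        case 2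
        have y'Orb: "y' \<in> Orb" "x' \<notin> Orb" using 2 Orb' by auto
        note \<gamma>1 = \<gamma>[OF y'Orb(1) E_sym[OF e']] and \<gamma>2 = \<gamma>[OF 2(2) E_sym[OF e]]
        have \<beta>eq: "\<beta> y x = \<beta> y' x'" using \<beta>G[OF g, of y' x'] gx by simp
        obtain k where k: "c x' = lcos k M" "k \<in> G" "k v = v"
          using cD[OF x'V] y'Orb unfolding D_def by auto
        let ?A = "g \<circ> \<gamma> y' x' \<circ> k" and ?B = "\<gamma> y x \<circ> k"
        have AB: "?A \<in> G" "?B \<in> G" using k g \<gamma>1 \<gamma>2 by (auto simp: G_comp)
        have v1: "pinv k v = v" using k G_inv_eq by simp
        have "(k v, k (pinv k (\<beta> y x))) \<in> E" using k \<beta>[OF 2(2) E_sym[OF e]] by simp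
        then have e2: "(v, pinv k (\<beta> y x)) \<in> E" using G_E_iff[OF k(2)] by blast
        have iA: "pinv ?A = pinv k \<circ> pinv (\<gamma> y' x') \<circ> pinv g"
          using k \<gamma>1 g by (simp add: G_inv_dist G_comp comp_assoc)
        have p1: "pinv (\<gamma> y' x') y' = v" "pinv (\<gamma> y' x') x' = \<beta> y' x'"
          using \<gamma>1 G_inv_eq[OF \<gamma>1(1)] by simp_all
        have "pinv ?A \<circ> ?B \<in> M"
        proof (rule M_arc[OF _ _ e2])
          show "pinv ?A \<circ> ?B \<in> G" using AB G_comp G_inv by blast
          show "(pinv ?A \<circ> ?B) v = v"
            unfolding iA using k p1 \<gamma>2 v1 by (simp add: x'_def[symmetric] y'_def[symmetric])
          show "(pinv ?A \<circ> ?B) (pinv k (\<beta> y x)) = pinv k (\<beta> y x)"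
            unfolding iA using k p1 \<gamma>2 \<beta>eq by (simp add: x'_def[symmetric] y'_def[symmetric])
        qed
        then have "lcos ?A M = lcos ?B M" using lcos_eq AB by blast
        then have "lcos g (lcos (\<gamma> y' x') (c x')) = lcos (\<gamma> y x) (c x')"
          using k lcos_comp by simp
        moreover have "c y' = lcos (\<gamma> y' x') (c x')" using c\<tau>[OF e'] 2 Orb' by (simp add: \<tau>_def)
        ultimately show ?thesis using 2 by (simp add: act_def \<tau>_def x'_def y'_def)
      next
        case 3
        then show ?thesis using c\<tau>[OF e'] Orb' by (simp add: act_def \<tau>_def x'_def y'_def)
      qed
    qed
    ultimately show ?thesis unfolding C_def by blast
  qed
  have "act g0 s v = s v"
  proof (rule simple_acts_trivially[where act = act and C = C and n = n, OF simple])
    show "act (g \<circ> h) c = act g (act h c)" if "g \<in> G" "h \<in> G" for g h c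
    proof
      fix z
      have "pinv g z \<in> Orb \<longleftrightarrow> z \<in> Orb" using OG[OF G_inv[OF that(1)]] .
      then show "act (g \<circ> h) c z = act g (act h c) z"
        using that by (simp add: act_def G_inv_dist lcos_comp)
    qed
    show "act id c = c" for c by (simp add: act_def lcos_id fun_eq_iff inv_id)
    show "act g c x = act g d x" if "g \<in> G" "\<And>x. x \<in> V \<Longrightarrow> c x = d x" "x \<in> V" for g c d x
      using that by (simp add: act_def G_inv)
    have "pinv n a = a" using n G_inv_eq by simp
    then have na: "act n c a = c a" for c using a by (simp add: act_def)
    show "act n c x = c x" if "c \<in> C" "x \<in> V" for c x
      by (rule uniq[OF act_C[OF n(1) that(1)] that(1) a(1) na that(2)])
  qed (use act_C n g0 sC vV in auto)
  moreover have "v \<in> Orb" using OrbI[OF G_id] by simp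
  moreover have "pinv g0 v = v" using g0 G_inv_eq by simp
  ultimately have "lcos g0 M = M" using s by (simp add: act_def)
  then have "g0 \<circ> id \<in> M" using M_id unfolding lcos_def by blast
  then show "g0 \<in> M0" by (simp add: M_def)
qed

end

section \<open>Generation by vertex stabilisers over a quotient tree\<close>

context tree_action
begin

text \<open>The quotient of the geodesic from \<open>x\<close> to \<open>g x\<close> is a closed walk in a tree; it backtracks at a
  vertex at maximal distance from its origin, where an element of the vertex stabiliser shortens
  the geodesic.\<close>

lemma generated_by_vertex_stabs:
  fixes cls :: "'v \<Rightarrow> 'w"
  assumes Q: "tree_rel VQ EQ" and cls: "\<And>x y. (x, y) \<in> E \<Longrightarrow> (cls x, cls y) \<in> EQ"
    and cls_G: "\<And>g x. g \<in> G \<Longrightarrow> cls (g x) = cls x"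
    and no_mult: "\<And>x y y'. (x, y) \<in> E \<Longrightarrow> (x, y') \<in> E \<Longrightarrow> cls y = cls y' \<Longrightarrow> \<exists>h\<in>G. h x = x \<and> h y = y'"
    and M: "perm_subgroup M" "M \<subseteq> G" "\<And>g x. g \<in> G \<Longrightarrow> x \<in> V \<Longrightarrow> g x = x \<Longrightarrow> g \<in> M"
    and ne: "V \<noteq> {}"
  shows "G \<subseteq> M"
proof -
  interpret Q: tree_rel VQ EQ by (rule Q)
  obtain x where x: "x \<in> V" using ne by blast
  have "g \<in> M" if "g \<in> G" for g
    using that
  proof (induction "dist x (g x)" arbitrary: g rule: less_induct)
    case less
    define n where "n = dist x (g x)"
    have gx: "g x \<in> V" using less x by simp
    show ?case
    proof (cases "n = 0")
      case True
      then have "g x = x" using dist_0_iff[OF x gx] by (simp add: n_def)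
      then show ?thesis using M(3) less x by blast
    next
      case False
      obtain q where q: "q 0 = x" "q n = g x" "\<And>i. i < n \<Longrightarrow> (q i, q (Suc i)) \<in> E"
        "\<And>i. i \<le> n \<Longrightarrow> dist x (q i) = i"
        using geodesic_path[OF x gx] unfolding n_def by blast
      have qV: "q i \<in> V" if "i \<le> n" for i
        using that q gx E_V by (cases "i < n") (auto simp: le_less)
      define d where "d i = Q.dist (cls x) (cls (q i))" for i
      have cQ: "(cls (q i), cls (q (Suc i))) \<in> EQ" if "i < n" for i using cls q that by blast
      have clsx: "cls x \<in> VQ" using cQ[of 0] False Q.E_V q by auto
      have fin: "finite (d ` {..n})" "d ` {..n} \<noteq> {}" by auto
      obtain i where i: "i \<le> n" "d i = Max (d ` {..n})" using Max_in[OF fin] by (metis atMost_iff imageE)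
      have max: "d j \<le> d i" if "j \<le> n" for j unfolding i(2) using that fin by (intro Max_ge) auto
      have d0: "d 0 = 0" "d n = 0" using q cls_G less.prems by (auto simp: d_def)
      have "d 1 = 1" using Q.dist_edge[OF cQ[of 0]] False q by (simp add: d_def)
      then have "d i \<noteq> 0" using max[of 1] False by simp
      \<comment> \<open>\<open>d\<close> vanishes at both ends, because \<open>x\<close> and
        \<open>g x\<close> have the same class, whereas \<open>d 1 = 1\<close>; so the maximum is
        attained in the interior.\<close>
      then have i0: "i \<noteq> 0" "i \<noteq> n" using d0 by metis+
      then obtain j where j: "i = Suc j" "Suc j < n" using i(1) by (cases i) auto
      have e: "(q i, q j) \<in> E" "(q i, q (Suc i)) \<in> E" using q(3)[of j] q(3)[of i] E_sym j by auto
      have "cls (q j) = cls (q (Suc i))"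
      proof (rule Q.unique_parent[OF clsx])
        show "(cls (q i), cls (q j)) \<in> EQ" "(cls (q i), cls (q (Suc i))) \<in> EQ" using cls e by auto
        show "Q.dist (cls x) (cls (q j)) \<le> Q.dist (cls x) (cls (q i))" using max[of j] j by (simp add: d_def)
        show "Q.dist (cls x) (cls (q (Suc i))) \<le> Q.dist (cls x) (cls (q i))" using max[of "Suc i"] j by (simp add: d_def)
      qed
      \<comment> \<open>\<open>h\<close> folds the rest of the geodesic back onto
        \<open>q j\<close>. Then \<open>h (g x)\<close> is reached from \<open>x\<close> in
        \<open>j + (n - Suc i)\<close> steps, two fewer than \<open>n\<close>.\<close>
      then obtain h where h: "h \<in> G" "h (q i) = q i" "h (q (Suc i)) = q j" using no_mult[OF e(2,1)] by auto
      have "dist (q (Suc i)) (q (Suc i + (n - Suc i))) \<le> n - Suc i"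
        by (rule walk_dist) (use q qV j in auto)
      moreover have "Suc i + (n - Suc i) = n" using j by simp
      ultimately have "dist (q (Suc i)) (g x) \<le> n - Suc i" using q(2) by simp
      then have "dist (q j) (h (g x)) \<le> n - Suc i" using G_dist[OF h(1), of "q (Suc i)" "g x"] h by simp
      moreover have "dist x (h (g x)) \<le> dist x (q j) + dist (q j) (h (g x))"
        by (rule dist_tri) (use x qV j h gx in auto)
      moreover have "dist x (q j) = j" using q j by simp
      ultimately have "dist x ((h \<circ> g) x) < dist x (g x)" using j n_def by simp
      then have "h \<circ> g \<in> M" using less h G_comp by blast
      moreover have "h \<in> M" using M(3)[OF h(1) qV[OF i(1)] h(2)] .
      moreover have "g = pinv h \<circ> (h \<circ> g)" using h by (simp add: fun_eq_iff)
      ultimately show ?thesis using M(1) unfolding perm_subgroup_def by metis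
    qed
  qed
  then show ?thesis by blast
qed

end

section \<open>Permutation groups and automorphisms of trees\<close>

text \<open>Elements of \<open>Bij V\<close> are undefined off \<open>V\<close>; extended by the
  identity instead, they compose and invert as plain functions.\<close>

definition tot :: "'v set \<Rightarrow> ('v \<Rightarrow> 'v) \<Rightarrow> 'v \<Rightarrow> 'v"
  where "tot V g = (\<lambda>x. if x \<in> V then g x else x)"

lemma tot_in [simp]: "x \<in> V \<Longrightarrow> tot V g x = g x"
  and tot_out [simp]: "x \<notin> V \<Longrightarrow> tot V g x = x"
  by (auto simp: tot_def)

lemma tot_restrict [simp]: "tot V (restrict g V) = tot V g"
  by (auto simp: tot_def)

lemma restrict_tot: "g \<in> extensional V \<Longrightarrow> restrict (tot V g) V = g"
  by (auto simp: extensional_def fun_eq_iff)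

lemma tot_bij: assumes "bij_betw g V V" shows "bij (tot V g)"
proof -
  have "bij_betw (tot V g) V V" using assms by (simp cong: bij_betw_cong)
  moreover have "bij_betw (tot V g) (- V) (- V)" by (auto simp: bij_betw_def inj_on_def tot_def)
  ultimately have "bij_betw (tot V g) (V \<union> - V) (V \<union> - V)" by (rule bij_betw_combine) auto
  then show ?thesis by simp
qed

lemma tot_comp: "h ` V \<subseteq> V \<Longrightarrow> tot V (compose V g h) = tot V g \<circ> tot V h"
  by (auto simp: tot_def compose_def fun_eq_iff)

lemma tot_inj: "g \<in> extensional V \<Longrightarrow> h \<in> extensional V \<Longrightarrow> tot V g = tot V h \<Longrightarrow> g = h"
  by (metis restrict_tot)

lemma BijD: assumes "g \<in> Bij V"
  shows "g \<in> extensional V" "g ` V = V" "inj_on g V" "bij_betw g V V" "x \<in> V \<Longrightarrow> g x \<in> V"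
  using assms by (auto simp: Bij_def bij_betw_def)

lemma BijGroup_mult: "g \<in> Bij V \<Longrightarrow> h \<in> Bij V \<Longrightarrow> g \<otimes>\<^bsub>BijGroup V\<^esub> h = compose V g h"
  by (simp add: BijGroup_def)

lemma BijGroup_one: "\<one>\<^bsub>BijGroup V\<^esub> = (\<lambda>x\<in>V. x)"
  by (simp add: BijGroup_def)

lemma BijGroup_inv: assumes "g \<in> Bij V"
  shows "inv\<^bsub>BijGroup V\<^esub> g \<in> Bij V" "tot V (inv\<^bsub>BijGroup V\<^esub> g) = pinv (tot V g)"
proof -
  interpret group "BijGroup V" by (rule group_BijGroup)
  have g: "g \<in> carrier (BijGroup V)" using assms by (simp add: BijGroup_def)
  then show i: "inv\<^bsub>BijGroup V\<^esub> g \<in> Bij V" using inv_closed[OF g] by (simp add: BijGroup_def)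
  have "compose V g (inv\<^bsub>BijGroup V\<^esub> g) = (\<lambda>x\<in>V. x)"
    using r_inv[OF g] BijGroup_mult[OF assms i] BijGroup_one by simp
  then have "tot V g \<circ> tot V (inv\<^bsub>BijGroup V\<^esub> g) = tot V (\<lambda>x\<in>V. x)"
    using tot_comp[of "inv\<^bsub>BijGroup V\<^esub> g" V g] BijD(2)[OF i] by simp
  then have "tot V g \<circ> tot V (inv\<^bsub>BijGroup V\<^esub> g) = id" by (simp add: tot_def fun_eq_iff)
  then show "tot V (inv\<^bsub>BijGroup V\<^esub> g) = pinv (tot V g)"
    using tot_bij[OF BijD(4)[OF assms]] by (metis bij_is_inj inv_o_cancel fun.map_comp id_o o_id)
qed

lemma subgroup_BijGroup_iff:
  "subgroup G (BijGroup V) \<longleftrightarrow> G \<subseteq> Bij V \<and> perm_subgroup (tot V ` G)"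
proof
  assume "subgroup G (BijGroup V)"
  then interpret subgroup G "BijGroup V" .
  have sub: "G \<subseteq> Bij V" using subset by (simp add: BijGroup_def)
  moreover have "perm_subgroup (tot V ` G)" unfolding perm_subgroup_def
  proof (intro conjI ballI; (elim imageE)?)
    have "tot V (\<lambda>x\<in>V. x) = id" by (auto simp: tot_def)
    then show "id \<in> tot V ` G" using one_closed by (metis BijGroup_one imageI)
  next
    fix a b g h assume "a = tot V g" "b = tot V h" "g \<in> G" "h \<in> G"
    then show "a \<circ> b \<in> tot V ` G"
      using m_closed[of g h] BijGroup_mult[of g V h] tot_comp[of h V g] BijD(2)[of h V] sub
      by (metis image_eqI order_refl subsetD)
  next
    fix a g assume "a = tot V g" "g \<in> G"
    then show "pinv a \<in> tot V ` G" using BijGroup_inv(2)[of g V] m_inv_closed[of g] sub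
      by (metis imageI subsetD)
  qed
  ultimately show "G \<subseteq> Bij V \<and> perm_subgroup (tot V ` G)" by blast
next
  assume G: "G \<subseteq> Bij V \<and> perm_subgroup (tot V ` G)"
  have mem: "k \<in> G" if k: "k \<in> Bij V" "tot V k \<in> tot V ` G" for k
  proof -
    obtain g where "g \<in> G" "tot V k = tot V g" using k(2) by blast
    then show ?thesis using tot_inj[of k V g] BijD(1) k(1) G by blast
  qed
  show "subgroup G (BijGroup V)"
  proof
    show "G \<subseteq> carrier (BijGroup V)" using G by (simp add: BijGroup_def)
    show "g \<otimes>\<^bsub>BijGroup V\<^esub> h \<in> G" if gh: "g \<in> G" "h \<in> G" for g h
    proof (rule mem)
      have B: "g \<in> Bij V" "h \<in> Bij V" using G gh by auto
      show "g \<otimes>\<^bsub>BijGroup V\<^esub> h \<in> Bij V" using compose_Bij[OF B] BijGroup_mult[OF B] by simp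
      show "tot V (g \<otimes>\<^bsub>BijGroup V\<^esub> h) \<in> tot V ` G"
        using tot_comp[of h V g] BijD(2)[OF B(2)] BijGroup_mult[OF B] G gh unfolding perm_subgroup_def by simp
    qed
    show "\<one>\<^bsub>BijGroup V\<^esub> \<in> G"
    proof (rule mem)
      have "tot V (\<lambda>x\<in>V. x) = id" by (auto simp: tot_def)
      then show "tot V \<one>\<^bsub>BijGroup V\<^esub> \<in> tot V ` G" using G unfolding perm_subgroup_def BijGroup_one by simp
    qed (simp add: BijGroup_one id_Bij)
    show "inv\<^bsub>BijGroup V\<^esub> g \<in> G" if "g \<in> G" for g
      by (rule mem) (use BijGroup_inv[of g V] that G in \<open>auto simp: perm_subgroup_def\<close>)
  qed
qed

section \<open>The permutation topology as agreement on finite sets\<close>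

lemma coset_fixator:
  assumes "h \<in> Bij X" "F \<subseteq> X"
  shows "h <#\<^bsub>BijGroup X\<^esub> fixator (Bij X) F = {g \<in> Bij X. \<forall>x\<in>F. g x = h x}"
proof (intro equalityI subsetI)
  fix g assume "g \<in> h <#\<^bsub>BijGroup X\<^esub> fixator (Bij X) F"
  then obtain k where k: "k \<in> Bij X" "\<forall>x\<in>F. k x = x" "g = compose X h k"
    unfolding l_coset_def fixator_def using BijGroup_mult[OF assms(1)] by auto
  then show "g \<in> {g \<in> Bij X. \<forall>x\<in>F. g x = h x}"
    using compose_Bij[OF assms(1) k(1)] assms by (auto simp: compose_def subset_iff)
next
  fix g assume g: "g \<in> {g \<in> Bij X. \<forall>x\<in>F. g x = h x}"
  interpret group "BijGroup X" by (rule group_BijGroup)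
  have c: "carrier (BijGroup X) = Bij X" by (simp add: BijGroup_def)
  define k where "k = inv\<^bsub>BijGroup X\<^esub> h \<otimes>\<^bsub>BijGroup X\<^esub> g"
  have i: "inv\<^bsub>BijGroup X\<^esub> h \<in> Bij X" using BijGroup_inv assms by blast
  have "h \<in> carrier (BijGroup X)" "g \<in> carrier (BijGroup X)" using assms g c by auto
  then have hk: "h \<otimes>\<^bsub>BijGroup X\<^esub> k = g" unfolding k_def by (simp add: m_assoc[symmetric])
  have kB: "k \<in> Bij X" unfolding k_def using m_closed[of "inv\<^bsub>BijGroup X\<^esub> h" g] i g c by simp
  have "k x = x" if "x \<in> F" for x
  proof -
    have xX: "x \<in> X" using that assms by blast
    have "h (k x) = g x" using fun_cong[OF hk, of x] BijGroup_mult[OF assms(1) kB] xX by (simp add: compose_def)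
    then have "h (k x) = h x" using g that by simp
    then show ?thesis using BijD(3)[OF assms(1)] BijD(5)[OF kB xX] xX by (simp add: inj_on_eq_iff)
  qed
  then show "g \<in> h <#\<^bsub>BijGroup X\<^esub> fixator (Bij X) F"
    unfolding l_coset_def fixator_def using hk kB by blast
qed

lemma openin_perm_topology_iff:
  "openin (perm_topology X) U \<longleftrightarrow> U \<subseteq> Bij X \<and>
    (\<forall>g\<in>U. \<exists>F. finite F \<and> F \<subseteq> X \<and> {k \<in> Bij X. \<forall>x\<in>F. k x = g x} \<subseteq> U)"
proof (cases "U \<subseteq> Bij X")
  case True
  have "finite F \<and> F \<subseteq> X \<and> g <#\<^bsub>BijGroup X\<^esub> fixator (Bij X) F \<subseteq> U \<longleftrightarrow>
      finite F \<and> F \<subseteq> X \<and> {k \<in> Bij X. \<forall>x\<in>F. k x = g x} \<subseteq> U" if "g \<in> U" for g F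
    using coset_fixator[OF subsetD[OF True that], of F] by (cases "F \<subseteq> X") simp_all
  then show ?thesis unfolding openin_perm_topology by simp
qed (simp add: openin_perm_topology)

lemma in_perm_closure_iff:
  assumes "A \<subseteq> Bij X"
  shows "s \<in> perm_topology X closure_of A \<longleftrightarrow>
    s \<in> Bij X \<and> (\<forall>F. finite F \<and> F \<subseteq> X \<longrightarrow> (\<exists>a\<in>A. \<forall>x\<in>F. a x = s x))"
proof
  assume s: "s \<in> perm_topology X closure_of A"
  then have sB: "s \<in> Bij X" by (simp add: in_closure_of)
  moreover have "\<exists>a\<in>A. \<forall>x\<in>F. a x = s x" if F: "finite F" "F \<subseteq> X" for F
  proof -
    let ?U = "{k \<in> Bij X. \<forall>x\<in>F. k x = s x}"
    have "openin (perm_topology X) ?U" unfolding openin_perm_topology_iff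
    proof (intro conjI ballI)
      fix g assume "g \<in> ?U"
      then have "{k \<in> Bij X. \<forall>x\<in>F. k x = g x} \<subseteq> ?U" by simp
      then show "\<exists>F. finite F \<and> F \<subseteq> X \<and> {k \<in> Bij X. \<forall>x\<in>F. k x = g x} \<subseteq> ?U" using F by blast
    qed auto
    moreover have "s \<in> ?U" using sB by simp
    ultimately obtain a where "a \<in> A" "a \<in> ?U" using s unfolding in_closure_of by meson
    then show ?thesis by blast
  qed
  ultimately show "s \<in> Bij X \<and> (\<forall>F. finite F \<and> F \<subseteq> X \<longrightarrow> (\<exists>a\<in>A. \<forall>x\<in>F. a x = s x))" by blast
next
  assume s: "s \<in> Bij X \<and> (\<forall>F. finite F \<and> F \<subseteq> X \<longrightarrow> (\<exists>a\<in>A. \<forall>x\<in>F. a x = s x))"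
  show "s \<in> perm_topology X closure_of A" unfolding in_closure_of topspace_perm_topology
  proof (intro conjI allI impI)
    fix U assume U: "s \<in> U \<and> openin (perm_topology X) U"
    then obtain F where F: "finite F" "F \<subseteq> X" "{k \<in> Bij X. \<forall>x\<in>F. k x = s x} \<subseteq> U"
      unfolding openin_perm_topology_iff by blast
    then obtain a where "a \<in> A" "\<forall>x\<in>F. a x = s x" using s by blast
    then show "\<exists>y. y \<in> A \<and> y \<in> U" using F assms by blast
  qed (use s in blast)
qed

lemma closedin_aut_limit:
  assumes "closedin (aut_topology T) G" "h \<in> aut T"
    and "\<And>F. finite F \<Longrightarrow> F \<subseteq> verts T \<Longrightarrow> \<exists>g\<in>G. \<forall>x\<in>F. g x = h x"
  shows "h \<in> G"
proof (rule ccontr)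
  assume hG: "h \<notin> G"
  have top: "topspace (aut_topology T) = aut T"
    by (auto simp: aut_topology_def aut_def)
  have "openin (aut_topology T) (aut T - G)" "G \<subseteq> aut T"
    using assms(1) unfolding closedin_def top by auto
  then obtain U where U: "openin (perm_topology (verts T)) U" "aut T - G = U \<inter> aut T"
    unfolding aut_topology_def openin_subtopology by blast
  have "h \<in> U" using U assms(2) hG by blast
  then obtain F where F: "finite F" "F \<subseteq> verts T" "{k \<in> Bij (verts T). \<forall>x\<in>F. k x = h x} \<subseteq> U"
    using U(1) unfolding openin_perm_topology_iff by blast
  obtain g where g: "g \<in> G" "\<forall>x\<in>F. g x = h x" using assms(3)[OF F(1,2)] by blast
  have "g \<in> aut T" using g \<open>G \<subseteq> aut T\<close> by blast
  then have "g \<in> U" using F g by (auto simp: aut_def)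
  then show False using U g \<open>g \<in> aut T\<close> by blast
qed

section \<open>Trees as relations, automorphisms as adjacency-preserving bijections\<close>

lemma is_treeD: assumes "is_tree T"
  shows "is_graph T" "verts T \<noteq> {}" "connected_graph T" "\<not> has_loop T" "\<not> has_multiple_edge T" "\<not> has_cycle T"
  using assms by (auto simp: is_tree_def)

lemma graphD: assumes "is_graph T" "a \<in> arcs T"
  shows "orig T a \<in> verts T" "arev T a \<in> arcs T" "arev T (arev T a) = a" "terminus T a \<in> verts T"
    "orig T (arev T a) = terminus T a" "terminus T (arev T a) = orig T a" "(orig T a, terminus T a) \<in> adj T"
  using assms unfolding is_graph_def terminus_def adj_def by (auto simp: Pi_iff)

lemma tree_rel_adj: assumes "is_tree T" shows "tree_rel (verts T) (adj T)"
proof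
  note D = is_treeD[OF assms]
  show "adj T \<subseteq> verts T \<times> verts T" using graphD[OF D(1)] by (auto simp: adj_def)
  show "(y, x) \<in> adj T" if xy: "(x, y) \<in> adj T" for x y
  proof -
    obtain a where a: "a \<in> arcs T" "x = orig T a" "y = terminus T a" using xy unfolding adj_def by blast
    then show ?thesis using graphD[OF D(1) graphD(2)[OF D(1) a(1)]] graphD[OF D(1) a(1)] by simp
  qed
  show "(x, x) \<notin> adj T" for x using D(4) unfolding has_loop_def adj_def by auto
  show "(x, y) \<in> (adj T)\<^sup>*" if "x \<in> verts T" "y \<in> verts T" for x y
    using D(3) that unfolding connected_graph_def by blast
  show "\<exists>i<length vs. (vs ! i, vs ! (Suc i mod length vs)) \<notin> adj T" if "3 \<le> length vs" "distinct vs" for vs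
    using D(6) that unfolding has_cycle_def by blast
qed

lemma tree_arc_unique:
  assumes "is_tree T" "a \<in> arcs T" "b \<in> arcs T" "orig T a = orig T b" "terminus T a = terminus T b"
  shows "a = b"
  using is_treeD(5)[OF assms(1)] assms unfolding has_multiple_edge_def by blast

lemma arc_mapI:
  assumes T: "is_tree T" and a: "a \<in> arcs T" and b: "b \<in> arcs T" "orig T b = g (orig T a)" "terminus T b = g (terminus T a)"
  shows "arc_map T g a = b"
  unfolding arc_map_def using a b tree_arc_unique[OF T] by (auto intro!: the_equality)

lemma arc_map_props:
  assumes T: "is_tree T" and a: "a \<in> arcs T" and g: "(g (orig T a), g (terminus T a)) \<in> adj T"
  shows "arc_map T g a \<in> arcs T" "orig T (arc_map T g a) = g (orig T a)" "terminus T (arc_map T g a) = g (terminus T a)"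
proof -
  obtain b where b: "b \<in> arcs T" "g (orig T a) = orig T b" "g (terminus T a) = terminus T b"
    using g unfolding adj_def by blast
  then show "arc_map T g a \<in> arcs T" "orig T (arc_map T g a) = g (orig T a)" "terminus T (arc_map T g a) = g (terminus T a)"
    using arc_mapI[OF T a b(1)] by auto
qed

text \<open>In a tree \<open>arc_map T g\<close> is the only possible action on arcs, and it
  commutes with reversal because an arc is determined by its ends.\<close>

lemma aut_iff:
  assumes T: "is_tree T"
  shows "g \<in> aut T \<longleftrightarrow> g \<in> Bij (verts T) \<and> (\<forall>x\<in>verts T. \<forall>y\<in>verts T. (g x, g y) \<in> adj T \<longleftrightarrow> (x, y) \<in> adj T)"
proof
  note G = graphD[OF is_treeD(1)[OF T]]
  assume "g \<in> aut T"
  then obtain \<alpha> where g: "g \<in> Bij (verts T)" and \<alpha>: "\<alpha> \<in> Bij (arcs T)"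
    "\<And>a. a \<in> arcs T \<Longrightarrow> orig T (\<alpha> a) = g (orig T a) \<and> \<alpha> (arev T a) = arev T (\<alpha> a)"
    unfolding aut_def by blast
  have t: "terminus T (\<alpha> a) = g (terminus T a)" if "a \<in> arcs T" for a
    using \<alpha>(2)[OF that] \<alpha>(2)[OF G(2)[OF that]] by (simp add: terminus_def)
  have "(g x, g y) \<in> adj T \<longleftrightarrow> (x, y) \<in> adj T" if xy: "x \<in> verts T" "y \<in> verts T" for x y
  proof
    assume "(x, y) \<in> adj T"
    then obtain a where "a \<in> arcs T" "x = orig T a" "y = terminus T a" unfolding adj_def by blast
    then show "(g x, g y) \<in> adj T" using \<alpha> t BijD(5)[OF \<alpha>(1)] unfolding adj_def by force
  next
    assume "(g x, g y) \<in> adj T"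
    then obtain b where b: "b \<in> arcs T" "g x = orig T b" "g y = terminus T b" unfolding adj_def by blast
    then obtain a where a: "a \<in> arcs T" "b = \<alpha> a" using BijD(2)[OF \<alpha>(1)] by blast
    have "g x = g (orig T a)" "g y = g (terminus T a)" using a b \<alpha>(2) t by auto
    then have "x = orig T a" "y = terminus T a" using BijD(3)[OF g] xy G(1,4)[OF a(1)] by (auto simp: inj_on_eq_iff)
    then show "(x, y) \<in> adj T" using a unfolding adj_def by blast
  qed
  then show "g \<in> Bij (verts T) \<and> (\<forall>x\<in>verts T. \<forall>y\<in>verts T. (g x, g y) \<in> adj T \<longleftrightarrow> (x, y) \<in> adj T)" using g by blast
next
  note G = graphD[OF is_treeD(1)[OF T]]
  assume g: "g \<in> Bij (verts T) \<and> (\<forall>x\<in>verts T. \<forall>y\<in>verts T. (g x, g y) \<in> adj T \<longleftrightarrow> (x, y) \<in> adj T)"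
  then have gE: "(g (orig T a), g (terminus T a)) \<in> adj T" if "a \<in> arcs T" for a using G[OF that] by blast
  note P = arc_map_props[OF T _ gE]
  have "inj_on (arc_map T g) (arcs T)"
  proof (rule inj_onI)
    fix a b assume ab: "a \<in> arcs T" "b \<in> arcs T" "arc_map T g a = arc_map T g b"
    then have "g (orig T a) = g (orig T b)" "g (terminus T a) = g (terminus T b)" using P by metis+
    then show "a = b" using tree_arc_unique[OF T ab(1,2)] g BijD(3)[of g "verts T"] G ab by (auto simp: inj_on_eq_iff)
  qed
  moreover have "arc_map T g ` arcs T = arcs T"
  proof (intro equalityI subsetI)
    fix b assume b: "b \<in> arcs T"
    obtain x y where xy: "x \<in> verts T" "y \<in> verts T" "g x = orig T b" "g y = terminus T b"
      using BijD(2)[of g "verts T"] g G(1,4)[OF b] by (metis imageE)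
    then have "(g x, g y) \<in> adj T" using G(7)[OF b] by simp
    then have "(x, y) \<in> adj T" using g xy by blast
    then obtain a where a: "a \<in> arcs T" "x = orig T a" "y = terminus T a" unfolding adj_def by blast
    then have "arc_map T g a = b" using arc_mapI[OF T a(1) b] xy by simp
    then show "b \<in> arc_map T g ` arcs T" using a by blast
  qed (use P in auto)
  ultimately have "arc_map T g \<in> Bij (arcs T)" by (auto simp: Bij_def bij_betw_def arc_map_def)
  moreover have "arc_map T g (arev T a) = arev T (arc_map T g a)" if a: "a \<in> arcs T" for a
    by (rule arc_mapI[OF T G(2)[OF a] G(2)[OF P(1)[OF a a]]]) (use P[OF a a] G[OF a] G[OF P(1)[OF a a]] in auto)
  ultimately show "g \<in> aut T" unfolding aut_def using g P by blast
qed

lemma subgroup_aut_BijGroup: assumes T: "is_tree T" shows "subgroup (aut T) (BijGroup (verts T))"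
proof -
  interpret group "BijGroup (verts T)" by (rule group_BijGroup)
  have c: "carrier (BijGroup (verts T)) = Bij (verts T)" by (simp add: BijGroup_def)
  show ?thesis
  proof (rule subgroupI)
    show "aut T \<subseteq> carrier (BijGroup (verts T))" unfolding c by (auto simp: aut_def)
    have "(\<lambda>x\<in>verts T. x) \<in> aut T" unfolding aut_iff[OF T] using id_Bij by auto
    then show "aut T \<noteq> {}" by blast
    show "inv\<^bsub>BijGroup (verts T)\<^esub> g \<in> aut T" if g: "g \<in> aut T" for g
    proof -
      have gB: "g \<in> Bij (verts T)" and gE: "\<And>x y. x \<in> verts T \<Longrightarrow> y \<in> verts T \<Longrightarrow> (g x, g y) \<in> adj T \<longleftrightarrow> (x, y) \<in> adj T"
        using g unfolding aut_iff[OF T] by auto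
      note i = BijGroup_inv[OF gB]
      have gi: "g ((inv\<^bsub>BijGroup (verts T)\<^esub> g) x) = x" if "x \<in> verts T" for x
      proof -
        have "pinv (tot (verts T) g) x = (inv\<^bsub>BijGroup (verts T)\<^esub> g) x" using i(2) that by (metis tot_in)
        moreover have "tot (verts T) g (pinv (tot (verts T) g) x) = x"
          using tot_bij[OF BijD(4)[OF gB]] by (simp add: bij_is_surj surj_f_inv_f)
        ultimately show ?thesis using BijD(5)[OF i(1) that] by simp
      qed
      show ?thesis unfolding aut_iff[OF T] using i(1) gE gi BijD(5)[OF i(1)] by metis
    qed
    show "g \<otimes>\<^bsub>BijGroup (verts T)\<^esub> h \<in> aut T" if "g \<in> aut T" "h \<in> aut T" for g h
    proof -
      have B: "g \<in> Bij (verts T)" "h \<in> Bij (verts T)" using that by (auto simp: aut_def)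
      have "compose (verts T) g h \<in> aut T"
        using that BijD(5)[OF B(2)] compose_Bij[OF B] unfolding aut_iff[OF T] by (simp add: compose_eq)
      then show ?thesis by (simp add: BijGroup_mult[OF B])
    qed
  qed
qed

lemma subgroup_aut_group_iff: assumes T: "is_tree T"
  shows "subgroup G (aut_group T) \<longleftrightarrow> G \<subseteq> aut T \<and> subgroup G (BijGroup (verts T))"
proof -
  interpret group "BijGroup (verts T)" by (rule group_BijGroup)
  note A = subgroup_aut_BijGroup[OF T]
  show ?thesis unfolding aut_group_def perm_group_def
    using incl_subgroup[OF A, of G] subgroup_incl[of G "aut T"] A
      subgroup.subset[of G "BijGroup (verts T)\<lparr>carrier := aut T\<rparr>"] by auto
qed

section \<open>The quotient graph\<close>

locale tree_group =
  fixes T :: "('v, 'a) graph" and G :: "('v \<Rightarrow> 'v) set"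
  assumes T: "is_tree T" and subgroup_G: "subgroup G (aut_group T)"
begin

definition Gh :: "('v \<Rightarrow> 'v) set" where "Gh = tot (verts T) ` G"

lemma G_aut: "g \<in> G \<Longrightarrow> g \<in> aut T"
  using subgroup_G unfolding subgroup_aut_group_iff[OF T] by blast

lemma G_Bij: "g \<in> G \<Longrightarrow> g \<in> Bij (verts T)"
  using G_aut unfolding aut_def by blast

lemma subgroup_G_BijGroup: "subgroup G (BijGroup (verts T))"
  using subgroup_G unfolding subgroup_aut_group_iff[OF T] by blast

end

sublocale tree_group \<subseteq> tree_action "verts T" "adj T" Gh
proof (intro tree_action.intro tree_rel_adj[OF T] tree_action_axioms.intro)
  show "perm_subgroup Gh" using subgroup_G_BijGroup unfolding subgroup_BijGroup_iff Gh_def by blast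
  show "bij g" if "g \<in> Gh" for g using that tot_bij BijD(4) G_Bij unfolding Gh_def by blast
  show "g x = x" if "g \<in> Gh" "x \<notin> verts T" for g x using that unfolding Gh_def by auto
  show "(g x, g y) \<in> adj T" if g: "g \<in> Gh" and e: "(x, y) \<in> adj T" for g x y
  proof -
    obtain k where k: "k \<in> G" "g = tot (verts T) k" using g unfolding Gh_def by blast
    have "x \<in> verts T" "y \<in> verts T" using e tree_rel.E_V[OF tree_rel_adj[OF T]] by blast+
    then show ?thesis using G_aut[OF k(1)] e k(2) unfolding aut_iff[OF T] by simp
  qed
qed

section \<open>Orbits of vertices and arcs\<close>

context tree_group
begin

lemmas arcD = graphD[OF is_treeD(1)[OF T]]

lemma arc_ex: "(x, y) \<in> adj T \<Longrightarrow> \<exists>b\<in>arcs T. orig T b = x \<and> terminus T b = y"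
  unfolding adj_def by auto

lemma arc_map_tot [simp]: "b \<in> arcs T \<Longrightarrow> arc_map T (tot (verts T) g) b = arc_map T g b"
  using arcD(1,4)[of b] by (simp add: arc_map_def)

lemma arc_map_Gh:
  assumes "h \<in> Gh" "b \<in> arcs T"
  shows "arc_map T h b \<in> arcs T" "orig T (arc_map T h b) = h (orig T b)"
    "terminus T (arc_map T h b) = h (terminus T b)"
  using arc_map_props[OF T assms(2), of h] G_E[OF assms(1) arcD(7)[OF assms(2)]] by auto

lemma arc_eqI: "a \<in> arcs T \<Longrightarrow> b \<in> arcs T \<Longrightarrow> orig T a = orig T b \<Longrightarrow> terminus T a = terminus T b \<Longrightarrow> a = b"
  using tree_arc_unique[OF T] .

lemma arc_map_comp: "g \<in> Gh \<Longrightarrow> h \<in> Gh \<Longrightarrow> b \<in> arcs T \<Longrightarrow> arc_map T (g \<circ> h) b = arc_map T g (arc_map T h b)"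
  by (rule arc_eqI) (simp_all add: arc_map_Gh G_comp)

lemma arc_map_id: "b \<in> arcs T \<Longrightarrow> arc_map T id b = b"
  by (rule arc_eqI) (simp_all add: arc_map_Gh)

lemma arc_map_rev: "h \<in> Gh \<Longrightarrow> b \<in> arcs T \<Longrightarrow> arc_map T h (arev T b) = arev T (arc_map T h b)"
  by (rule arc_eqI) (simp_all add: arc_map_Gh arcD)

lemma arc_map_inv: "h \<in> Gh \<Longrightarrow> b \<in> arcs T \<Longrightarrow> arc_map T (pinv h) (arc_map T h b) = b"
  by (rule arc_eqI) (simp_all add: arc_map_Gh G_inv)

abbreviation \<Gamma> where "\<Gamma> \<equiv> quotient_graph T G"

definition cls where "cls x = orbit (perm_group (verts T) G) (\<lambda>g. g) x"
definition acls where "acls b = orbit (perm_group (verts T) G) (arc_map T) b"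

lemma cls_alt: "x \<in> verts T \<Longrightarrow> cls x = {h x | h. h \<in> Gh}"
  by (simp add: cls_def orbit_def perm_group_def Gh_def Setcompr_eq_image image_image)

lemma acls_alt: "b \<in> arcs T \<Longrightarrow> acls b = {arc_map T h b | h. h \<in> Gh}"
  by (simp add: acls_def orbit_def perm_group_def Gh_def Setcompr_eq_image image_image)

lemma cls_self: "x \<in> verts T \<Longrightarrow> x \<in> cls x"
  using G_id by (auto simp: cls_alt intro!: exI[of _ id])

lemma cls_G: assumes "x \<in> verts T" "h \<in> Gh" shows "cls (h x) = cls x"
proof -
  have "\<exists>k'. k (h x) = k' x \<and> k' \<in> Gh" if "k \<in> Gh" for k
    using that assms by (intro exI[of _ "k \<circ> h"]) (simp add: G_comp)
  moreover have "\<exists>k'. k x = k' (h x) \<and> k' \<in> Gh" if "k \<in> Gh" for k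
    using that assms by (intro exI[of _ "k \<circ> pinv h"]) (simp add: G_comp G_inv)
  ultimately show ?thesis using assms by (auto simp: cls_alt)
qed

lemma cls_eq_iff: "x \<in> verts T \<Longrightarrow> y \<in> verts T \<Longrightarrow> cls x = cls y \<longleftrightarrow> (\<exists>h\<in>Gh. y = h x)"
  using cls_self[of y] cls_G by (auto simp: cls_alt[of x])

lemma acls_self: "b \<in> arcs T \<Longrightarrow> b \<in> acls b"
  using G_id arc_map_id[of b] by (auto simp: acls_alt intro!: exI[of _ id])

lemma acls_G: assumes "b \<in> arcs T" "h \<in> Gh" shows "acls (arc_map T h b) = acls b"
proof -
  have "\<exists>k'. arc_map T k (arc_map T h b) = arc_map T k' b \<and> k' \<in> Gh" if "k \<in> Gh" for k
    using that assms by (intro exI[of _ "k \<circ> h"]) (simp add: G_comp arc_map_comp)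
  moreover have "\<exists>k'. arc_map T k b = arc_map T k' (arc_map T h b) \<and> k' \<in> Gh" if "k \<in> Gh" for k
    using that assms
    by (intro exI[of _ "k \<circ> pinv h"]) (simp add: G_comp G_inv arc_map_comp arc_map_Gh arc_map_inv)
  ultimately show ?thesis using assms by (auto simp: acls_alt arc_map_Gh)
qed

lemma acls_eq_iff: "b \<in> arcs T \<Longrightarrow> c \<in> arcs T \<Longrightarrow> acls b = acls c \<longleftrightarrow> (\<exists>h\<in>Gh. c = arc_map T h b)"
  using acls_self[of c] acls_G by (auto simp: acls_alt[of b])

lemma verts_\<Gamma>: "verts \<Gamma> = cls ` verts T"
  by (auto simp: quotient_graph_def orbits_def cls_def)

lemma arcs_\<Gamma>: "arcs \<Gamma> = acls ` arcs T"
  by (auto simp: quotient_graph_def orbits_def acls_def)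

lemma orig_\<Gamma>: "b \<in> arcs T \<Longrightarrow> orig \<Gamma> (acls b) = cls (orig T b)"
  using arcD(1)[of b] by (force simp: quotient_graph_def acls_alt cls_alt arc_map_Gh)

lemma arev_\<Gamma>: "b \<in> arcs T \<Longrightarrow> arev \<Gamma> (acls b) = acls (arev T b)"
  using arcD(2)[of b] by (force simp: quotient_graph_def acls_alt arc_map_rev)

lemma terminus_\<Gamma>: "b \<in> arcs T \<Longrightarrow> terminus \<Gamma> (acls b) = cls (terminus T b)"
  by (simp add: terminus_def[of \<Gamma>] arev_\<Gamma> orig_\<Gamma> arcD)

lemma adj_\<Gamma>: "adj \<Gamma> = {(cls x, cls y) | x y. (x, y) \<in> adj T}"
proof -
  have "adj \<Gamma> = {(cls (orig T b), cls (terminus T b)) | b. b \<in> arcs T}"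
    unfolding adj_def by (auto simp: arcs_\<Gamma> orig_\<Gamma> terminus_\<Gamma>) (metis imageI orig_\<Gamma> terminus_\<Gamma>)
  then show ?thesis unfolding adj_def[of T] by blast
qed

lemma graph_\<Gamma>: "is_graph \<Gamma>"
  unfolding is_graph_def by (auto simp: arcs_\<Gamma> verts_\<Gamma> orig_\<Gamma> arev_\<Gamma> arcD)

lemma connected_\<Gamma>: "connected_graph \<Gamma>"
  unfolding connected_graph_def
proof (intro ballI)
  fix u v assume "u \<in> verts \<Gamma>" "v \<in> verts \<Gamma>"
  then obtain x y where xy: "x \<in> verts T" "y \<in> verts T" "u = cls x" "v = cls y" unfolding verts_\<Gamma> by blast
  have "(cls x, cls y) \<in> (adj \<Gamma>)\<^sup>*" using xy(1,2)
  proof (induction rule: tree_induct)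
    case (step y z)
    then have "(cls y, cls z) \<in> adj \<Gamma>" unfolding adj_\<Gamma> by blast
    then show ?case using step by (meson rtrancl.rtrancl_into_rtrancl)
  qed simp
  then show "(u, v) \<in> (adj \<Gamma>)\<^sup>*" using xy by simp
qed

lemma translate_arc:
  assumes "b \<in> arcs T" "x \<in> verts T" "cls x = cls (orig T b)"
  obtains c where "c \<in> arcs T" "orig T c = x" "acls c = acls b"
proof -
  obtain h where h: "h \<in> Gh" "x = h (orig T b)" using cls_eq_iff[of "orig T b" x] assms arcD(1) by auto
  show thesis using that[of "arc_map T h b"] h arc_map_Gh[OF h(1) assms(1)] acls_G[OF assms(1) h(1)] by simp
qed

text \<open>Two neighbours of \<open>x\<close> in one orbit give parallel arcs of the quotient,
  which coincide in a tree. The arcs at \<open>x\<close> are then conjugate by an element that fixes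
  \<open>x\<close>, the folding that \<open>generated_by_vertex_stabs\<close> asks for.\<close>

lemma vertex_gen_if_tree:
  assumes "is_tree \<Gamma>"
    and M: "perm_subgroup M" "M \<subseteq> Gh" "\<And>g x. g \<in> Gh \<Longrightarrow> x \<in> verts T \<Longrightarrow> g x = x \<Longrightarrow> g \<in> M"
  shows "Gh \<subseteq> M"
proof (rule generated_by_vertex_stabs[OF tree_rel_adj[OF assms(1)], where cls = cls])
  show "(cls x, cls y) \<in> adj \<Gamma>" if "(x, y) \<in> adj T" for x y using that unfolding adj_\<Gamma> by blast
  show "cls (g x) = cls x" if "g \<in> Gh" for g x
    using that cls_G[of x g] G_out[of g x] by (cases "x \<in> verts T") auto
  show "\<exists>h\<in>Gh. h x = x \<and> h y = y'" if e: "(x, y) \<in> adj T" "(x, y') \<in> adj T" "cls y = cls y'" for x y y'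
  proof -
    obtain b b' where b: "b \<in> arcs T" "orig T b = x" "terminus T b = y"
      "b' \<in> arcs T" "orig T b' = x" "terminus T b' = y'" using arc_ex e by metis
    have "acls b = acls b'"
      by (rule tree_arc_unique[OF assms(1)]) (use b e in \<open>auto simp: arcs_\<Gamma> orig_\<Gamma> terminus_\<Gamma>\<close>)
    then obtain h where "h \<in> Gh" "b' = arc_map T h b" using acls_eq_iff b by blast
    then show ?thesis using b arc_map_Gh[of h b] by auto
  qed
  show "verts T \<noteq> {}" using is_treeD(2)[OF T] .
qed (use M in auto)

lemma no_loop_if_tree:
  assumes "is_tree \<Gamma>" "g \<in> Gh"
  shows "(v, g v) \<notin> adj T"
proof
  assume e: "(v, g v) \<in> adj T"
  then have "(cls v, cls (g v)) \<in> adj \<Gamma>" unfolding adj_\<Gamma> by blast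
  then have "(cls v, cls v) \<in> adj \<Gamma>" using cls_G E_V[OF e] assms by simp
  then show False using tree_rel.E_irrefl[OF tree_rel_adj[OF assms(1)]] by blast
qed

text \<open>Each failure singles out an invariant set of edges, and \<open>parity\<close> gives a
  colouring constant on orbits that changes exactly across it. Over a loop it would change between
  vertices of one orbit; over one of two parallel edges it would change, over the other not, with
  the same end classes; around a cycle it would change exactly once.\<close>

lemma tree_if_simple:
  assumes "simple_tree_action (verts T) (adj T) Gh"
  shows "is_tree \<Gamma>"
proof -
  interpret S: simple_tree_action "verts T" "adj T" Gh by (rule assms)
  have flip_const: False
    if Q: "\<And>x y. (x, y) \<in> Q \<Longrightarrow> (y, x) \<in> Q" "\<And>g x y. g \<in> Gh \<Longrightarrow> (g x, g y) \<in> Q \<longleftrightarrow> (x, y) \<in> Q"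
      and 1: "(x, y) \<in> adj T" "(x, y) \<in> Q" "(x, y') \<in> adj T" "(x, y') \<notin> Q" "cls y = cls y'" for Q x y y'
  proof -
    obtain c :: "'v \<Rightarrow> bool" where c: "\<forall>(x, y)\<in>adj T. c x \<noteq> c y \<longleftrightarrow> (x, y) \<in> Q" "\<forall>g\<in>Gh. \<forall>x\<in>verts T. c (g x) = c x"
      using S.parity[OF Q] by blast
    have "c y = c y'" using cls_eq_iff[of y y'] E_V 1 c(2) by auto
    moreover have "c x \<noteq> c y" "c x = c y'" using c(1) 1 by auto
    ultimately show False by simp
  qed
  have no_loop: "\<not> has_loop \<Gamma>"
  proof
    assume "has_loop \<Gamma>"
    then obtain b where b: "b \<in> arcs T" "cls (orig T b) = cls (terminus T b)"
      unfolding has_loop_def by (auto simp: arcs_\<Gamma> orig_\<Gamma> terminus_\<Gamma>)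
    define Q where "Q = {(x, y). x \<in> verts T \<and> y \<in> verts T \<and> cls x = cls y}"
    obtain c :: "'v \<Rightarrow> bool" where c: "\<forall>(x, y)\<in>adj T. c x \<noteq> c y \<longleftrightarrow> (x, y) \<in> Q" "\<forall>g\<in>Gh. \<forall>x\<in>verts T. c (g x) = c x"
      using S.parity[of Q] cls_G unfolding Q_def by fastforce
    have "c (orig T b) = c (terminus T b)"
      using cls_eq_iff[of "orig T b" "terminus T b"] arcD[OF b(1)] b c(2) by auto
    moreover have "(orig T b, terminus T b) \<in> Q" using b arcD[OF b(1)] by (simp add: Q_def)
    ultimately show False using c(1) arcD(7)[OF b(1)] by auto
  qed
  have "\<not> has_multiple_edge \<Gamma>"
  proof
    assume "has_multiple_edge \<Gamma>"
    then obtain b b0 where b: "b \<in> arcs T" "b0 \<in> arcs T" "acls b \<noteq> acls b0" "cls (orig T b) = cls (orig T b0)"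
      "cls (terminus T b) = cls (terminus T b0)"
      unfolding has_multiple_edge_def by (auto simp: arcs_\<Gamma> orig_\<Gamma> terminus_\<Gamma>)
    obtain b' where b': "b' \<in> arcs T" "orig T b' = orig T b" "acls b' = acls b0"
      using translate_arc[OF b(2) _ b(4)] arcD(1)[OF b(1)] by blast
    have t: "cls (terminus T b') = cls (terminus T b)"
      using terminus_\<Gamma>[OF b'(1)] terminus_\<Gamma>[OF b(2)] b b' by simp
    \<comment> \<open>The orbit of \<open>b\<close> in both directions. The edge of
      \<open>b'\<close> is not in it: if the reverse of \<open>b'\<close> lay in the orbit of
      \<open>b\<close>, the common ends in the quotient would form a loop.\<close>
    define Q where "Q = {(x, y). \<exists>c\<in>arcs T. orig T c = x \<and> terminus T c = y \<and> (acls c = acls b \<or> acls (arev T c) = acls b)}"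
    have QG1: "(g x, g y) \<in> Q" if gQ: "g \<in> Gh" "(x, y) \<in> Q" for g x y
    proof -
      obtain c where c: "c \<in> arcs T" "orig T c = x" "terminus T c = y" "acls c = acls b \<or> acls (arev T c) = acls b"
        using gQ(2) unfolding Q_def by blast
      have "orig T (arc_map T g c) = g x" "terminus T (arc_map T g c) = g y"
        "acls (arc_map T g c) = acls b \<or> acls (arev T (arc_map T g c)) = acls b"
        using c arc_map_Gh[OF gQ(1) c(1)] acls_G[OF c(1) gQ(1)] acls_G[OF arcD(2)[OF c(1)] gQ(1)]
          arc_map_rev[OF gQ(1) c(1)] by auto
      then show ?thesis unfolding Q_def using arc_map_Gh(1)[OF gQ(1) c(1)] by blast
    qed
    show False
    proof (rule flip_const[of Q "orig T b" "terminus T b" "terminus T b'"])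
      show "(y, x) \<in> Q" if xy: "(x, y) \<in> Q" for x y
      proof -
        obtain c where c: "c \<in> arcs T" "orig T c = x" "terminus T c = y" "acls c = acls b \<or> acls (arev T c) = acls b"
          using xy unfolding Q_def by blast
        have "orig T (arev T c) = y" "terminus T (arev T c) = x"
          "acls (arev T c) = acls b \<or> acls (arev T (arev T c)) = acls b"
          using c arcD(3,5,6)[OF c(1)] by auto
        then show ?thesis unfolding Q_def using arcD(2)[OF c(1)] by blast
      qed
      show "(g x, g y) \<in> Q \<longleftrightarrow> (x, y) \<in> Q" if "g \<in> Gh" for g x y
        using QG1[OF that, of x y] QG1[OF G_inv[OF that], of "g x" "g y"] that by auto
      show "(orig T b, terminus T b) \<in> Q" unfolding Q_def using b by blast
      show "(orig T b, terminus T b') \<notin> Q"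
      proof
        assume "(orig T b, terminus T b') \<in> Q"
        then obtain c where c: "c \<in> arcs T" "orig T c = orig T b" "terminus T c = terminus T b'"
          "acls c = acls b \<or> acls (arev T c) = acls b"
          unfolding Q_def mem_Collect_eq prod.case by metis
        have "c = b'" using arc_eqI[OF c(1) b'(1)] c b' by simp
        then have "acls (arev T b') = acls b" using c(4) b(3) b'(3) by simp
        then have "cls (terminus T b') = cls (orig T b)"
          using orig_\<Gamma>[OF arcD(2)[OF b'(1)]] orig_\<Gamma>[OF b(1)] arcD(5)[OF b'(1)] by simp
        then show False using no_loop t b(1) unfolding has_loop_def
          by (auto simp: arcs_\<Gamma> orig_\<Gamma> terminus_\<Gamma>)
      qed
    qed (use arcD(7)[OF b(1)] arcD(7)[OF b'(1)] b' t in auto)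
  qed
  moreover have "\<not> has_cycle \<Gamma>"
  proof
    assume "has_cycle \<Gamma>"
    then obtain vs where vs: "3 \<le> length vs" "distinct vs" "\<And>i. i < length vs \<Longrightarrow> (vs ! i, vs ! (Suc i mod length vs)) \<in> adj \<Gamma>"
      unfolding has_cycle_def by blast
    define Q where "Q = {(x, y). x \<in> verts T \<and> y \<in> verts T \<and> {cls x, cls y} = {vs ! 0, vs ! 1}}"
    have Q_sym: "(y, x) \<in> Q" if "(x, y) \<in> Q" for x y
      using that unfolding Q_def mem_Collect_eq prod.case by (metis insert_commute)
    have Q_G: "(g x, g y) \<in> Q \<longleftrightarrow> (x, y) \<in> Q" if "g \<in> Gh" for g x y
      using that by (simp add: Q_def cls_G cong: conj_cong)
    obtain c :: "'v \<Rightarrow> bool" where c: "\<forall>(x, y)\<in>adj T. c x \<noteq> c y \<longleftrightarrow> (x, y) \<in> Q" "\<forall>g\<in>Gh. \<forall>x\<in>verts T. c (g x) = c x"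
      using S.parity[of Q, OF Q_sym Q_G] by blast
    define d where "d v = c (SOME x. x \<in> verts T \<and> cls x = v)" for v
    have d: "d (cls x) = c x" if x: "x \<in> verts T" for x
    proof -
      define y where "y = (SOME y. y \<in> verts T \<and> cls y = cls x)"
      have "\<exists>y. y \<in> verts T \<and> cls y = cls x" using x by blast
      from someI_ex[OF this] have y: "y \<in> verts T" "cls x = cls y" unfolding y_def by auto
      then obtain h where "h \<in> Gh" "y = h x" using cls_eq_iff[OF x y(1)] by blast
      then have "c y = c x" using c(2) x by blast
      then show ?thesis by (simp add: d_def y_def)
    qed
    have step: "d u \<noteq> d v \<longleftrightarrow> {u, v} = {vs ! 0, vs ! 1}" if uv: "(u, v) \<in> adj \<Gamma>" for u v
    proof -
      obtain x y where xy: "(x, y) \<in> adj T" "u = cls x" "v = cls y" using uv unfolding adj_\<Gamma> by blast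
      then have "c x \<noteq> c y \<longleftrightarrow> (x, y) \<in> Q" using c(1) by auto
      then show ?thesis using xy d E_V[OF xy(1)] unfolding Q_def by simp
    qed
    have ne: "vs \<noteq> []" using vs(1) by auto
    then have 01: "d (vs ! 0) \<noteq> d (vs ! 1)" using step[OF vs(3)[of 0]] vs(1) by simp
    have same: "d (vs ! i) = d (vs ! (Suc i mod length vs))" if i: "0 < i" "i < length vs" for i
    proof -
      have "vs ! i \<noteq> vs ! 0" using i ne nth_eq_iff_index_eq[OF vs(2), of i 0] by simp
      moreover have "vs ! (Suc i mod length vs) \<noteq> vs ! 0 \<or> vs ! i \<noteq> vs ! 1"
      proof (rule disjCI)
        assume "\<not> vs ! i \<noteq> vs ! 1"
        then have "i = 1" using i vs(1,2) nth_eq_iff_index_eq[OF vs(2), of i 1] by simp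
        then show "vs ! (Suc i mod length vs) \<noteq> vs ! 0" using vs(1) ne nth_eq_iff_index_eq[OF vs(2), of 2 0] by (simp add: numeral_2_eq_2)
      qed
      ultimately have "{vs ! i, vs ! (Suc i mod length vs)} \<noteq> {vs ! 0, vs ! 1}" by (auto simp: doubleton_eq_iff)
      then show ?thesis using step[OF vs(3)[OF i(2)]] by blast
    qed
    have const: "i < length vs \<Longrightarrow> 0 < i \<Longrightarrow> d (vs ! i) = d (vs ! 1)" for i
    proof (induction i)
      case (Suc i)
      then show ?case using same[of i] by (cases "i = 0") auto
    qed simp
    have "Suc (length vs - 1) = length vs" using vs(1) by simp
    then have "d (vs ! (length vs - 1)) = d (vs ! 0)" using same[of "length vs - 1"] vs(1) by simp
    then show False using const[of "length vs - 1"] 01 vs(1) by simp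
  qed
  ultimately show ?thesis unfolding is_tree_def
    using graph_\<Gamma> connected_\<Gamma> no_loop is_treeD(2)[OF T] by (simp add: verts_\<Gamma>)
qed

end

section \<open>Local action diagrams and universal groups\<close>

locale tree_group_rep = tree_group T G for T :: "('v, 'a) graph" and G :: "('v \<Rightarrow> 'v) set" +
  fixes rep :: "'v set \<Rightarrow> 'v"
  assumes rep: "S \<noteq> {} \<Longrightarrow> rep S \<in> S"
begin

abbreviation \<Delta> where "\<Delta> \<equiv> local_action_diagram T G rep"

lemma base_\<Delta> [simp]: "base \<Delta> = \<Gamma>"
  by (simp add: local_action_diagram_def)

lemma rep_cls:
  assumes "x \<in> verts T"
  shows "\<exists>h\<in>Gh. rep (cls x) = h x" "rep (cls x) \<in> verts T" "cls (rep (cls x)) = cls x"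
proof -
  have "rep (cls x) \<in> cls x" using rep[of "cls x"] cls_self[OF assms] by blast
  then show ex: "\<exists>h\<in>Gh. rep (cls x) = h x" using cls_alt[OF assms] by blast
  then obtain h where "h \<in> Gh" "rep (cls x) = h x" by blast
  then show "rep (cls x) \<in> verts T" "cls (rep (cls x)) = cls x" using assms cls_G by auto
qed

lemma colours_\<Delta>: "b \<in> arcs T \<Longrightarrow>
  colours \<Delta> (acls b) = {c \<in> arcs T. orig T c = rep (cls (orig T b)) \<and> acls c = acls b}"
  by (auto simp: local_action_diagram_def orig_\<Gamma> out_arcs_def acls_def[symmetric])

lemma colours_at_\<Delta>:
  assumes x: "x \<in> verts T" shows "colours_at \<Delta> (cls x) = out_arcs T (rep (cls x))"
proof (intro equalityI subsetI)
  fix c assume "c \<in> colours_at \<Delta> (cls x)"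
  then obtain b where "b \<in> arcs T" "cls (orig T b) = cls x" "c \<in> colours \<Delta> (acls b)"
    unfolding colours_at_def out_arcs_def by (auto simp: arcs_\<Gamma> orig_\<Gamma>)
  then show "c \<in> out_arcs T (rep (cls x))" by (simp add: colours_\<Delta> out_arcs_def)
next
  fix c assume c: "c \<in> out_arcs T (rep (cls x))"
  then have "c \<in> arcs T" "orig T c = rep (cls x)" by (auto simp: out_arcs_def)
  then have "acls c \<in> out_arcs \<Gamma> (cls x)" "c \<in> colours \<Delta> (acls c)"
    using rep_cls[OF x] by (auto simp: out_arcs_def arcs_\<Gamma> orig_\<Gamma> colours_\<Delta>)
  then show "c \<in> colours_at \<Delta> (cls x)" unfolding colours_at_def by auto
qed

text \<open>The orbits of the arcs of \<open>S\<close> form a scopo of the diagram. At most one arc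
  of \<open>S\<close> leaves each vertex, so only one arc at the chosen representative lies in such
  an orbit, as the cardinality condition demands.\<close>

lemma arc_scopo_empty:
  assumes irr: "irreducible_diagram \<Delta>" and S: "arc_scopo S"
  shows "S = {}"
proof -
  have SE: "(x, y) \<in> S \<Longrightarrow> (x, y) \<in> adj T" for x y using S unfolding arc_scopo_def by blast
  have SG: "(x, y) \<in> S \<Longrightarrow> h \<in> Gh \<Longrightarrow> (h x, h y) \<in> S" for x y h using S unfolding arc_scopo_def by blast
  have Sa: "(x, y) \<in> S \<Longrightarrow> (y, x) \<notin> S" for x y using S unfolding arc_scopo_def by blast
  have Sb: "(x, y) \<in> S \<Longrightarrow> (z, x) \<in> adj T \<Longrightarrow> z \<noteq> y \<Longrightarrow> (z, x) \<in> S" for x y z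
    using S unfolding arc_scopo_def by blast
  have Su: "(x, y) \<in> S \<Longrightarrow> (x, z) \<in> S \<Longrightarrow> y = z" for x y z
    using Sb[of x y z] SE E_sym Sa by blast
  define B where "B = {b \<in> arcs T. (orig T b, terminus T b) \<in> S}"
  have B_G: "arc_map T h b \<in> B" if "b \<in> B" "h \<in> Gh" for b h
    using that SG arc_map_Gh[OF that(2)] unfolding B_def by simp
  have B_cls: "b \<in> B" if b: "b \<in> arcs T" "acls b \<in> acls ` B" for b
  proof -
    obtain c where c: "c \<in> B" "acls c = acls b" using b(2) by force
    then have "c \<in> arcs T" by (simp add: B_def)
    then obtain h where "h \<in> Gh" "b = arc_map T h c" using c acls_eq_iff b(1) by blast
    then show ?thesis using B_G c by blast
  qed
  have "scopo \<Delta> (acls ` B)" unfolding scopo_def base_\<Delta>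
  proof (intro conjI ballI impI)
    show "acls ` B \<subseteq> arcs \<Gamma>" by (auto simp: arcs_\<Gamma> B_def)
    fix a assume "a \<in> acls ` B"
    then obtain b where b: "b \<in> B" "a = acls b" by blast
    then have bT: "b \<in> arcs T" by (simp add: B_def)
    show "arev \<Gamma> a \<notin> acls ` B"
    proof
      assume "arev \<Gamma> a \<in> acls ` B"
      then have "arev T b \<in> B" using B_cls[OF arcD(2)[OF bT]] arev_\<Gamma>[OF bT] b by simp
      then show False using b Sa arcD(5,6)[OF bT] by (simp add: B_def)
    qed
    obtain h where h: "h \<in> Gh" "rep (cls (orig T b)) = h (orig T b)" using rep_cls(1) arcD(1)[OF bT] by blast
    have "colours \<Delta> a = {arc_map T h b}"
    proof (intro equalityI subsetI)
      fix c assume "c \<in> colours \<Delta> a"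
      then have c: "c \<in> arcs T" "orig T c = h (orig T b)" "acls c = acls b" using colours_\<Delta>[OF bT] b h by auto
      then have "c \<in> B" using B_cls b by simp
      moreover have "arc_map T h b \<in> B" using B_G b h by blast
      ultimately have "terminus T c = terminus T (arc_map T h b)"
        using Su c arc_map_Gh[OF h(1) bT] by (simp add: B_def)
      then show "c \<in> {arc_map T h b}" using arc_eqI c arc_map_Gh[OF h(1) bT] by simp
    qed (use colours_\<Delta>[OF bT] b h arc_map_Gh[OF h(1) bT] acls_G[OF bT h(1)] in simp)
    then show "card (colours \<Delta> a) = 1" by simp
  next
    fix v a assume "a \<in> acls ` B" and v: "orig \<Gamma> a = v"
    then obtain b where b: "b \<in> B" "a = acls b" by blast
    then have bT: "b \<in> arcs T" by (simp add: B_def)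
    show "{c \<in> arcs \<Gamma>. terminus \<Gamma> c = v \<and> c \<noteq> arev \<Gamma> a} \<subseteq> acls ` B"
    proof
      fix c assume "c \<in> {c \<in> arcs \<Gamma>. terminus \<Gamma> c = v \<and> c \<noteq> arev \<Gamma> a}"
      then obtain e where e: "e \<in> arcs T" "c = acls e" "terminus \<Gamma> c = v" "c \<noteq> arev \<Gamma> a"
        unfolding arcs_\<Gamma> by blast
      have "cls (terminus T e) = cls (orig T b)" using e v b terminus_\<Gamma> orig_\<Gamma> bT by simp
      then obtain h where h: "h \<in> Gh" "orig T b = h (terminus T e)"
        using cls_eq_iff arcD(1)[OF bT] arcD(4)[OF e(1)] by blast
      let ?e = "arc_map T h e"
      note he = arc_map_Gh[OF h(1) e(1)]
      have "orig T ?e \<noteq> terminus T b"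
      proof
        assume *: "orig T ?e = terminus T b"
        have "?e = arev T b"
          by (rule arc_eqI) (use he h * arcD[OF bT] in auto)
        then show False using e b arev_\<Gamma>[OF bT] acls_G[OF e(1) h(1)] by simp
      qed
      then have "?e \<in> B" using Sb[of "orig T b" "terminus T b" "orig T ?e"] b he h arcD(7)[OF he(1)]
        unfolding B_def by simp
      then show "c \<in> acls ` B" using acls_G[OF e(1) h(1)] e by blast
    qed
  qed
  then have "acls ` B = {}" using irr unfolding irreducible_diagram_def by blast
  then have "(x, y) \<notin> S" for x y using arc_ex[of x y] SE[of x y] unfolding B_def by auto
  then show ?thesis by auto
qed

lemma irreducible_if_arc_scopo_empty:
  assumes "\<And>S. arc_scopo S \<Longrightarrow> S = {}"
  shows "irreducible_diagram \<Delta>"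
  unfolding irreducible_diagram_def
proof (intro allI impI)
  fix Q assume Q: "scopo \<Delta> Q"
  have Q1: "Q \<subseteq> acls ` arcs T" using Q unfolding scopo_def base_\<Delta> arcs_\<Gamma> by blast
  have Q2: "arev \<Gamma> a \<notin> Q" "card (colours \<Delta> a) = 1" if "a \<in> Q" for a
    using Q that unfolding scopo_def base_\<Delta> by auto
  have Q3: "c \<in> Q" if "a \<in> Q" "orig \<Gamma> a \<in> verts \<Gamma>" "c \<in> arcs \<Gamma>" "terminus \<Gamma> c = orig \<Gamma> a" "c \<noteq> arev \<Gamma> a" for a c
    using Q that unfolding scopo_def base_\<Delta> by blast
  define S where "S = (\<lambda>b. (orig T b, terminus T b)) ` {b \<in> arcs T. acls b \<in> Q}"
  have S_iff: "(orig T b, terminus T b) \<in> S \<longleftrightarrow> acls b \<in> Q" if "b \<in> arcs T" for b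
    using arc_eqI[OF that] that unfolding S_def by auto
  have "arc_scopo S" unfolding arc_scopo_def
  proof (intro conjI ballI; (elim SigmaE)?)
    show "S \<subseteq> adj T" unfolding S_def using arcD(7) by auto
    fix p assume "p \<in> S"
    then obtain b where b: "b \<in> arcs T" "acls b \<in> Q" "p = (orig T b, terminus T b)" unfolding S_def by blast
    show "case p of (x, y) \<Rightarrow> (g x, g y) \<in> S" if g: "g \<in> Gh" for g
      using S_iff[OF arc_map_Gh(1)[OF g b(1)]] arc_map_Gh[OF g b(1)] acls_G[OF b(1) g] b by simp
    have "(terminus T b, orig T b) \<notin> S"
      using S_iff[OF arcD(2)[OF b(1)]] arcD(5,6)[OF b(1)] Q2(1)[OF b(2)] arev_\<Gamma>[OF b(1)] by simp
    moreover have "(z, orig T b) \<in> S" if z: "(z, orig T b) \<in> adj T" "z \<noteq> terminus T b" for z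
    proof -
      obtain c where c: "c \<in> arcs T" "orig T c = z" "terminus T c = orig T b" using arc_ex[OF z(1)] by blast
      \<comment> \<open>The scopo condition exempts the whole reverse orbit,
        \<open>arc_scopo\<close> only the reverse arc. If \<open>c\<close> lay over the reverse
        orbit, \<open>b\<close> and the reverse of \<open>c\<close> would be two arcs of one orbit
        leaving the same vertex, against
        \<open>card (colours \<Delta> (acls b)) = 1\<close>.\<close>
      have ne: "acls c \<noteq> arev \<Gamma> (acls b)"
      proof
        assume "acls c = arev \<Gamma> (acls b)"
        then have "acls (arev T c) = acls b"
          using arev_\<Gamma>[OF c(1)] arev_\<Gamma>[OF arcD(2)[OF b(1)]] arev_\<Gamma>[OF b(1)] arcD(3)[OF b(1)] by simp
        moreover obtain h where h: "h \<in> Gh" "rep (cls (orig T b)) = h (orig T b)"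
          using rep_cls(1) arcD(1)[OF b(1)] by blast
        ultimately have "arc_map T h b \<in> colours \<Delta> (acls b)" "arc_map T h (arev T c) \<in> colours \<Delta> (acls b)"
          using colours_\<Delta>[OF b(1)] arc_map_Gh[OF h(1) b(1)] arc_map_Gh[OF h(1) arcD(2)[OF c(1)]]
            acls_G[OF b(1) h(1)] acls_G[OF arcD(2)[OF c(1)] h(1)] arcD(5)[OF c(1)] c by auto
        then have "arc_map T h b = arc_map T h (arev T c)"
          using Q2(2)[OF b(2)] by (metis card_1_singletonE singletonD)
        then have "h (terminus T b) = h z"
          using arc_map_Gh(3)[OF h(1) b(1)] arc_map_Gh(3)[OF h(1) arcD(2)[OF c(1)]] arcD(6)[OF c(1)] c by simp
        then show False using z(2) G_inj[OF h(1)] by simp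
      qed
      have "acls c \<in> Q"
        by (rule Q3[OF b(2)]) (use b c ne arcD(1)[OF b(1)] in \<open>auto simp: orig_\<Gamma> terminus_\<Gamma> verts_\<Gamma> arcs_\<Gamma>\<close>)
      then show ?thesis using S_iff[OF c(1)] c by simp
    qed
    ultimately show "case p of (x, y) \<Rightarrow> (y, x) \<notin> S \<and> (\<forall>z. (z, x) \<in> adj T \<and> z \<noteq> y \<longrightarrow> (z, x) \<in> S)"
      using b by simp
  qed
  then have "S = {}" by (rule assms)
  then show "Q = {}" using Q1 unfolding S_def by blast
qed

section \<open>Local actions and point stabilisers\<close>

definition loc :: "'v \<Rightarrow> ('v \<Rightarrow> 'v) \<Rightarrow> 'a \<Rightarrow> 'a"
  where "loc w h = restrict (arc_map T h) (out_arcs T w)"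

lemma loc_Bij: assumes "h \<in> Gh" "h w = w" shows "loc w h \<in> Bij (out_arcs T w)"
proof -
  have into: "arc_map T k b \<in> out_arcs T w" if "k \<in> Gh" "k w = w" "b \<in> out_arcs T w" for k b
    using that arc_map_Gh[of k b] by (simp add: out_arcs_def)
  have iw: "pinv h w = w" using assms G_inv_eq by simp
  have "bij_betw (arc_map T h) (out_arcs T w) (out_arcs T w)"
  proof (rule bij_betwI[where g = "arc_map T (pinv h)"])
    show "arc_map T (pinv h) (arc_map T h b) = b" if "b \<in> out_arcs T w" for b
      using arc_map_inv[OF assms(1)] that by (simp add: out_arcs_def)
    show "arc_map T h (arc_map T (pinv h) b) = b" if "b \<in> out_arcs T w" for b
      using arc_map_inv[OF G_inv[OF assms(1)], of b] that assms by (simp add: out_arcs_def G_inv_inv)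
  qed (use into assms iw G_inv in auto)
  then show ?thesis by (simp add: loc_def Bij_def cong: bij_betw_cong)
qed

lemma loc_comp: "g \<in> Gh \<Longrightarrow> h \<in> Gh \<Longrightarrow> h w = w \<Longrightarrow> loc w (g \<circ> h) = compose (out_arcs T w) (loc w g) (loc w h)"
  using arc_map_Gh[of h] by (auto simp: loc_def compose_def fun_eq_iff out_arcs_def arc_map_comp)

lemma loc_mult: "g \<in> Gh \<Longrightarrow> g w = w \<Longrightarrow> h \<in> Gh \<Longrightarrow> h w = w \<Longrightarrow>
    loc w g \<otimes>\<^bsub>BijGroup (out_arcs T w)\<^esub> loc w h = loc w (g \<circ> h)"
  using BijGroup_mult[OF loc_Bij loc_Bij] loc_comp by simp

lemma loc_id: "loc w id = (\<lambda>b\<in>out_arcs T w. b)"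
  by (auto simp: loc_def fun_eq_iff out_arcs_def arc_map_id)

lemma loc_inv:
  assumes g: "g \<in> Gh" "g w = w"
  shows "inv\<^bsub>BijGroup (out_arcs T w)\<^esub> (loc w g) = loc w (pinv g)"
proof (rule group.inv_equality[OF group_BijGroup])
  have pw: "pinv g w = w" using g G_inv_eq by simp
  show "loc w (pinv g) \<otimes>\<^bsub>BijGroup (out_arcs T w)\<^esub> loc w g = \<one>\<^bsub>BijGroup (out_arcs T w)\<^esub>"
    using loc_mult[OF G_inv[OF g(1)] pw g] by (simp add: G_inv_comp g loc_id BijGroup_one)
  show "loc w g \<in> carrier (BijGroup (out_arcs T w))" "loc w (pinv g) \<in> carrier (BijGroup (out_arcs T w))"
    using loc_Bij g G_inv pw by (auto simp: BijGroup_def)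
qed

text \<open>The local action before the closure is taken; \<open>local_group_eq_locs\<close> shows
  that for closed groups with (P) the closure adds nothing.\<close>

definition locs :: "'v \<Rightarrow> ('a \<Rightarrow> 'a) set"
  where "locs w = loc w ` {h \<in> Gh. h w = w}"

lemma one_locs: "(\<lambda>b\<in>out_arcs T w. b) \<in> locs w"
proof -
  have "id \<in> {h \<in> Gh. h w = w}" using G_id by (simp del: id_apply add: id_apply[of w])
  then show ?thesis unfolding locs_def loc_id[symmetric] by (rule imageI)
qed

lemma local_group_\<Delta>:
  assumes x: "x \<in> verts T"
  shows "local_group \<Delta> (cls x) = perm_topology (out_arcs T (rep (cls x))) closure_of (locs (rep (cls x)))"
proof -
  let ?w = "rep (cls x)"
  have "(\<lambda>g. restrict (arc_map T g) (out_arcs T ?w)) ` fixator G {?w} = locs ?w"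
  proof -
    have "loc ?w (tot (verts T) g) = restrict (arc_map T g) (out_arcs T ?w)" for g
      by (auto simp: loc_def out_arcs_def fun_eq_iff)
    moreover have "{h \<in> Gh. h ?w = ?w} = tot (verts T) ` fixator G {?w}"
      using rep_cls(2)[OF x] by (auto simp: Gh_def fixator_def)
    ultimately show ?thesis by (simp add: locs_def image_image)
  qed
  then show ?thesis by (simp add: local_action_diagram_def)
qed

text \<open>The elements of the stabiliser of \<open>w\<close> whose local action lies in the
  generated group form a subgroup containing \<open>arc_stabs w\<close>, so \<open>local_gen\<close>
  makes it the whole stabiliser.\<close>

lemma generated_if_local_gen:
  assumes w: "w \<in> verts T" and lg: "local_gen w"
  shows "generated_by_point_stabilisers (out_arcs T w) (locs w)"
proof -
  interpret B: group "BijGroup (out_arcs T w)" by (rule group_BijGroup)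
  have c: "carrier (BijGroup (out_arcs T w)) = Bij (out_arcs T w)" by (simp add: BijGroup_def)
  let ?X = "out_arcs T w"
  let ?S = "\<Union>b\<in>?X. fixator (locs w) {b}"
  have S_sub: "?S \<subseteq> locs w" by (auto simp: fixator_def)
  have "generate (BijGroup ?X) ?S \<subseteq> locs w"
  proof
    fix s assume "s \<in> generate (BijGroup ?X) ?S"
    then show "s \<in> locs w"
    proof induction
      case one
      show ?case unfolding BijGroup_one by (rule one_locs)
    next
      case (incl h) then show ?case using S_sub by blast
    next
      case (inv h)
      then obtain g where "g \<in> Gh" "g w = w" "h = loc w g" using S_sub unfolding locs_def by blast
      then show ?case using loc_inv G_inv G_inv_eq by (auto simp: locs_def)
    next
      case (eng h1 h2)
      then show ?case using loc_mult by (auto simp: locs_def G_comp)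
    qed
  qed
  moreover have "locs w \<subseteq> generate (BijGroup ?X) ?S"
  proof
    fix s assume "s \<in> locs w"
    then obtain g where g: "g \<in> Gh" "g w = w" "s = loc w g" unfolding locs_def by blast
    define M where "M = {h \<in> Gh. h w = w \<and> loc w h \<in> generate (BijGroup ?X) ?S}"
    have "S_car": "?S \<subseteq> carrier (BijGroup ?X)" using S_sub loc_Bij unfolding c locs_def by blast
    have "perm_subgroup M" unfolding perm_subgroup_def
    proof (intro conjI ballI)
      show "id \<in> M" using generate.one[of "BijGroup ?X" ?S] loc_id[of w] BijGroup_one[of ?X] by (simp add: M_def)
      show "g \<circ> h \<in> M" if "g \<in> M" "h \<in> M" for g h
        using that loc_mult[of g w h] generate.eng[of "loc w g" "BijGroup ?X" ?S "loc w h"] by (simp add: M_def G_comp)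
      show "pinv g \<in> M" if "g \<in> M" for g
        using that loc_inv[of g w] B.generate_m_inv_closed[OF S_car, of "loc w g"] G_inv_eq[of g w w] by (simp add: M_def G_inv)
    qed
    moreover have "M \<subseteq> Gh" by (auto simp: M_def)
    moreover have "arc_stabs w \<subseteq> M"
    proof
      fix k assume "k \<in> arc_stabs w"
      then obtain y where k: "k \<in> Gh" "k w = w" "(w, y) \<in> adj T" "k y = y" unfolding arc_stabs_def by blast
      obtain b where b: "b \<in> arcs T" "orig T b = w" "terminus T b = y" using arc_ex[OF k(3)] by blast
      have "arc_map T k b = b" by (rule arc_eqI) (use b k arc_map_Gh[OF k(1) b(1)] in auto)
      then have "loc w k \<in> ?S" using k b by (auto simp: fixator_def locs_def loc_def out_arcs_def)
      then have "loc w k \<in> generate (BijGroup ?X) ?S" by (rule generate.incl)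
      then show "k \<in> M" using k by (simp add: M_def)
    qed
    ultimately have "g \<in> M" using lg g unfolding local_gen_def by blast
    then show "s \<in> generate (BijGroup ?X) ?S" using g by (simp add: M_def)
  qed
  ultimately show ?thesis unfolding generated_by_point_stabilisers_def by blast
qed

lemma local_gen_if_generated:
  assumes w: "(w, a) \<in> adj T" and gen: "generated_by_point_stabilisers (out_arcs T w) (locs w)"
  shows "local_gen w"
  unfolding local_gen_def
proof (intro allI impI ballI)
  let ?X = "out_arcs T w"
  let ?S = "\<Union>b\<in>?X. fixator (locs w) {b}"
  fix M g assume M: "perm_subgroup M \<and> M \<subseteq> Gh \<and> arc_stabs w \<subseteq> M" and g: "g \<in> Gh" "g w = w"
  have Mc: "id \<in> M" "\<And>g h. g \<in> M \<Longrightarrow> h \<in> M \<Longrightarrow> g \<circ> h \<in> M" "\<And>g. g \<in> M \<Longrightarrow> pinv g \<in> M"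
    using M unfolding perm_subgroup_def by auto
  have MG: "k \<in> M \<Longrightarrow> k \<in> Gh" for k using M by blast
  have arc: "k \<in> M" if "k \<in> Gh" "k w = w" "b \<in> ?X" "arc_map T k b = b" for k b
  proof -
    have b: "b \<in> arcs T" "orig T b = w" using that by (auto simp: out_arcs_def)
    have "k (terminus T b) = terminus T b" using arc_map_Gh(3)[OF that(1) b(1)] that by simp
    moreover have "(w, terminus T b) \<in> adj T" using arcD(7)[OF b(1)] b by simp
    ultimately have "k \<in> arc_stabs w" using that unfolding arc_stabs_def by blast
    then show ?thesis using M by blast
  qed
  have S_M: "\<exists>k\<in>M. k w = w \<and> s = loc w k" if s: "s \<in> ?S" for s
  proof -
    obtain b k where bk: "b \<in> ?X" "k \<in> Gh" "k w = w" "s = loc w k" "s b = b"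
      using s unfolding fixator_def locs_def by blast
    then have "arc_map T k b = b" by (simp add: loc_def)
    then show ?thesis using arc bk by blast
  qed
  have gen_M: "\<exists>k\<in>M. k w = w \<and> s = loc w k" if "s \<in> generate (BijGroup ?X) ?S" for s
    using that
  proof induction
    case one
    show ?case unfolding BijGroup_one loc_id[symmetric] using Mc(1) id_apply by metis
  next
    case (incl h) then show ?case by (rule S_M)
  next
    case (inv h)
    then obtain k where k: "k \<in> M" "k w = w" "h = loc w k" using S_M by blast
    have kG: "k \<in> Gh" and pw: "pinv k w = w" using k MG G_inv_eq by auto
    have "inv\<^bsub>BijGroup ?X\<^esub> h = loc w (pinv k)" using loc_inv[OF kG k(2)] k(3) by simp
    then show ?case using k pw Mc(3) by blast
  next
    case (eng h1 h2)
    then obtain k1 k2 where k: "k1 \<in> M" "k1 w = w" "h1 = loc w k1" "k2 \<in> M" "k2 w = w" "h2 = loc w k2" by blast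
    have "h1 \<otimes>\<^bsub>BijGroup ?X\<^esub> h2 = loc w (k1 \<circ> k2)"
      using loc_mult k MG by simp
    moreover have "(k1 \<circ> k2) w = w" using k by simp
    ultimately show ?case using Mc(2)[OF k(1,4)] by blast
  qed
  have "loc w g \<in> locs w" using g by (auto simp: locs_def)
  then obtain k where k: "k \<in> M" "k w = w" "loc w g = loc w k"
    using gen_M gen unfolding generated_by_point_stabilisers_def by metis
  \<comment> \<open>Elements with equal local action differ by one that fixes all neighbours of
    \<open>w\<close>. The neighbour \<open>a\<close> is there to put this difference into
    \<open>arc_stabs w\<close>.\<close>
  obtain b where b: "b \<in> arcs T" "orig T b = w" "terminus T b = a" using arc_ex[OF w] by blast
  have bX: "b \<in> ?X" using b by (simp add: out_arcs_def)
  have "arc_map T g b = arc_map T k b" using fun_cong[OF k(3), of b] bX by (simp add: loc_def)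
  then have "arc_map T (pinv k \<circ> g) b = b"
    using arc_map_comp[OF G_inv[OF MG[OF k(1)]] g(1) b(1)] arc_map_inv[OF MG[OF k(1)] b(1)] by simp
  moreover have "(pinv k \<circ> g) w = w" using g k MG G_inv_eq[of k w w] by simp
  ultimately have "pinv k \<circ> g \<in> M" using arc[OF _ _ bX] g G_comp G_inv MG[OF k(1)] by blast
  then have "k \<circ> (pinv k \<circ> g) \<in> M" using Mc(2) k(1) by blast
  moreover have "k \<circ> (pinv k \<circ> g) = g" using MG[OF k(1)] by (simp add: fun_eq_iff)
  ultimately show "g \<in> M" by simp
qed

lemma locs_trivial_iff:
  assumes "w \<in> verts T"
  shows "locs w = {\<lambda>b\<in>out_arcs T w. b} \<longleftrightarrow> (\<forall>g\<in>Gh. g w = w \<longrightarrow> (\<forall>y. (w, y) \<in> adj T \<longrightarrow> g y = y))"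
proof
  assume L: "locs w = {\<lambda>b\<in>out_arcs T w. b}"
  show "\<forall>g\<in>Gh. g w = w \<longrightarrow> (\<forall>y. (w, y) \<in> adj T \<longrightarrow> g y = y)"
  proof (intro ballI impI allI)
    fix g y assume g: "g \<in> Gh" "g w = w" and y: "(w, y) \<in> adj T"
    obtain b where b: "b \<in> arcs T" "orig T b = w" "terminus T b = y" using arc_ex[OF y] by blast
    have "loc w g = (\<lambda>b\<in>out_arcs T w. b)" using L g unfolding locs_def by blast
    from fun_cong[OF this, of b] have "arc_map T g b = b" using b by (simp add: loc_def out_arcs_def)
    then show "g y = y" using arc_map_Gh(3)[OF g(1) b(1)] b by simp
  qed
next
  assume R: "\<forall>g\<in>Gh. g w = w \<longrightarrow> (\<forall>y. (w, y) \<in> adj T \<longrightarrow> g y = y)"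
  have "loc w g = (\<lambda>b\<in>out_arcs T w. b)" if g: "g \<in> Gh" "g w = w" for g
  proof -
    have "arc_map T g b = b" if b: "b \<in> arcs T" "orig T b = w" for b
      by (rule arc_eqI) (use R g b arc_map_Gh[OF g(1) b(1)] arcD(7)[OF b(1)] in auto)
    then show ?thesis by (auto simp: loc_def out_arcs_def fun_eq_iff)
  qed
  then have "locs w \<subseteq> {\<lambda>b\<in>out_arcs T w. b}" unfolding locs_def by blast
  moreover note one_locs[of w]
  ultimately show "locs w = {\<lambda>b\<in>out_arcs T w. b}" by blast
qed

end

locale P_tree_group = tree_group_rep T G rep
  for T :: "('v, 'a) graph" and G :: "('v \<Rightarrow> 'v) set" and rep :: "'v set \<Rightarrow> 'v" +
  assumes closed: "closedin (aut_topology T) G"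
    and edge_indep: "(x, y) \<in> adj T \<Longrightarrow> g \<in> Gh \<Longrightarrow> g x = x \<Longrightarrow> g y = y \<Longrightarrow>
      \<exists>g'\<in>Gh. (\<forall>z\<in>half x y. g' z = g z) \<and> (\<forall>z\<in>half y x. g' z = z)"
begin

text \<open>Approximation on two points at a time gives injectivity and preservation of adjacency,
  so the limit is an automorphism and closedness in \<open>aut T\<close> applies.\<close>

lemma limit_closed:
  assumes "h ` verts T = verts T" "\<And>x. x \<notin> verts T \<Longrightarrow> h x = x"
    and lim: "\<And>F. finite F \<Longrightarrow> F \<subseteq> verts T \<Longrightarrow> \<exists>g\<in>Gh. \<forall>x\<in>F. g x = h x"
  shows "h \<in> Gh"
proof -
  let ?h = "restrict h (verts T)"
  have two: "\<exists>g\<in>Gh. g x = h x \<and> g y = h y" if "x \<in> verts T" "y \<in> verts T" for x y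
    using lim[of "{x, y}"] that by auto
  have "inj_on h (verts T)" using two G_inj by (metis (no_types, lifting) inj_onI)
  then have B: "?h \<in> Bij (verts T)" using assms(1) by (simp add: Bij_def bij_betw_def)
  have "?h \<in> aut T" unfolding aut_iff[OF T]
  proof (intro conjI B ballI)
    fix x y assume xy: "x \<in> verts T" "y \<in> verts T"
    then obtain g where "g \<in> Gh" "g x = h x" "g y = h y" using two by blast
    then show "(?h x, ?h y) \<in> adj T \<longleftrightarrow> (x, y) \<in> adj T" using G_E_iff[of g x y] xy by simp
  qed
  then have "?h \<in> G"
  proof (rule closedin_aut_limit[OF closed])
    fix F assume F: "finite F" "F \<subseteq> verts T"
    obtain g where "g \<in> G" "\<forall>x\<in>F. tot (verts T) g x = h x" using lim[OF F] unfolding Gh_def by blast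
    then have "\<forall>x\<in>F. g x = ?h x" using F by (metis restrict_apply' subsetD tot_in)
    then show "\<exists>g\<in>G. \<forall>x\<in>F. g x = ?h x" using \<open>g \<in> G\<close> by blast
  qed
  moreover have "h = tot (verts T) ?h" using assms(2) by (auto simp: tot_def fun_eq_iff)
  ultimately show ?thesis unfolding Gh_def by blast
qed

end

sublocale P_tree_group \<subseteq> P_tree_action "verts T" "adj T" Gh
  by unfold_locales (rule edge_indep limit_closed; assumption)+

section \<open>Closed local groups and the universal group\<close>

context P_tree_group
begin

text \<open>A permutation in the closure is approximated on finite sets by elements of the
  stabiliser, and \<open>local_lift\<close> realises it exactly. The functions
  \<open>\<beta>\<close> and \<open>s'\<close> translate between arcs at the representative and its
  neighbours.\<close>

lemma local_group_eq_locs: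
  assumes x: "x \<in> verts T"
  shows "local_group \<Delta> (cls x) = locs (rep (cls x))"
proof -
  let ?w = "rep (cls x)"
  let ?X = "out_arcs T ?w"
  have w: "?w \<in> verts T" by (rule rep_cls(2)[OF x])
  have sub: "locs ?w \<subseteq> Bij ?X" using loc_Bij unfolding locs_def by blast
  have "s \<in> locs ?w" if s: "s \<in> perm_topology ?X closure_of (locs ?w)" for s
  proof -
    have sB: "s \<in> Bij ?X" and sF: "\<And>F. finite F \<Longrightarrow> F \<subseteq> ?X \<Longrightarrow> \<exists>a\<in>locs ?w. \<forall>b\<in>F. a b = s b"
      using s unfolding in_perm_closure_iff[OF sub] by auto
    define \<beta> where "\<beta> y = (SOME b. b \<in> arcs T \<and> orig T b = ?w \<and> terminus T b = y)" for y
    have \<beta>: "\<beta> y \<in> ?X" "terminus T (\<beta> y) = y" if "(?w, y) \<in> adj T" for y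
    proof -
      have "\<exists>b. b \<in> arcs T \<and> orig T b = ?w \<and> terminus T b = y" using arc_ex[OF that] by blast
      from someI_ex[OF this] show "\<beta> y \<in> ?X" "terminus T (\<beta> y) = y" unfolding \<beta>_def out_arcs_def by auto
    qed
    have \<beta>t: "\<beta> (terminus T b) = b" "(?w, terminus T b) \<in> adj T" if "b \<in> ?X" for b
    proof -
      show e: "(?w, terminus T b) \<in> adj T" using arcD(7)[of b] that by (auto simp: out_arcs_def)
      show "\<beta> (terminus T b) = b" using arc_eqI[of "\<beta> (terminus T b)" b] \<beta>[OF e] that by (simp add: out_arcs_def)
    qed
    define s' where "s' y = terminus T (s (\<beta> y))" for y
    have "\<exists>g\<in>Gh. g ?w = ?w \<and> (\<forall>y. (?w, y) \<in> adj T \<longrightarrow> g y = s' y)"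
    proof (rule local_lift[OF w])
      show "s' ` {y. (?w, y) \<in> adj T} = {y. (?w, y) \<in> adj T}"
      proof (intro equalityI subsetI)
        fix z assume "z \<in> s' ` {y. (?w, y) \<in> adj T}"
        then show "z \<in> {y. (?w, y) \<in> adj T}" using \<beta>t(2)[OF BijD(5)[OF sB \<beta>(1)]] by (auto simp: s'_def)
      next
        fix z assume z: "z \<in> {y. (?w, y) \<in> adj T}"
        then obtain b where b: "b \<in> ?X" "s b = \<beta> z" using BijD(2)[OF sB] \<beta>(1)[of z] by force
        then have "s' (terminus T b) = z" using \<beta>t[OF b(1)] \<beta>(2)[of z] z by (simp add: s'_def)
        then show "z \<in> s' ` {y. (?w, y) \<in> adj T}" using \<beta>t(2)[OF b(1)] by blast
      qed
      fix Y assume Y: "finite Y" "\<And>y. y \<in> Y \<Longrightarrow> (?w, y) \<in> adj T"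
      then obtain a where a: "a \<in> locs ?w" "\<forall>b\<in>\<beta> ` Y. a b = s b" using sF[of "\<beta> ` Y"] \<beta>(1) by blast
      then obtain k where k: "k \<in> Gh" "k ?w = ?w" "a = loc ?w k" unfolding locs_def by blast
      have "k y = s' y" if "y \<in> Y" for y
      proof -
        have b: "\<beta> y \<in> ?X" "terminus T (\<beta> y) = y" using \<beta> Y that by auto
        have "a (\<beta> y) = s (\<beta> y)" using a(2) that by blast
        then have "arc_map T k (\<beta> y) = s (\<beta> y)" using k(3) b by (simp add: loc_def)
        then show ?thesis using arc_map_Gh(3)[OF k(1), of "\<beta> y"] b by (simp add: s'_def out_arcs_def)
      qed
      then show "\<exists>k\<in>Gh. k ?w = ?w \<and> (\<forall>y\<in>Y. k y = s' y)" using k by blast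
    qed
    then obtain g where g: "g \<in> Gh" "g ?w = ?w" "\<And>y. (?w, y) \<in> adj T \<Longrightarrow> g y = s' y" by blast
    have "loc ?w g = s"
    proof (rule extensionalityI[of _ ?X])
      fix b assume b: "b \<in> ?X"
      then have bT: "b \<in> arcs T" "orig T b = ?w" by (auto simp: out_arcs_def)
      have sb: "s b \<in> arcs T" "orig T (s b) = ?w" using BijD(5)[OF sB b] by (auto simp: out_arcs_def)
      have "arc_map T g b = s b"
        by (rule arc_eqI)
          (use arc_map_Gh[OF g(1) bT(1)] bT sb g(2) g(3)[OF \<beta>t(2)[OF b]] \<beta>t(1)[OF b] in \<open>auto simp: s'_def\<close>)
      then show "loc ?w g b = s b" using b by (simp add: loc_def)
    qed (use BijD(1)[OF sB] in \<open>auto simp: loc_def\<close>)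
    then show ?thesis using g unfolding locs_def by blast
  qed
  moreover have "locs ?w \<subseteq> perm_topology ?X closure_of (locs ?w)"
    using sub in_perm_closure_iff[OF sub] by blast
  ultimately show ?thesis using local_group_\<Delta>[OF x] by blast
qed

text \<open>Labelling the arcs at \<open>x\<close> by an element of \<open>G\<close> that maps \<open>x\<close> to its representative makes the
  local actions of the elements of \<open>G\<close> elements of the local groups.\<close>

theorem eq_universal_group:
  "\<exists>\<pi>V \<pi>A \<L>. diagram_tree \<Delta> T \<pi>V \<pi>A \<L> \<and> G = universal_group \<Delta> T \<pi>V \<pi>A \<L>"
proof -
  define \<gamma> where "\<gamma> x = (SOME h. h \<in> Gh \<and> h x = rep (cls x))" for x
  have \<gamma>: "\<gamma> x \<in> Gh" "\<gamma> x x = rep (cls x)" if x: "x \<in> verts T" for x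
  proof -
    have "\<exists>h. h \<in> Gh \<and> h x = rep (cls x)" using rep_cls(1)[OF x] by metis
    from someI_ex[OF this] show "\<gamma> x \<in> Gh" "\<gamma> x x = rep (cls x)" unfolding \<gamma>_def by auto
  qed
  define \<L> where "\<L> b = arc_map T (\<gamma> (orig T b)) b" for b
  have \<L>: "\<L> b \<in> arcs T" "orig T (\<L> b) = rep (cls (orig T b))" "acls (\<L> b) = acls b"
    "terminus T (\<L> b) = \<gamma> (orig T b) (terminus T b)" if b: "b \<in> arcs T" for b
    using \<gamma>[OF arcD(1)[OF b]] arc_map_Gh[OF _ b] acls_G[OF b] by (auto simp: \<L>_def)
  have \<L>_back: "arc_map T (pinv (\<gamma> v)) c \<in> out_arcs T v" "\<L> (arc_map T (pinv (\<gamma> v)) c) = c"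
    "acls (arc_map T (pinv (\<gamma> v)) c) = acls c" if v: "v \<in> verts T" and c: "c \<in> out_arcs T (rep (cls v))" for v c
  proof -
    note g = \<gamma>[OF v]
    have cT: "c \<in> arcs T" "orig T c = rep (cls v)" using c by (auto simp: out_arcs_def)
    have "pinv (\<gamma> v) (rep (cls v)) = v" using g G_inv_eq by simp
    then have o: "orig T (arc_map T (pinv (\<gamma> v)) c) = v" "arc_map T (pinv (\<gamma> v)) c \<in> arcs T"
      using arc_map_Gh[OF G_inv[OF g(1)] cT(1)] cT by auto
    then show "arc_map T (pinv (\<gamma> v)) c \<in> out_arcs T v" by (simp add: out_arcs_def)
    show "\<L> (arc_map T (pinv (\<gamma> v)) c) = c"
      using arc_map_inv[OF G_inv[OF g(1)] cT(1)] o g by (simp add: \<L>_def G_inv_inv)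
    show "acls (arc_map T (pinv (\<gamma> v)) c) = acls c" using acls_G[OF cT(1) G_inv[OF g(1)]] .
  qed
  have \<L>_inj: "inj_on \<L> (out_arcs T v)" if v: "v \<in> verts T" for v
  proof (rule inj_onI)
    fix b c assume "b \<in> out_arcs T v" "c \<in> out_arcs T v" "\<L> b = \<L> c"
    then show "b = c" using arc_map_inv[OF \<gamma>(1)[OF v]] unfolding out_arcs_def \<L>_def
      by (metis (mono_tags, lifting) mem_Collect_eq)
  qed
  have tree: "diagram_tree \<Delta> T cls acls \<L>" unfolding diagram_tree_def base_\<Delta>
  proof (intro conjI ballI)
    show "is_tree T" by (rule T)
    show "surj_graph_hom T \<Gamma> cls acls"
      unfolding surj_graph_hom_def by (auto simp: verts_\<Gamma> arcs_\<Gamma> orig_\<Gamma> arev_\<Gamma>)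
    have "\<L> b \<in> colours \<Delta> (acls b)" if "b \<in> arcs T" for b
      using \<L>[OF that] colours_\<Delta>[OF that] by simp
    then show "\<L> \<in> arcs T \<rightarrow> (\<Union>a\<in>arcs \<Gamma>. colours \<Delta> a)" by (auto simp: arcs_\<Gamma>)
    fix v a assume v: "v \<in> verts T" and a: "a \<in> out_arcs \<Gamma> (cls v)"
    then obtain b0 where b0: "b0 \<in> arcs T" "a = acls b0" "cls (orig T b0) = cls v"
      by (auto simp: out_arcs_def arcs_\<Gamma> orig_\<Gamma>)
    have "\<L> ` {b \<in> out_arcs T v. acls b = a} = colours \<Delta> a"
    proof (intro equalityI subsetI)
      fix c assume "c \<in> \<L> ` {b \<in> out_arcs T v. acls b = a}"
      then show "c \<in> colours \<Delta> a" using \<L> colours_\<Delta>[OF b0(1)] b0 by (auto simp: out_arcs_def)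
    next
      fix c assume "c \<in> colours \<Delta> a"
      then have c: "c \<in> out_arcs T (rep (cls v))" "acls c = a" using colours_\<Delta>[OF b0(1)] b0 by (auto simp: out_arcs_def)
      then show "c \<in> \<L> ` {b \<in> out_arcs T v. acls b = a}" using \<L>_back[OF v c(1)]
        by (intro image_eqI[of _ _ "arc_map T (pinv (\<gamma> v)) c"]) auto
    qed
    then show "bij_betw \<L> {b \<in> out_arcs T v. acls b = a} (colours \<Delta> a)"
      using inj_on_subset[OF \<L>_inj[OF v]] by (auto simp: bij_betw_def)
  qed
  have inv_\<L>: "inv_into (out_arcs T v) \<L> c = arc_map T (pinv (\<gamma> v)) c"
    if "v \<in> verts T" "c \<in> out_arcs T (rep (cls v))" for v c
    using inv_into_f_f[OF \<L>_inj[OF that(1)] \<L>_back(1)[OF that]] \<L>_back(2)[OF that] by simp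
  have "G \<subseteq> universal_group \<Delta> T cls acls \<L>"
  proof
    fix g assume g: "g \<in> G"
    define h where "h = tot (verts T) g"
    have h: "h \<in> Gh" using g by (simp add: Gh_def h_def)
    have hg: "v \<in> verts T \<Longrightarrow> g v = h v" "b \<in> arcs T \<Longrightarrow> arc_map T g b = arc_map T h b" for v b
      by (simp_all add: h_def)
    show "g \<in> universal_group \<Delta> T cls acls \<L>" unfolding universal_group_def
    proof (intro CollectI conjI ballI)
      show "g \<in> aut T" using G_aut g by blast
      show "cls (g v) = cls v" if "v \<in> verts T" for v using cls_G[OF that h] hg that by simp
      show "acls (arc_map T g b) = acls b" if "b \<in> arcs T" for b using acls_G[OF that h] hg that by simp
      fix v assume v: "v \<in> verts T"
      have hv: "h v \<in> verts T" "cls (h v) = cls v" using v h cls_G by auto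
      let ?w = "rep (cls v)"
      \<comment> \<open>\<open>k\<close> is \<open>h\<close> read through the labels at
        \<open>v\<close> and at \<open>h v\<close>. These vertices have the same representative, so
        \<open>k\<close> fixes it and acts there as the local action of \<open>g\<close> at
        \<open>v\<close>.\<close>
      define k where "k = \<gamma> (h v) \<circ> (h \<circ> pinv (\<gamma> v))"
      have pv: "pinv (\<gamma> v) ?w = v" using \<gamma>[OF v] G_inv_eq by simp
      have k: "k \<in> Gh" "k ?w = ?w"
        using \<gamma>[OF v] \<gamma>[OF hv(1)] h hv(2) pv by (auto simp: k_def G_comp G_inv)
      have "local_action \<Delta> T cls \<L> v g = loc ?w k"
        unfolding local_action_def colours_at_\<Delta>[OF v] loc_def
      proof (rule restrict_ext)
        fix c assume c: "c \<in> out_arcs T ?w"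
        then have cT: "c \<in> arcs T" by (simp add: out_arcs_def)
        note b = \<L>_back[OF v c]
        let ?b = "arc_map T (pinv (\<gamma> v)) c"
        have bT: "?b \<in> arcs T" "orig T ?b = v" using b(1) by (auto simp: out_arcs_def)
        have "\<L> (arc_map T g ?b) = arc_map T (\<gamma> (h v)) (arc_map T h ?b)"
          using hg(2)[OF bT(1)] arc_map_Gh[OF h bT(1)] bT by (simp add: \<L>_def)
        also have "\<dots> = arc_map T k c"
          using arc_map_comp[OF \<gamma>(1)[OF hv(1)] G_comp[OF h G_inv[OF \<gamma>(1)[OF v]]] cT]
            arc_map_comp[OF h G_inv[OF \<gamma>(1)[OF v]] cT] by (simp add: k_def)
        finally show "\<L> (arc_map T g (inv_into (out_arcs T v) \<L> c)) = arc_map T k c"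
          using inv_\<L>[OF v c] by simp
      qed
      then show "local_action \<Delta> T cls \<L> v g \<in> local_group \<Delta> (cls v)"
        using k local_group_eq_locs[OF v] unfolding locs_def by auto
    qed
  qed
  moreover have "universal_group \<Delta> T cls acls \<L> \<subseteq> G"
  proof
    fix g assume "g \<in> universal_group \<Delta> T cls acls \<L>"
    then have g: "g \<in> aut T" "\<And>v. v \<in> verts T \<Longrightarrow> cls (g v) = cls v"
      "\<And>v. v \<in> verts T \<Longrightarrow> local_action \<Delta> T cls \<L> v g \<in> local_group \<Delta> (cls v)"
      unfolding universal_group_def by auto
    have gB: "g \<in> Bij (verts T)" using g(1) by (simp add: aut_def)
    have gE: "(g x, g y) \<in> adj T" if "(x, y) \<in> adj T" for x y
      using g(1) E_V[OF that] that unfolding aut_iff[OF T] by blast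
    have "tot (verts T) g \<in> Gh"
    proof (rule locally_in_G)
      show "tot (verts T) g ` verts T = verts T" using BijD(2)[OF gB] by simp
      show "tot (verts T) g x = x" if "x \<notin> verts T" for x using that by simp
      fix v Y assume v: "v \<in> verts T" and Y: "\<And>y. y \<in> Y \<Longrightarrow> (v, y) \<in> adj T"
      let ?w = "rep (cls v)"
      have gv: "g v \<in> verts T" "cls (g v) = cls v" using BijD(5)[OF gB v] g(2)[OF v] by auto
      obtain k where k: "k \<in> Gh" "k ?w = ?w" "local_action \<Delta> T cls \<L> v g = loc ?w k"
        using g(3)[OF v] local_group_eq_locs[OF v] unfolding locs_def by auto
      \<comment> \<open>Removing the labels from the element \<open>k\<close> that realises the
        local action gives an element of \<open>G\<close> that agrees with \<open>g\<close> on
        \<open>v\<close> and its neighbours, as \<open>locally_in_G\<close> asks.\<close>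
      define m where "m = pinv (\<gamma> (g v)) \<circ> (k \<circ> \<gamma> v)"
      have mG: "m \<in> Gh" using k \<gamma> v gv by (simp add: m_def G_comp G_inv)
      have "m v = g v" using k \<gamma>[OF v] \<gamma>[OF gv(1)] gv(2) G_inv_eq[of "\<gamma> (g v)"] by (simp add: m_def)
      moreover have "m y = g y" if y: "(v, y) \<in> adj T" for y
      proof -
        obtain b where b: "b \<in> arcs T" "orig T b = v" "terminus T b = y" using arc_ex[OF y] by blast
        have bX: "\<L> b \<in> out_arcs T ?w" "b \<in> out_arcs T v" using \<L>[OF b(1)] b by (auto simp: out_arcs_def)
        note gb = arc_map_props[OF T b(1) gE[OF arcD(7)[OF b(1)]]]
        have "inv_into (out_arcs T v) \<L> (\<L> b) = b" using inv_into_f_f[OF \<L>_inj[OF v] bX(2)] .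
        then have "\<L> (arc_map T g b) = arc_map T k (\<L> b)"
          using fun_cong[OF k(3), of "\<L> b"] bX unfolding local_action_def colours_at_\<Delta>[OF v] loc_def by simp
        then have "terminus T (\<L> (arc_map T g b)) = k (terminus T (\<L> b))"
          using arc_map_Gh(3)[OF k(1) \<L>(1)[OF b(1)]] by simp
        then have "\<gamma> (g v) (g y) = k (\<gamma> v y)" using \<L>(4)[OF gb(1)] \<L>(4)[OF b(1)] gb b by simp
        then show ?thesis using G_inv_eq[OF \<gamma>(1)[OF gv(1)]] by (simp add: m_def)
      qed
      ultimately show "\<exists>h\<in>Gh. h v = tot (verts T) g v \<and> (\<forall>y\<in>Y. h y = tot (verts T) g y)"
        using mG v Y E_V(2)[OF Y] by (intro bexI[of _ m]) auto
    qed
    then obtain g' where "g' \<in> G" "tot (verts T) g = tot (verts T) g'" unfolding Gh_def by blast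
    then show "g \<in> G" using tot_inj[OF BijD(1)[OF gB], of g'] BijD(1)[OF G_Bij] by blast
  qed
  ultimately show ?thesis using tree by blast
qed

end

section \<open>Invariant subtrees\<close>

text \<open>A half-tree of \<open>T'\<close> stays on its side of the edge in \<open>T\<close> by
  \<open>half_crossing\<close>. For the two orientations of the edge this gives both directions,
  since the sides are complementary.\<close>

lemma subtree_half:
  assumes T: "is_tree T" and T': "is_tree T'" and sub: "adj T' \<subseteq> adj T"
    and e: "(x, y) \<in> adj T'" and z: "z \<in> verts T'"
  shows "z \<in> tree_rel.half (verts T') (adj T') x y \<longleftrightarrow> z \<in> tree_rel.half (verts T) (adj T) x y"
proof -
  interpret R: tree_rel "verts T" "adj T" by (rule tree_rel_adj[OF T])
  interpret S: tree_rel "verts T'" "adj T'" by (rule tree_rel_adj[OF T'])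
  have *: "w \<in> R.half a b" if ab: "(a, b) \<in> adj T'" and w: "w \<in> S.half a b" for w a b
    using ab w
  proof (induction rule: S.half_induct)
    case root
    then show ?case using R.half_ends ab sub by blast
  next
    case (step u w)
    then show ?case using R.half_crossing[of a b u w] S.half_ends[OF ab] ab sub by blast
  qed
  show ?thesis
  proof
    show "z \<in> R.half x y" if "z \<in> S.half x y" by (rule *[OF e that])
    show "z \<in> S.half x y" if zR: "z \<in> R.half x y"
    proof (rule ccontr)
      assume "z \<notin> S.half x y"
      then have "z \<in> S.half y x" using S.half_iff[OF e z] by blast
      then have "z \<in> R.half y x" by (rule *[OF S.E_sym[OF e]])
      then show False using zR R.half_compl[of x y] sub e by blast
    qed
  qed
qed

text \<open>For the path with the vertices \<open>x\<close> and \<open>y\<close>, the fibres of the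
  projection contain the two half-trees, and (P) realises the pair consisting of \<open>g\<close>
  over \<open>y\<close> and the identity over \<open>x\<close>.\<close>

lemma edge_independence:
  assumes T: "is_tree T" and P: "property_P T G" and one: "(\<lambda>v\<in>verts T. v) \<in> G"
    and e: "(x, y) \<in> adj T" and g: "g \<in> G" "g x = x" "g y = y"
  shows "\<exists>g'\<in>G. (\<forall>z\<in>tree_rel.half (verts T) (adj T) x y. g' z = g z) \<and>
    (\<forall>z\<in>tree_rel.half (verts T) (adj T) y x. g' z = z)"
proof -
  interpret R: tree_rel "verts T" "adj T" by (rule tree_rel_adj[OF T])
  have V: "x \<in> verts T" "y \<in> verts T" "x \<noteq> y" using R.E_V[OF e] e R.E_irrefl by auto
  define p :: "int \<Rightarrow> 'a" where "p i = (if i = 0 then x else y)" for i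
  have L: "p ` {0, 1} = {x, y}" by (auto simp: p_def)
  have "simple_path T {0, 1} p"
    unfolding simple_path_def L using V e by (auto simp: p_def inj_on_def)
  then have P': "(\<lambda>g. \<lambda>z\<in>{x, y}. restrict g (proj_fibre T {x, y} z)) ` fixator G {x, y} =
      (\<Pi>\<^sub>E z\<in>{x, y}. (\<lambda>g. restrict g (proj_fibre T {x, y} z)) ` fixator G {x, y})"
    using P unfolding property_P_def L[symmetric] Let_def by blast
  have dist: "graph_dist T = R.dist" by (simp add: fun_eq_iff graph_dist_def R.dist_def)
  have cl: "closest_vertex T {x, y} z = (if R.dist z y < R.dist z x then y else x)"
    if "R.dist z y \<noteq> R.dist z x" for z
  proof -
    have "arg_min_on (R.dist z) {x, y} \<in> {x, y}"
      "\<not> (\<exists>w\<in>{x, y}. R.dist z w < R.dist z (arg_min_on (R.dist z) {x, y}))"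
      using arg_min_if_finite[of "{x, y}" "R.dist z"] by auto
    then show ?thesis using that unfolding closest_vertex_def dist by fastforce
  qed
  have half_y: "R.half x y \<subseteq> proj_fibre T {x, y} y"
    using cl by (auto simp: proj_fibre_def R.half_def)
  have half_x: "R.half y x \<subseteq> proj_fibre T {x, y} x"
    using cl by (auto simp: proj_fibre_def R.half_def)
  define f where "f = (\<lambda>z\<in>{x, y}. restrict (if z = y then g else (\<lambda>v\<in>verts T. v)) (proj_fibre T {x, y} z))"
  have "g \<in> fixator G {x, y}" "(\<lambda>v\<in>verts T. v) \<in> fixator G {x, y}" using g one V by (auto simp: fixator_def)
  then have "f \<in> (\<Pi>\<^sub>E z\<in>{x, y}. (\<lambda>g. restrict g (proj_fibre T {x, y} z)) ` fixator G {x, y})"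
    unfolding f_def restrict_PiE_iff by (intro ballI imageI) (simp only: split: if_split, simp)
  then have "f \<in> (\<lambda>g. \<lambda>z\<in>{x, y}. restrict g (proj_fibre T {x, y} z)) ` fixator G {x, y}"
    unfolding P' .
  then obtain g' where g': "g' \<in> fixator G {x, y}" "f = (\<lambda>z\<in>{x, y}. restrict g' (proj_fibre T {x, y} z))"
    by blast
  have "restrict g (proj_fibre T {x, y} y) = restrict g' (proj_fibre T {x, y} y)"
    using fun_cong[OF g'(2), of y] by (simp add: f_def)
  then have "g' z = g z" if "z \<in> R.half x y" for z
    using that half_y by (metis restrict_apply' subsetD)
  moreover have fx: "restrict (\<lambda>v\<in>verts T. v) (proj_fibre T {x, y} x) = restrict g' (proj_fibre T {x, y} x)"
    using fun_cong[OF g'(2), of x] V by (simp add: f_def)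
  have "g' z = z" if "z \<in> R.half y x" for z
    using fun_cong[OF fx, of z] that half_x R.half_sub by (auto simp: subset_iff)
  ultimately show ?thesis using g' unfolding fixator_def by blast
qed

locale closed_setting =
  fixes T :: "('v, 'a) graph" and G :: "('v \<Rightarrow> 'v) set" and rep :: "'v set \<Rightarrow> 'v"
  assumes tree: "is_tree T"
    and subgroup: "subgroup G (aut_group T)"
    and P_closed: "P_closed T G"
    and strong: "strongly_closed T G"
    and rep: "\<And>S. S \<noteq> {} \<Longrightarrow> rep S \<in> S"
begin

sublocale A: tree_group T G by (rule tree_group.intro[OF tree subgroup])

abbreviation GP where "GP \<equiv> perm_group (verts T) G"

lemma group_GP: "group GP"
  unfolding perm_group_def
  by (rule subgroup.subgroup_is_group[OF A.subgroup_G_BijGroup group_BijGroup])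

lemma mult_GP: "g \<in> G \<Longrightarrow> h \<in> G \<Longrightarrow> g \<otimes>\<^bsub>GP\<^esub> h = compose (verts T) g h"
  using BijGroup_mult[OF A.G_Bij A.G_Bij] by (simp add: perm_group_def)

lemma one_GP: "\<one>\<^bsub>GP\<^esub> = (\<lambda>v\<in>verts T. v)"
  by (simp add: perm_group_def BijGroup_def)

lemma carrier_GP [simp]: "carrier GP = G"
  by (simp add: perm_group_def)

lemma one_G: "(\<lambda>v\<in>verts T. v) \<in> G"
  using group.is_monoid[OF group_GP] monoid.one_closed[of GP] one_GP by simp

lemma inv_GP: assumes "g \<in> G"
  shows "inv\<^bsub>GP\<^esub> g \<in> G" "x \<in> verts T \<Longrightarrow> (inv\<^bsub>GP\<^esub> g) (g x) = x" "x \<in> verts T \<Longrightarrow> g ((inv\<^bsub>GP\<^esub> g) x) = x"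
proof -
  interpret group GP by (rule group_GP)
  show i: "inv\<^bsub>GP\<^esub> g \<in> G" using inv_closed[of g] assms by simp
  have "compose (verts T) (inv\<^bsub>GP\<^esub> g) g = (\<lambda>v\<in>verts T. v)" "compose (verts T) g (inv\<^bsub>GP\<^esub> g) = (\<lambda>v\<in>verts T. v)"
    using l_inv[of g] r_inv[of g] mult_GP assms i one_GP by auto
  then show "x \<in> verts T \<Longrightarrow> (inv\<^bsub>GP\<^esub> g) (g x) = x" "x \<in> verts T \<Longrightarrow> g ((inv\<^bsub>GP\<^esub> g) x) = x"
    by (metis compose_eq restrict_apply')+
qed

lemma G_eqI: "g \<in> G \<Longrightarrow> h \<in> G \<Longrightarrow> (\<And>x. x \<in> verts T \<Longrightarrow> g x = h x) \<Longrightarrow> g = h"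
  using BijD(1)[OF A.G_Bij] by (metis extensionalityI)

lemma edge_indep:
  assumes "(x, y) \<in> adj T" "g \<in> G" "g x = x" "g y = y"
  shows "\<exists>g'\<in>G. (\<forall>z\<in>A.half x y. g' z = g z) \<and> (\<forall>z\<in>A.half y x. g' z = z)"
  using edge_independence[OF tree _ one_G assms] P_closed unfolding P_closed_def by blast

end

locale invariant_setting = closed_setting T G rep
  for T :: "('v, 'a) graph" and G :: "('v \<Rightarrow> 'v) set" and rep :: "'v set \<Rightarrow> 'v" +
  fixes T' :: "('v, 'a) graph"
  assumes invariant: "invariant_subtree T G T'"
begin

lemma sub: "is_graph T'" "verts T' \<subseteq> verts T" "arcs T' \<subseteq> arcs T" "orig T' = orig T" "arev T' = arev T"
    "verts T' \<noteq> {}" "connected_graph T'"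
  and G_verts': "g \<in> G \<Longrightarrow> g ` verts T' = verts T'" and G_arcs': "g \<in> G \<Longrightarrow> arc_map T g ` arcs T' = arcs T'"
  using invariant unfolding invariant_subtree_def subtree_def subgraph_def by auto

lemma terminus' : "terminus T' = terminus T"
  using sub by (simp add: terminus_def fun_eq_iff)

lemma adj_sub: "adj T' \<subseteq> adj T"
  using sub terminus' unfolding adj_def by auto

lemma tree': "is_tree T'"
proof -
  note D = is_treeD[OF tree]
  have "\<not> has_loop T'" using D(4) sub terminus' unfolding has_loop_def by auto
  moreover have "\<not> has_multiple_edge T'" using D(5) sub terminus' unfolding has_multiple_edge_def by (metis subsetD)
  moreover have "\<not> has_cycle T'" using D(6) adj_sub unfolding has_cycle_def by blast
  ultimately show ?thesis unfolding is_tree_def using sub by blast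
qed

abbreviation H where "H \<equiv> induced_on T' G"

lemma tot_H: "tot (verts T') ` H = tot (verts T') ` G"
  by (simp add: induced_on_def image_image)

lemma G_verts'_mem: "g \<in> G \<Longrightarrow> x \<in> verts T' \<Longrightarrow> g x \<in> verts T'"
  using G_verts' by blast

lemma subgroup_H: "subgroup H (aut_group T')"
  unfolding subgroup_aut_group_iff[OF tree'] subgroup_BijGroup_iff tot_H
proof (intro conjI)
  show aut: "H \<subseteq> aut T'"
  proof
    fix h assume "h \<in> H"
    then obtain g where g: "g \<in> G" "h = restrict g (verts T')" unfolding induced_on_def by blast
    have inj: "inj_on g (verts T)" using BijD(3)[OF A.G_Bij[OF g(1)]] .
    show "h \<in> aut T'" unfolding aut_iff[OF tree']
    proof (intro conjI ballI)
      have "bij_betw g (verts T') (verts T')"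
        using G_verts'[OF g(1)] inj_on_subset[OF inj sub(2)] by (simp add: bij_betw_def)
      then show "h \<in> Bij (verts T')" using g(2) by (simp add: Bij_def cong: bij_betw_cong)
      fix x y assume xy: "x \<in> verts T'" "y \<in> verts T'"
      have map: "orig T (arc_map T g a) = g (orig T a)" "terminus T (arc_map T g a) = g (terminus T a)"
        if "a \<in> arcs T" for a
        using A.arc_map_Gh[of "tot (verts T) g" a] that g(1) A.arcD(1,4)[OF that] by (simp_all add: A.Gh_def)
      have "(g x, g y) \<in> adj T' \<longleftrightarrow> (x, y) \<in> adj T'"
      proof
        assume "(x, y) \<in> adj T'"
        then obtain a where a: "a \<in> arcs T'" "x = orig T a" "y = terminus T a"
          unfolding adj_def sub(4) terminus' by blast
        have "arc_map T g a \<in> arcs T'" using G_arcs'[OF g(1)] a(1) by blast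
        moreover have "g x = orig T (arc_map T g a)" "g y = terminus T (arc_map T g a)"
          using map[of a] a sub(3) by auto
        ultimately show "(g x, g y) \<in> adj T'" unfolding adj_def sub(4) terminus' by blast
      next
        assume "(g x, g y) \<in> adj T'"
        then obtain b where b: "b \<in> arcs T'" "g x = orig T b" "g y = terminus T b"
          unfolding adj_def sub(4) terminus' by blast
        then obtain a where a: "a \<in> arcs T'" "b = arc_map T g a" using G_arcs'[OF g(1)] by blast
        have aT: "a \<in> arcs T" using a sub(3) by blast
        then have "g x = g (orig T a)" "g y = g (terminus T a)" using a b map by auto
        then have "x = orig T a" "y = terminus T a"
          using inj_onD[OF inj] xy sub(2) A.arcD(1,4)[OF aT] by blast+
        then show "(x, y) \<in> adj T'" unfolding adj_def sub(4) terminus' using a by blast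
      qed
      then show "(h x, h y) \<in> adj T' \<longleftrightarrow> (x, y) \<in> adj T'" using g xy by simp
    qed
  qed
  show "H \<subseteq> Bij (verts T')" using aut unfolding aut_def by blast
  show "perm_subgroup (tot (verts T') ` G)" unfolding perm_subgroup_def
  proof (intro conjI ballI)
    have "tot (verts T') (\<lambda>v\<in>verts T. v) = id" using sub(2) by (auto simp: tot_def fun_eq_iff)
    then show "id \<in> tot (verts T') ` G" using one_G by (metis imageI)
  next
    fix a b assume "a \<in> tot (verts T') ` G" "b \<in> tot (verts T') ` G"
    then obtain g h where gh: "g \<in> G" "a = tot (verts T') g" "h \<in> G" "b = tot (verts T') h" by blast
    have "compose (verts T) g h \<in> G"
      using monoid.m_closed[OF group.is_monoid[OF group_GP], of g h] mult_GP gh by simp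
    moreover have "tot (verts T') (compose (verts T) g h) = a \<circ> b"
      using gh G_verts'_mem[of h] sub(2) by (auto simp: tot_def fun_eq_iff compose_def)
    ultimately show "a \<circ> b \<in> tot (verts T') ` G" by (metis imageI)
  next
    fix a assume "a \<in> tot (verts T') ` G"
    then obtain g where g: "g \<in> G" "a = tot (verts T') g" by blast
    note i = inv_GP[OF g(1)]
    have "pinv a = tot (verts T') (inv\<^bsub>GP\<^esub> g)"
    proof (rule inv_unique_comp)
      show "a \<circ> tot (verts T') (inv\<^bsub>GP\<^esub> g) = id" "tot (verts T') (inv\<^bsub>GP\<^esub> g) \<circ> a = id"
        using g i(2,3) G_verts'_mem[OF i(1)] G_verts'_mem[OF g(1)] sub(2) by (auto simp: tot_def fun_eq_iff)
    qed
    then show "pinv a \<in> tot (verts T') ` G" using i(1) by simp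
  qed
qed

lemma half': "(x, y) \<in> adj T' \<Longrightarrow> z \<in> verts T' \<Longrightarrow>
    z \<in> tree_rel.half (verts T') (adj T') x y \<longleftrightarrow> z \<in> A.half x y"
  by (rule subtree_half[OF tree tree' adj_sub])

text \<open>Strong closedness provides that the induced group is closed. Independence across an edge
  passes to \<open>T'\<close> by restriction, because half-trees of \<open>T'\<close> are cut out by
  those of \<open>T\<close>.\<close>

sublocale S: P_tree_group T' H rep
proof -
  interpret S0: tree_group T' H by (rule tree_group.intro[OF tree' subgroup_H])
  show "P_tree_group T' H rep"
  proof (unfold_locales, rule rep, assumption)
    show "closedin (aut_topology T') H" using strong invariant unfolding strongly_closed_def by blast
    fix x y g assume e: "(x, y) \<in> adj T'" and g: "g \<in> S0.Gh" "g x = x" "g y = y"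
    have V: "x \<in> verts T'" "y \<in> verts T'" using S0.E_V[OF e] by auto
    obtain k where k: "k \<in> G" "g = tot (verts T') k" using g(1) unfolding S0.Gh_def tot_H by blast
    then have "k x = x" "k y = y" using g V by auto
    then obtain k' where k': "k' \<in> G" "\<forall>z\<in>A.half x y. k' z = k z" "\<forall>z\<in>A.half y x. k' z = z"
      using edge_indep[OF _ k(1)] e adj_sub by blast
    have "tot (verts T') k' \<in> S0.Gh" using k'(1) unfolding S0.Gh_def tot_H by blast
    moreover have "tot (verts T') k' z = g z" if "z \<in> S0.half x y" for z
    proof -
      have "z \<in> verts T'" using that S0.half_sub by blast
      then show ?thesis using half'[OF e, of z] k'(2) k(2) that by simp
    qed
    moreover have "tot (verts T') k' z = z" if "z \<in> S0.half y x" for z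
    proof -
      have "z \<in> verts T'" using that S0.half_sub by blast
      then show ?thesis using half'[OF S0.E_sym[OF e], of z] k'(3) that by simp
    qed
    ultimately show "\<exists>g'\<in>S0.Gh. (\<forall>z\<in>S0.half x y. g' z = g z) \<and> (\<forall>z\<in>S0.half y x. g' z = z)" by blast
  qed
qed

lemma SGh: "S.Gh = tot (verts T') ` G"
  by (simp add: S.Gh_def tot_H)

lemma tot_mult: "g \<in> G \<Longrightarrow> h \<in> G \<Longrightarrow> tot (verts T') (g \<otimes>\<^bsub>GP\<^esub> h) = tot (verts T') g \<circ> tot (verts T') h"
  using mult_GP[of g h] G_verts'_mem[of h] sub(2) by (auto simp: tot_def fun_eq_iff compose_def)

lemma tot_one: "tot (verts T') \<one>\<^bsub>GP\<^esub> = id"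
  using sub(2) by (auto simp: one_GP tot_def fun_eq_iff)

lemma tot_inv: assumes "g \<in> G" shows "tot (verts T') (inv\<^bsub>GP\<^esub> g) = pinv (tot (verts T') g)"
proof -
  interpret group GP by (rule group_GP)
  have i: "inv\<^bsub>GP\<^esub> g \<in> G" using inv_closed[of g] assms by simp
  have "tot (verts T') g \<circ> tot (verts T') (inv\<^bsub>GP\<^esub> g) = id" "tot (verts T') (inv\<^bsub>GP\<^esub> g) \<circ> tot (verts T') g = id"
    using tot_mult[OF assms i] tot_mult[OF i assms] tot_one r_inv[of g] l_inv[of g] assms by auto
  then show ?thesis using inv_unique_comp by metis
qed

lemma normal_iff: "N \<lhd> GP \<longleftrightarrow> subgroup N GP \<and> (\<forall>g\<in>G. \<forall>n\<in>N. g \<otimes>\<^bsub>GP\<^esub> n \<otimes>\<^bsub>GP\<^esub> inv\<^bsub>GP\<^esub> g \<in> N)"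
  using group.normal_inv_iff[OF group_GP, of N] by simp

text \<open>The preimage in \<open>G\<close> of a normal subgroup of the image is normal; if it is
  trivial, so is the subgroup, since every element of it has a preimage.\<close>

lemma simple_transfer:
  assumes simple: "is_simple GP" and ne: "S.Gh \<noteq> {id}"
  shows "S.simple_action"
  unfolding S.simple_action_def
proof (intro conjI ne allI impI)
  interpret group GP by (rule group_GP)
  fix N assume N: "S.normal_sub N"
  have NG: "N \<subseteq> S.Gh" and Ns: "id \<in> N" "\<And>a b. a \<in> N \<Longrightarrow> b \<in> N \<Longrightarrow> a \<circ> b \<in> N" "\<And>a. a \<in> N \<Longrightarrow> pinv a \<in> N"
    and Nn: "\<And>n g. n \<in> N \<Longrightarrow> g \<in> S.Gh \<Longrightarrow> g \<circ> n \<circ> pinv g \<in> N"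
    using N unfolding S.normal_sub_def perm_subgroup_def by auto
  define N0 where "N0 = {g \<in> G. tot (verts T') g \<in> N}"
  have "N0 \<lhd> GP" unfolding normal_iff
  proof (intro conjI ballI)
    show "subgroup N0 GP"
    proof (rule subgroupI)
      show "N0 \<subseteq> carrier GP" by (auto simp: N0_def)
      have "\<one>\<^bsub>GP\<^esub> \<in> N0" using one_closed tot_one Ns(1) by (simp add: N0_def)
      then show "N0 \<noteq> {}" by blast
      show "inv\<^bsub>GP\<^esub> g \<in> N0" if "g \<in> N0" for g using that inv_closed[of g] tot_inv Ns(3) by (simp add: N0_def)
      show "g \<otimes>\<^bsub>GP\<^esub> h \<in> N0" if "g \<in> N0" "h \<in> N0" for g h
        using that m_closed[of g h] tot_mult Ns(2) by (simp add: N0_def)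
    qed
    fix g n assume g: "g \<in> G" and n: "n \<in> N0"
    then have nG: "n \<in> G" "tot (verts T') n \<in> N" by (auto simp: N0_def)
    have gn: "g \<otimes>\<^bsub>GP\<^esub> n \<in> G" "inv\<^bsub>GP\<^esub> g \<in> G" using m_closed[of g n] inv_closed[of g] g nG by auto
    then have "tot (verts T') (g \<otimes>\<^bsub>GP\<^esub> n \<otimes>\<^bsub>GP\<^esub> inv\<^bsub>GP\<^esub> g) = tot (verts T') g \<circ> tot (verts T') n \<circ> pinv (tot (verts T') g)"
      using tot_mult g nG tot_inv by simp
    moreover have "tot (verts T') g \<in> S.Gh" using g unfolding SGh by blast
    ultimately show "g \<otimes>\<^bsub>GP\<^esub> n \<otimes>\<^bsub>GP\<^esub> inv\<^bsub>GP\<^esub> g \<in> N0"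
      using Nn nG m_closed[of "g \<otimes>\<^bsub>GP\<^esub> n" "inv\<^bsub>GP\<^esub> g"] gn by (simp add: N0_def)
  qed
  then have "N0 = G \<or> N0 = {\<one>\<^bsub>GP\<^esub>}" using simple unfolding is_simple_def by auto
  then show "N = S.Gh \<or> N = {id}"
  proof
    assume "N0 = G"
    then have "S.Gh \<subseteq> N" unfolding SGh N0_def by blast
    then show ?thesis using NG by blast
  next
    assume *: "N0 = {\<one>\<^bsub>GP\<^esub>}"
    have "N \<subseteq> {id}"
    proof
      fix n assume n: "n \<in> N"
      then obtain g where g: "g \<in> G" "n = tot (verts T') g" using NG unfolding SGh by blast
      then have "g \<in> N0" using n by (simp add: N0_def)
      then show "n \<in> {id}" using * g tot_one by simp
    qed
    then show ?thesis using Ns(1) by blast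
  qed
qed

lemma simple_transfer_back:
  assumes simple: "S.simple_action" and inj: "inj_on (\<lambda>g. restrict g (verts T')) G"
  shows "is_simple GP"
  unfolding is_simple_def
proof (intro conjI allI impI)
  interpret group GP by (rule group_GP)
  show "group GP" by (rule group_GP)
  show "carrier GP \<noteq> {\<one>\<^bsub>GP\<^esub>}"
  proof
    assume "carrier GP = {\<one>\<^bsub>GP\<^esub>}"
    then have "G = {\<one>\<^bsub>GP\<^esub>}" by simp
    from arg_cong[OF this, of "image (tot (verts T'))"] have "S.Gh = {id}" unfolding SGh using tot_one by simp
    then show False using simple unfolding S.simple_action_def by blast
  qed
  fix N assume "N \<lhd> GP"
  then have N: "subgroup N GP" "\<And>g n. g \<in> G \<Longrightarrow> n \<in> N \<Longrightarrow> g \<otimes>\<^bsub>GP\<^esub> n \<otimes>\<^bsub>GP\<^esub> inv\<^bsub>GP\<^esub> g \<in> N"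
    unfolding normal_iff by auto
  have NG: "N \<subseteq> G" using subgroup.subset[OF N(1)] by simp
  let ?\<phi> = "tot (verts T')"
  have inj': "inj_on ?\<phi> G"
  proof (rule inj_onI)
    fix g h assume gh: "g \<in> G" "h \<in> G" "?\<phi> g = ?\<phi> h"
    then have "restrict g (verts T') = restrict h (verts T')" by (metis restrict_ext tot_in)
    then show "g = h" using inj gh by (auto dest: inj_onD)
  qed
  have "S.normal_sub (?\<phi> ` N)" unfolding S.normal_sub_def perm_subgroup_def
  proof (intro conjI ballI)
    show "?\<phi> ` N \<subseteq> S.Gh" using NG unfolding SGh by blast
    show "id \<in> ?\<phi> ` N" using subgroup.one_closed[OF N(1)] tot_one by (metis imageI)
    fix a assume "a \<in> ?\<phi> ` N"
    then obtain n where n: "n \<in> N" "a = ?\<phi> n" by blast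
    then have nG: "n \<in> G" using NG by blast
    show "pinv a \<in> ?\<phi> ` N" using subgroup.m_inv_closed[OF N(1) n(1)] tot_inv[OF nG] n by (metis imageI)
    show "a \<circ> b \<in> ?\<phi> ` N" if "b \<in> ?\<phi> ` N" for b
    proof -
      obtain k where k: "k \<in> N" "b = ?\<phi> k" using \<open>b \<in> ?\<phi> ` N\<close> by blast
      then show ?thesis using subgroup.m_closed[OF N(1) n(1) k(1)] tot_mult[of n k] nG NG n by (metis imageI subsetD)
    qed
    show "g \<circ> a \<circ> pinv g \<in> ?\<phi> ` N" if "g \<in> S.Gh" for g
    proof -
      obtain k where k: "k \<in> G" "g = ?\<phi> k" using \<open>g \<in> S.Gh\<close> unfolding SGh by blast
      have "?\<phi> (k \<otimes>\<^bsub>GP\<^esub> n \<otimes>\<^bsub>GP\<^esub> inv\<^bsub>GP\<^esub> k) = g \<circ> a \<circ> pinv g"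
        using tot_mult[of "k \<otimes>\<^bsub>GP\<^esub> n" "inv\<^bsub>GP\<^esub> k"] tot_mult[OF k(1) nG] tot_inv[OF k(1)] k n
          m_closed[of k n] inv_closed[of k] nG by simp
      then show ?thesis using N(2)[OF k(1) n(1)] by (metis imageI)
    qed
  qed
  then have "?\<phi> ` N = S.Gh \<or> ?\<phi> ` N = {id}" using simple unfolding S.simple_action_def by blast
  then show "N = carrier GP \<or> N = {\<one>\<^bsub>GP\<^esub>}"
  proof
    assume "?\<phi> ` N = S.Gh"
    then show ?thesis using inj_on_image_eq_iff[OF inj' NG, of G] unfolding SGh by simp
  next
    assume *: "?\<phi> ` N = {id}"
    have oG: "\<one>\<^bsub>GP\<^esub> \<in> G" using one_closed by simp
    then have "?\<phi> ` N = ?\<phi> ` {\<one>\<^bsub>GP\<^esub>}" using * tot_one by simp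
    then show ?thesis using inj_on_image_eq_iff[OF inj' NG, of "{\<one>\<^bsub>GP\<^esub>}"] oG by blast
  qed
qed

text \<open>An edge of \<open>T\<close> with an end outside \<open>T'\<close> crosses no edge of
  \<open>T'\<close>, so along a path from \<open>T'\<close> to \<open>x\<close> the sides change
  only at vertices of \<open>T'\<close>. It lets finite subsets of \<open>T\<close> be replaced by
  finite subsets of \<open>T'\<close>.\<close>

lemma gate:
  assumes "x \<in> verts T"
  shows "\<exists>y\<in>verts T'. \<forall>(a, b)\<in>adj T'. x \<in> A.half a b \<longleftrightarrow> y \<in> A.half a b"
proof -
  obtain r where r: "r \<in> verts T'" using sub(6) by blast
  then have "r \<in> verts T" using sub(2) by blast
  then show ?thesis using assms
  proof (induction rule: A.tree_induct)
    case root then show ?case using r by blast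
  next
    case (step x x')
    then obtain y where y: "y \<in> verts T'" "\<forall>(a, b)\<in>adj T'. x \<in> A.half a b \<longleftrightarrow> y \<in> A.half a b" by blast
    show ?case
    proof (cases "x' \<in> verts T'")
      case False
      have "x \<in> A.half a b \<longleftrightarrow> x' \<in> A.half a b" if ab: "(a, b) \<in> adj T'" for a b
        using A.half_crossing[OF _ step(1), of a b] A.half_crossing[OF _ A.E_sym[OF step(1)], of a b]
          ab adj_sub S.E_V[OF ab] False by blast
      then show ?thesis using y by blast
    qed blast
  qed
qed

end

section \<open>The equivalence\<close>

context invariant_setting
begin

lemma nbr_ex: assumes "infinite (verts T')" "w \<in> verts T'" shows "\<exists>a. (w, a) \<in> adj T'"
proof -
  obtain z where "z \<in> verts T'" "z \<noteq> w" using assms by (metis finite.emptyI finite_insert finite_subset insert_iff subsetI)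
  then show ?thesis using S.half_toward[OF assms(2)] by blast
qed

text \<open>The diagram speaks of one representative per orbit; \<open>local_gen_translate\<close>
  carries generation to the other vertices of the orbit.\<close>

lemma irreducible_from_diagram:
  assumes irr: "irreducible_diagram S.\<Delta>" and Q: "is_tree S.\<Gamma>" and inf: "infinite (verts T')"
    and gen: "\<And>v. v \<in> verts S.\<Gamma> \<Longrightarrow> generated_by_point_stabilisers (colours_at S.\<Delta> v) (local_group S.\<Delta> v)"
    and nontriv: "\<exists>v\<in>verts S.\<Gamma>. local_group S.\<Delta> v \<noteq> {\<one>\<^bsub>BijGroup (colours_at S.\<Delta> v)\<^esub>}"
  shows "irreducible_action (verts T') (adj T') S.Gh"
proof
  show "M = {}" if "S.arc_scopo M" for M using S.arc_scopo_empty[OF irr that] .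
  show "S.local_gen x" if x: "x \<in> verts T'" for x
  proof -
    let ?w = "rep (S.cls x)"
    obtain h where h: "h \<in> S.Gh" "?w = h x" using S.rep_cls(1)[OF x] by blast
    obtain a where a: "(?w, a) \<in> adj T'" using nbr_ex[OF inf S.rep_cls(2)[OF x]] by blast
    have "S.cls x \<in> verts S.\<Gamma>" using x by (simp add: S.verts_\<Gamma>)
    then have "generated_by_point_stabilisers (out_arcs T' ?w) (S.locs ?w)"
      using gen S.colours_at_\<Delta>[OF x] S.local_group_eq_locs[OF x] by metis
    then have "S.local_gen ?w" by (rule S.local_gen_if_generated[OF a])
    then have "S.local_gen (pinv h ?w)" using S.local_gen_translate S.G_inv[OF h(1)] by blast
    then show ?thesis using h by simp
  qed
  show "\<exists>v y g. (v, y) \<in> adj T' \<and> g \<in> S.Gh \<and> g v = v \<and> g y \<noteq> y"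
  proof -
    obtain x where x: "x \<in> verts T'"
      and ne: "local_group S.\<Delta> (S.cls x) \<noteq> {\<one>\<^bsub>BijGroup (colours_at S.\<Delta> (S.cls x))\<^esub>}"
      using nontriv unfolding S.verts_\<Gamma> by blast
    have "S.locs (rep (S.cls x)) \<noteq> {\<lambda>b\<in>out_arcs T' (rep (S.cls x)). b}"
      using ne unfolding S.local_group_eq_locs[OF x] S.colours_at_\<Delta>[OF x] BijGroup_one .
    then show ?thesis using S.locs_trivial_iff[OF S.rep_cls(2)[OF x]] by blast
  qed
  show "S.Gh \<subseteq> M" if "perm_subgroup M" "M \<subseteq> S.Gh" "\<And>g x. g \<in> S.Gh \<Longrightarrow> x \<in> verts T' \<Longrightarrow> g x = x \<Longrightarrow> g \<in> M" for M
    using S.vertex_gen_if_tree[OF Q that] .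
qed

text \<open>A half-tree of \<open>T'\<close> that avoids the gates of \<open>F\<close> supports a
  non-trivial element on \<open>T'\<close>. By (P) in \<open>T\<close> it can be made trivial on the
  opposite half-tree of \<open>T\<close>, which contains \<open>F\<close>.\<close>

lemma no_finite_base:
  assumes "irreducible_action (verts T') (adj T') S.Gh"
    and F: "finite F" "F \<subseteq> verts T"
  shows "fixator G F \<noteq> {\<one>\<^bsub>aut_group T\<^esub>}"
proof -
  interpret I: irreducible_action "verts T'" "adj T'" S.Gh by (rule assms(1))
  have "\<forall>x\<in>F. \<exists>y. y \<in> verts T' \<and> (\<forall>(a, b)\<in>adj T'. x \<in> A.half a b \<longleftrightarrow> y \<in> A.half a b)"
    using gate F(2) by blast
  from bchoice[OF this] obtain \<rho> where \<rho>: "\<forall>x\<in>F. \<rho> x \<in> verts T' \<and> (\<forall>(a, b)\<in>adj T'. x \<in> A.half a b \<longleftrightarrow> \<rho> x \<in> A.half a b)"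
    by blast
  obtain b b' where b: "(b, b') \<in> adj T'" "S.half b b' \<inter> \<rho> ` F = {}"
    using I.half_avoiding[of "\<rho> ` F"] F(1) by blast
  have bT: "(b, b') \<in> adj T" using b adj_sub by blast
  have Fb: "x \<in> A.half b' b" if x: "x \<in> F" for x
  proof -
    have "\<rho> x \<notin> A.half b b'" using half'[OF b(1), of "\<rho> x"] \<rho> b(2) x by blast
    then have "x \<notin> A.half b b'" using \<rho> x b(1) by blast
    then show ?thesis using A.half_iff[OF bT] x F(2) by blast
  qed
  obtain f where f: "f \<in> S.Gh" "f \<noteq> id" "\<And>z. z \<notin> S.half b b' \<Longrightarrow> f z = z"
    by (rule I.rigid_nontrivial[OF b(1)]) blast
  obtain k where k: "k \<in> G" "f = tot (verts T') k" using f(1) unfolding SGh by blast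
  have bV: "b \<in> verts T'" "b' \<in> verts T'" using S.E_V[OF b(1)] by auto
  have fb: "f b = b" using f(3) S.half_ends(2)[OF b(1)] .
  \<comment> \<open>If \<open>f b'\<close> were another neighbour of \<open>b\<close>, it would lie
    off \<open>half b b'\<close>, where \<open>f\<close> is trivial, against injectivity. So the
    edge is fixed and (P) can be applied to it.\<close>
  have fb': "f b' = b'"
  proof (rule ccontr)
    assume ne: "f b' \<noteq> b'"
    have e: "(b, f b') \<in> adj T'" using S.G_E[OF f(1) b(1)] fb by simp
    have "f b' \<notin> S.half b b'" by (rule S.sibling_half(3)[OF e b(1) ne])
    then have "f (f b') = f b'" by (rule f(3))
    then show False using ne S.G_inj[OF f(1)] by blast
  qed
  have kb: "k b = b" "k b' = b'" using fb fb' k(2) bV by auto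
  obtain k' where k': "k' \<in> G" "\<forall>z\<in>A.half b b'. k' z = k z" "\<forall>z\<in>A.half b' b. k' z = z"
    using edge_indep[OF bT k(1) kb] by blast
  obtain z where z: "f z \<noteq> z" using f(2) by (auto simp: fun_eq_iff)
  then have zS: "z \<in> S.half b b'" using f(3) by blast
  then have zV: "z \<in> verts T'" using S.half_sub by blast
  have "k' z \<noteq> z" using k'(2) half'[OF b(1) zV] zS z k(2) zV by simp
  moreover have "\<one>\<^bsub>aut_group T\<^esub> z = z" using zV sub(2) by (auto simp: aut_group_def perm_group_def BijGroup_def)
  ultimately have "k' \<noteq> \<one>\<^bsub>aut_group T\<^esub>" by auto
  moreover have "k' \<in> fixator G F" using k' Fb unfolding fixator_def by blast
  ultimately show ?thesis by blast
qed

lemma translation_from_irreducible: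
  assumes "irreducible_action (verts T') (adj T') S.Gh"
  shows "acts_with_translation T G"
proof -
  interpret I: irreducible_action "verts T'" "adj T'" S.Gh by (rule assms)
  obtain f and p :: "int \<Rightarrow> 'v" and m :: int
    where f: "f \<in> S.Gh" and p: "m \<noteq> 0" "inj p" "\<forall>i. (p i, p (i + 1)) \<in> adj T'" "\<forall>i. f (p i) = p (i + m)"
    using I.translation_exists by blast
  obtain g where g: "g \<in> G" "f = tot (verts T') g" using f unfolding SGh by blast
  have pV: "p i \<in> verts T'" for i using p(3) S.E_V by blast
  have gp: "g (p i) = p (i + m)" for i using p(4) g(2) pV by (metis tot_in)
  show ?thesis unfolding acts_with_translation_def
  proof (intro bexI[OF _ g(1)] exI[of _ p] conjI allI)
    show "simple_path T UNIV p"
      unfolding simple_path_def using pV sub(2) p(2,3) adj_sub by auto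
    show "g ` range p = range p"
    proof (intro equalityI subsetI)
      fix z assume "z \<in> range p"
      then obtain i where "z = p i" by blast
      then have "z = g (p (i - m))" using gp by simp
      then show "z \<in> g ` range p" by blast
    qed (use gp in auto)
    show "\<exists>j. g (p i) = p j \<and> g (p (i + 1)) = p (j + 1)" for i
      using gp by (intro exI[of _ "i + m"]) (simp add: algebra_simps)
    show "g (p i) \<noteq> p i" for i using gp p(1,2) by (simp add: inj_eq)
  qed
qed

text \<open>The kernel of the action on \<open>T'\<close> is normal and does not contain
  \<open>g\<close>, so simplicity makes it trivial.\<close>

lemma faithful_if_simple:
  assumes simple: "is_simple GP" and g: "g \<in> G" "x \<in> verts T'" "g x \<noteq> x"
  shows "inj_on (\<lambda>g. restrict g (verts T')) G"
proof -
  interpret group GP by (rule group_GP)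
  define N where "N = {g \<in> G. tot (verts T') g = id}"
  have "N \<lhd> GP" unfolding normal_iff
  proof (intro conjI ballI)
    show "subgroup N GP"
    proof (rule subgroupI)
      show "N \<subseteq> carrier GP" by (auto simp: N_def)
      show "N \<noteq> {}" using one_closed tot_one by (auto simp: N_def)
      show "inv\<^bsub>GP\<^esub> h \<in> N" if "h \<in> N" for h using that inv_closed[of h] tot_inv inv_id by (simp add: N_def)
      show "h \<otimes>\<^bsub>GP\<^esub> k \<in> N" if "h \<in> N" "k \<in> N" for h k
        using that m_closed[of h k] tot_mult by (simp add: N_def)
    qed
    fix h n assume h: "h \<in> G" and n: "n \<in> N"
    then have nG: "n \<in> G" "tot (verts T') n = id" by (auto simp: N_def)
    have hn: "h \<otimes>\<^bsub>GP\<^esub> n \<in> G" "inv\<^bsub>GP\<^esub> h \<in> G" using m_closed[of h n] inv_closed[of h] h nG by auto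
    have "tot (verts T') h \<circ> tot (verts T') (inv\<^bsub>GP\<^esub> h) = id"
      using tot_mult[OF h hn(2)] tot_one r_inv[of h] h by simp
    then have "tot (verts T') (h \<otimes>\<^bsub>GP\<^esub> n \<otimes>\<^bsub>GP\<^esub> inv\<^bsub>GP\<^esub> h) = id"
      using tot_mult[OF hn] tot_mult[OF h nG(1)] nG by simp
    then show "h \<otimes>\<^bsub>GP\<^esub> n \<otimes>\<^bsub>GP\<^esub> inv\<^bsub>GP\<^esub> h \<in> N"
      using m_closed[of "h \<otimes>\<^bsub>GP\<^esub> n" "inv\<^bsub>GP\<^esub> h"] hn by (simp add: N_def)
  qed
  moreover have "g \<notin> N" using g by (auto simp: N_def dest: fun_cong[of _ _ x])
  ultimately have N1: "N = {\<one>\<^bsub>GP\<^esub>}" using simple g(1) unfolding is_simple_def by auto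
  show ?thesis
  proof (rule inj_onI)
    fix h k assume h: "h \<in> G" and k: "k \<in> G" and eq: "restrict h (verts T') = restrict k (verts T')"
    have i: "inv\<^bsub>GP\<^esub> h \<in> G" using inv_closed[of h] h by simp
    have "tot (verts T') h = tot (verts T') k" using eq by (metis tot_restrict)
    then have "tot (verts T') (inv\<^bsub>GP\<^esub> h \<otimes>\<^bsub>GP\<^esub> k) = tot (verts T') (inv\<^bsub>GP\<^esub> h) \<circ> tot (verts T') h"
      using tot_mult[OF i k] by simp
    also have "\<dots> = id" using tot_mult[OF i h] tot_one l_inv[of h] h by simp
    finally have "inv\<^bsub>GP\<^esub> h \<otimes>\<^bsub>GP\<^esub> k \<in> N" using m_closed[of "inv\<^bsub>GP\<^esub> h" k] i k by (simp add: N_def)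
    then have "inv\<^bsub>GP\<^esub> h \<otimes>\<^bsub>GP\<^esub> k = \<one>\<^bsub>GP\<^esub>" using N1 by blast
    then show "h = k" using h k by (metis carrier_GP inv_closed inv_equality inv_inv)
  qed
qed

lemma faithful_action_iff:
  "faithful_action GP (verts T') (\<lambda>g. restrict g (verts T')) \<longleftrightarrow> inj_on (\<lambda>g. restrict g (verts T')) G"
proof -
  have B: "restrict g (verts T') \<in> Bij (verts T')" if "g \<in> G" for g
    using S.G_Bij that by (auto simp: induced_on_def)
  have "group_hom GP (BijGroup (verts T')) (\<lambda>g. restrict g (verts T'))"
  proof (intro group_hom.intro group_GP group_BijGroup group_hom_axioms.intro homI)
    show "restrict g (verts T') \<in> carrier (BijGroup (verts T'))" if "g \<in> carrier GP" for g
      using B that by (simp add: BijGroup_def)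
    show "restrict (g \<otimes>\<^bsub>GP\<^esub> h) (verts T') = restrict g (verts T') \<otimes>\<^bsub>BijGroup (verts T')\<^esub> restrict h (verts T')"
      if "g \<in> carrier GP" "h \<in> carrier GP" for g h
      using that mult_GP[of g h] BijGroup_mult[OF B B, of g h] G_verts'_mem[of h] sub(2)
      by (auto simp: fun_eq_iff compose_def)
  qed
  then show ?thesis
    by (simp add: faithful_action_def group_action_def faithful_action_axioms_def)
qed

text \<open>Faithfulness turns \<open>base\<close> into non-trivial vertex stabilisers on
  \<open>T'\<close>, which feed all arguments with families of functions; the axis and its
  minimality are for irreducibility.\<close>

lemma diagram_from_simple:
  fixes p :: "int \<Rightarrow> 'v" and m :: int
  assumes simple: "is_simple GP"
    and base: "\<And>F. finite F \<Longrightarrow> F \<subseteq> verts T \<Longrightarrow> fixator G F \<noteq> {\<one>\<^bsub>aut_group T\<^esub>}"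
    and p: "inj p" "\<And>i. (p i, p (i + 1)) \<in> adj T'" and m: "m \<noteq> 0"
    and g: "g \<in> G" "\<And>i. g (p i) = p (i + m)"
    and minimal: "\<And>W. S.convex W \<Longrightarrow> (\<And>h. h \<in> S.Gh \<Longrightarrow> h ` W = W) \<Longrightarrow> range p \<subseteq> W \<Longrightarrow> W = verts T'"
  shows "simplicity_subtree T G rep T'"
proof -
  have pV: "p i \<in> verts T'" for i using p(2) S.E_V by blast
  have g0: "g (p 0) \<noteq> p 0" using g(2) p(1) m by (simp add: inj_eq)
  have inj: "inj_on (\<lambda>g. restrict g (verts T')) G" by (rule faithful_if_simple[OF simple g(1) pV g0])
  let ?g = "tot (verts T') g"
  have gS: "?g \<in> S.Gh" "\<And>i. ?g (p i) = p (i + m)" using g pV unfolding SGh by auto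
  have "S.Gh \<noteq> {id}" using gS g0 g pV by (metis id_apply singletonD tot_in)
  then have simple': "S.simple_action" by (rule simple_transfer[OF simple])
  have stab: "\<exists>h\<in>S.Gh. h \<noteq> id \<and> h x = x" if x: "x \<in> verts T'" for x
  proof -
    have one: "\<one>\<^bsub>aut_group T\<^esub> = (\<lambda>v\<in>verts T. v)" by (simp add: aut_group_def perm_group_def BijGroup_def)
    have "\<one>\<^bsub>aut_group T\<^esub> \<in> fixator G {x}" using x sub(2) one_G unfolding one fixator_def by auto
    moreover have "fixator G {x} \<noteq> {\<one>\<^bsub>aut_group T\<^esub>}" using base[of "{x}"] x sub(2) by blast
    ultimately obtain k where k: "k \<in> fixator G {x}" "k \<noteq> (\<lambda>v\<in>verts T. v)" unfolding one by blast
    then have kG: "k \<in> G" "k x = x" by (auto simp: fixator_def)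
    have "tot (verts T') k \<noteq> id"
    proof
      assume "tot (verts T') k = id"
      then have "k v = v" if "v \<in> verts T'" for v using that by (metis id_apply tot_in)
      then have "restrict k (verts T') = restrict (\<lambda>v\<in>verts T. v) (verts T')" using sub(2) by (auto simp: fun_eq_iff)
      then show False using inj_onD[OF inj _ kG(1) one_G] k(2) by simp
    qed
    then show ?thesis using kG x unfolding SGh by (intro bexI[of _ "tot (verts T') k"]) auto
  qed
  have sta: "simple_tree_action (verts T') (adj T') S.Gh"
    by unfold_locales (use simple' stab in auto)
  interpret Q: simple_tree_action "verts T'" "adj T'" S.Gh by (rule sta)
  have tree_\<Gamma>: "is_tree S.\<Gamma>" by (rule S.tree_if_simple[OF sta])
  have irr: "irreducible_diagram S.\<Delta>"
    by (rule S.irreducible_if_arc_scopo_empty) (rule Q.scopo_empty[OF p m gS minimal])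
  have inf: "infinite (verts T')"
  proof
    assume "finite (verts T')"
    then have "finite (range p)" by (rule rev_finite_subset) (use pV in auto)
    then show False using finite_imageD[OF _ p(1)] by (simp add: infinite_UNIV_int)
  qed
  have loc: "closedin (perm_topology (colours_at S.\<Delta> v)) (local_group S.\<Delta> v) \<and>
      generated_by_point_stabilisers (colours_at S.\<Delta> v) (local_group S.\<Delta> v)" if v: "v \<in> verts S.\<Gamma>" for v
  proof -
    obtain x where x: "x \<in> verts T'" "v = S.cls x" using v unfolding S.verts_\<Gamma> by blast
    let ?w = "rep (S.cls x)"
    have w: "?w \<in> verts T'" by (rule S.rep_cls(2)[OF x(1)])
    obtain a where a: "(?w, a) \<in> adj T'" using nbr_ex[OF inf w] by blast
    have "S.local_gen ?w" by (rule Q.simple_local_gen[OF a]) (rule S.no_loop_if_tree[OF tree_\<Gamma>])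
    then have "generated_by_point_stabilisers (out_arcs T' ?w) (S.locs ?w)"
      by (rule S.generated_if_local_gen[OF w])
    then show ?thesis unfolding x(2) S.colours_at_\<Delta>[OF x(1)]
      using S.local_group_\<Delta>[OF x(1)] S.local_group_eq_locs[OF x(1)] by (metis closedin_closure_of)
  qed
  have "\<exists>v\<in>verts S.\<Gamma>. local_group S.\<Delta> v \<noteq> {\<one>\<^bsub>BijGroup (colours_at S.\<Delta> v)\<^esub>}"
  proof (rule ccontr)
    \<comment> \<open>If all local groups were trivial, an element fixing a vertex would fix its
      neighbours and so, step by step, all of \<open>T'\<close>, against
      \<open>stab\<close>.\<close>
    assume c: "\<not> ?thesis"
    have triv: "h y = y" if h: "h \<in> S.Gh" "h x = x" and e: "(x, y) \<in> adj T'" for h x y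
    proof -
      have x: "x \<in> verts T'" using S.E_V e by blast
      let ?w = "rep (S.cls x)"
      have "S.cls x \<in> verts S.\<Gamma>" using x by (simp add: S.verts_\<Gamma>)
      then have "S.locs ?w = {\<lambda>b\<in>out_arcs T' ?w. b}"
        using c unfolding BijGroup_one by (metis S.local_group_eq_locs[OF x] S.colours_at_\<Delta>[OF x])
      then have L: "\<forall>g\<in>S.Gh. g ?w = ?w \<longrightarrow> (\<forall>y. (?w, y) \<in> adj T' \<longrightarrow> g y = y)"
        using S.locs_trivial_iff[OF S.rep_cls(2)[OF x]] by blast
      obtain k where k: "k \<in> S.Gh" "?w = k x" using S.rep_cls(1)[OF x] by blast
      have "k \<circ> (h \<circ> pinv k) \<in> S.Gh" using k h by (simp add: S.G_comp S.G_inv)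
      moreover have "(k \<circ> (h \<circ> pinv k)) ?w = ?w" using k h by simp
      moreover have "(?w, k y) \<in> adj T'" using S.G_E[OF k(1) e] k(2) by simp
      ultimately have "(k \<circ> (h \<circ> pinv k)) (k y) = k y" using L by blast
      then show ?thesis using k S.G_inj[OF k(1)] by simp
    qed
    obtain n where n: "n \<in> S.Gh" "n \<noteq> id" "n (p 0) = p 0" using stab[OF pV] by blast
    have "n y = id y" if "y \<in> verts T'" for y
      using pV[of 0] that
    proof (induction rule: S.tree_induct)
      case root then show ?case using n by simp
    next
      case (step x y) then show ?case using triv[OF n(1) _ step(1)] by simp
    qed
    then show False using S.G_eqI[OF n(1) S.G_id] n(2) by blast
  qed
  then show ?thesis
    unfolding simplicity_subtree_def Let_def S.base_\<Delta> faithful_action_iff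
    using invariant inf inj irr tree_\<Gamma> loc by blast
qed

end

section \<open>The smallest invariant subtree around an axis\<close>

context closed_setting
begin

text \<open>The invariant subtree of (ii) is the smallest one containing the axis of the translation.\<close>

lemma simplicity_subtree_if_simple:
  assumes simple: "is_simple GP" and trans: "acts_with_translation T G"
    and base: "\<And>F. finite F \<Longrightarrow> F \<subseteq> verts T \<Longrightarrow> fixator G F \<noteq> {\<one>\<^bsub>aut_group T\<^esub>}"
  shows "\<exists>T'. simplicity_subtree T G rep T'"
proof -
  obtain g p where g: "g \<in> G" and path: "simple_path T UNIV p"
    and shift: "\<forall>i. \<exists>j. g (p i) = p j \<and> g (p (i + 1)) = p (j + 1)" and nofix: "\<forall>i. g (p i) \<noteq> p i"
    using trans unfolding acts_with_translation_def by blast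
  have p: "inj p" "\<And>i. (p i, p (i + 1)) \<in> adj T" "range p \<subseteq> verts T"
    using path unfolding simple_path_def by auto
  obtain m where m: "g (p 0) = p m" using shift by blast
  have step: "g (p (i + 1)) = p (j + 1)" if "g (p i) = p j" for i j
  proof -
    obtain j' where "g (p i) = p j'" "g (p (i + 1)) = p (j' + 1)" using shift by blast
    then show ?thesis using that p(1) by (simp add: inj_eq)
  qed
  have step': "g (p (i - 1)) = p (j - 1)" if ij: "g (p i) = p j" for i j
  proof -
    obtain j' where j': "g (p (i - 1)) = p j'" using shift by blast
    then have "g (p i) = p (j' + 1)" using step[OF j'] by simp
    then have "j = j' + 1" using ij p(1) by (simp add: inj_eq)
    then show ?thesis using j' by simp
  qed
  \<comment> \<open>Preserving the orientation forces the shift \<open>m\<close> found at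
    \<open>p 0\<close> at every point of the path.\<close>
  have gp: "g (p i) = p (i + m)" for i
  proof (induction i rule: int_induct[where k = 0])
    case base then show ?case using m by simp
  next
    case (step1 i) then show ?case using step[OF step1(2)] by (simp add: algebra_simps)
  next
    case (step2 i) then show ?case using step'[OF step2(2)] by (simp add: algebra_simps)
  qed
  have m0: "m \<noteq> 0" using nofix gp[of 0] by auto
  define \<W> where "\<W> = {W. A.convex W \<and> (\<forall>h\<in>G. h ` W = W) \<and> range p \<subseteq> W}"
  have VW: "verts T \<in> \<W>" unfolding \<W>_def A.convex_def using A.E_V BijD(2)[OF A.G_Bij] p(3) by auto
  define W0 where "W0 = \<Inter>\<W>"
  have W0_sub: "W0 \<subseteq> verts T" using VW unfolding W0_def by blast
  have pW: "range p \<subseteq> W0" unfolding W0_def \<W>_def by blast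
  have W0_convex: "A.convex W0" unfolding A.convex_def
  proof (intro conjI W0_sub ballI allI impI)
    fix x y assume x: "x \<in> W0" and y: "(x, y) \<in> adj T \<and> W0 \<inter> A.half x y \<noteq> {}"
    show "y \<in> W0" unfolding W0_def
    proof
      fix W assume W: "W \<in> \<W>"
      then have "W0 \<subseteq> W" unfolding W0_def by blast
      then show "y \<in> W" using W x y unfolding \<W>_def A.convex_def by blast
    qed
  qed
  have W0_into: "h x \<in> W0" if "h \<in> G" "x \<in> W0" for h x
    using that unfolding W0_def \<W>_def by blast
  have W0_G: "h ` W0 = W0" if h: "h \<in> G" for h
  proof
    show "h ` W0 \<subseteq> W0" using W0_into h by blast
    show "W0 \<subseteq> h ` W0"
    proof
      fix x assume x: "x \<in> W0"
      note i = inv_GP[OF h]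
      have "h ((inv\<^bsub>GP\<^esub> h) x) = x" using i(3) x W0_sub by blast
      then show "x \<in> h ` W0" using W0_into[OF i(1) x] by (metis imageI)
    qed
  qed
  define T' where "T' = \<lparr>verts = W0, arcs = {a \<in> arcs T. orig T a \<in> W0 \<and> terminus T a \<in> W0},
    orig = orig T, arev = arev T\<rparr>"
  have T'_sel: "verts T' = W0" "arcs T' = {a \<in> arcs T. orig T a \<in> W0 \<and> terminus T a \<in> W0}"
    "orig T' = orig T" "arev T' = arev T" by (simp_all add: T'_def)
  have term': "terminus T' = terminus T" by (simp add: terminus_def fun_eq_iff T'_sel)
  have adj': "adj T' = adj T \<inter> W0 \<times> W0" unfolding adj_def term' T'_sel by blast
  have inv_sub: "invariant_subtree T G T'"
    unfolding invariant_subtree_def subtree_def subgraph_def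
  proof (intro conjI ballI)
    show "is_graph T'" unfolding is_graph_def T'_sel using A.arcD by auto
    show "verts T' \<noteq> {}" using pW by (auto simp: T'_sel)
    show "connected_graph T'" unfolding connected_graph_def adj' T'_sel
      using A.convex_connected[OF W0_convex] by blast
    show "h ` verts T' = verts T'" if "h \<in> G" for h using W0_G[OF that] by (simp add: T'_sel)
    have into: "arc_map T h a \<in> arcs T'" if h: "h \<in> G" and a: "a \<in> arcs T'" for h a
    proof -
      have aT: "a \<in> arcs T" "orig T a \<in> W0" "terminus T a \<in> W0" using a by (auto simp: T'_sel)
      have "tot (verts T) h \<in> A.Gh" using h by (simp add: A.Gh_def)
      from A.arc_map_Gh[OF this aT(1)] show ?thesis
        using aT A.arcD(1,4)[OF aT(1)] W0_into[OF h] by (simp add: T'_sel)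
    qed
    show "arc_map T h ` arcs T' = arcs T'" if h: "h \<in> G" for h
    proof
      show "arc_map T h ` arcs T' \<subseteq> arcs T'" using into[OF h] by blast
      show "arcs T' \<subseteq> arc_map T h ` arcs T'"
      proof
        fix a assume a: "a \<in> arcs T'"
        then have aT: "a \<in> arcs T" by (simp add: T'_sel)
        note i = inv_GP[OF h]
        have hG: "tot (verts T) h \<in> A.Gh" "tot (verts T) (inv\<^bsub>GP\<^esub> h) \<in> A.Gh" using h i(1) by (auto simp: A.Gh_def)
        let ?b = "arc_map T (inv\<^bsub>GP\<^esub> h) a"
        have b: "?b \<in> arcs T'" by (rule into[OF i(1) a])
        then have bT: "?b \<in> arcs T" by (simp add: T'_sel)
        have "arc_map T h ?b = a"
          by (rule A.arc_eqI)
            (use A.arc_map_Gh[OF hG(1) bT] A.arc_map_Gh[OF hG(2) aT] bT aT A.arcD(1,4)[OF aT] A.arcD(1,4)[OF bT] i(3) in auto)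
        then show "a \<in> arc_map T h ` arcs T'" using b by (metis imageI)
      qed
    qed
  qed (use W0_sub in \<open>auto simp: T'_sel\<close>)
  interpret I: invariant_setting T G rep T' by unfold_locales (rule inv_sub)
  have "simplicity_subtree T G rep T'"
  proof (rule I.diagram_from_simple[OF simple base p(1) _ m0 g gp])
    show "(p i, p (i + 1)) \<in> adj T'" for i using p(2) pW by (auto simp: adj')
    fix W assume W: "I.S.convex W" "\<And>h. h \<in> I.S.Gh \<Longrightarrow> h ` W = W" "range p \<subseteq> W"
    have "W \<subseteq> verts T'" using W(1) unfolding I.S.convex_def by blast
    then have WW0: "W \<subseteq> W0" by (simp add: T'_sel)
    \<comment> \<open>Minimality inside \<open>T'\<close> reduces to the intersection taken in
      \<open>T\<close>: as \<open>W0\<close> is convex in \<open>T\<close>, a set convex in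
      \<open>T'\<close> is convex in \<open>T\<close>.\<close>
    have "A.convex W" unfolding A.convex_def
    proof (intro conjI ballI allI impI)
      show "W \<subseteq> verts T" using WW0 W0_sub by blast
      fix x y assume x: "x \<in> W" and y: "(x, y) \<in> adj T \<and> W \<inter> A.half x y \<noteq> {}"
      then obtain z where z: "z \<in> W" "z \<in> A.half x y" by blast
      have "y \<in> W0" using W0_convex x y z WW0 unfolding A.convex_def by blast
      then have e: "(x, y) \<in> adj T'" using x y WW0 by (auto simp: adj')
      then have "z \<in> I.S.half x y" using I.half'[OF e, of z] z WW0 by (auto simp: T'_sel)
      then show "y \<in> W" using W(1) x e z unfolding I.S.convex_def by blast
    qed
    moreover have "h ` W = W" if h: "h \<in> G" for h
    proof -
      have "tot (verts T') h ` W = W" using W(2) h unfolding I.SGh by blast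
      moreover have "tot (verts T') h ` W = h ` W" using WW0 by (intro image_cong) (auto simp: T'_sel)
      ultimately show ?thesis by simp
    qed
    ultimately have "W \<in> \<W>" using W(3) unfolding \<W>_def by blast
    then have "W0 \<subseteq> W" unfolding W0_def by blast
    then show "W = verts T'" using WW0 by (simp add: T'_sel)
  qed
  then show ?thesis by blast
qed

end

text \<open>The vertices of a quotient graph are orbits, so a single choice function
  \<open>rep\<close> on nonempty sets of vertices selects representatives for the diagrams of all
  subtrees at once. The description as a universal group is asserted for every subtree as in
  (ii).\<close>

theorem theorem1p8:
  fixes T :: "('v, 'a) graph" and G :: "('v \<Rightarrow> 'v) set" and rep :: "'v set \<Rightarrow> 'v"
  assumes "is_tree T"
    and "subgroup G (aut_group T)"
    and "P_closed T G"
    and "strongly_closed T G"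
    and "\<And>S. S \<noteq> {} \<Longrightarrow> rep S \<in> S"
  shows "(is_simple (perm_group (verts T) G) \<and> acts_with_translation T G \<and>
            \<not> (\<exists>F. finite F \<and> F \<subseteq> verts T \<and> fixator G F = {\<one>\<^bsub>aut_group T\<^esub>})
          \<longleftrightarrow> (\<exists>T'. simplicity_subtree T G rep T')) \<and>
         (\<forall>T'. simplicity_subtree T G rep T' \<longrightarrow>
            (\<exists>\<pi>V \<pi>A \<L>. diagram_tree (local_action_diagram T' (induced_on T' G) rep) T' \<pi>V \<pi>A \<L> \<and>
               induced_on T' G =
                 universal_group (local_action_diagram T' (induced_on T' G) rep) T' \<pi>V \<pi>A \<L>))"
proof -
  interpret C: closed_setting T G rep
    by (rule closed_setting.intro[OF assms(1-4)]) (rule assms(5))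
  have inv: "invariant_setting T G rep T'" if "simplicity_subtree T G rep T'" for T'
    by unfold_locales (use that in \<open>simp add: simplicity_subtree_def\<close>)
  have "is_simple (perm_group (verts T) G) \<and> acts_with_translation T G \<and>
      \<not> (\<exists>F. finite F \<and> F \<subseteq> verts T \<and> fixator G F = {\<one>\<^bsub>aut_group T\<^esub>})"
    if T': "simplicity_subtree T G rep T'" for T'
  proof -
    interpret I: invariant_setting T G rep T' by (rule inv[OF T'])
    have D: "infinite (verts T')" "inj_on (\<lambda>g. restrict g (verts T')) G" "irreducible_diagram I.S.\<Delta>" "is_tree I.S.\<Gamma>"
      "\<And>v. v \<in> verts I.S.\<Gamma> \<Longrightarrow> generated_by_point_stabilisers (colours_at I.S.\<Delta> v) (local_group I.S.\<Delta> v)"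
      "\<exists>v\<in>verts I.S.\<Gamma>. local_group I.S.\<Delta> v \<noteq> {\<one>\<^bsub>BijGroup (colours_at I.S.\<Delta> v)\<^esub>}"
      using T' unfolding simplicity_subtree_def Let_def I.S.base_\<Delta> I.faithful_action_iff by blast+
    have irr: "irreducible_action (verts T') (adj T') I.S.Gh"
      by (rule I.irreducible_from_diagram[OF D(3,4,1,5,6)])
    have "I.S.simple_action" using irreducible_action.simple[OF irr] .
    then have "is_simple (perm_group (verts T) G)" by (rule I.simple_transfer_back[OF _ D(2)])
    then show ?thesis using I.translation_from_irreducible[OF irr] I.no_finite_base[OF irr] by blast
  qed
  moreover have "\<exists>T'. simplicity_subtree T G rep T'"
    if "is_simple (perm_group (verts T) G)" "acts_with_translation T G"
      "\<not> (\<exists>F. finite F \<and> F \<subseteq> verts T \<and> fixator G F = {\<one>\<^bsub>aut_group T\<^esub>})"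
    by (rule C.simplicity_subtree_if_simple[OF that(1,2)]) (use that(3) in blast)
  moreover have "\<exists>\<pi>V \<pi>A \<L>. diagram_tree (local_action_diagram T' (induced_on T' G) rep) T' \<pi>V \<pi>A \<L> \<and>
      induced_on T' G = universal_group (local_action_diagram T' (induced_on T' G) rep) T' \<pi>V \<pi>A \<L>"
    if T': "simplicity_subtree T G rep T'" for T'
  proof -
    interpret I: invariant_setting T G rep T' by (rule inv[OF T'])
    show ?thesis by (rule I.S.eq_universal_group)
  qed
  ultimately show ?thesis by blast
qed

end
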